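(* Let $(u_0,v_0)\in L^2(\Omega)\times L^2(\Omega)$ and let $(u,v)$ be the weak solution, defined for all times $t\ge 0$, of the system $$u_t-a(l(u))\,\Delta u+f(u-v)=\alpha(u-v),$$ $$v_t-a(l(v))\,\Delta v-f(u-v)=\alpha(v-u)$$ in $\Omega\times(0,\infty)$, with $u=v=0$ on $\partial\Omega\times(0,\infty)$ and $u(x,0)=u_0(x)$, $v(x,0)=v_0(x)$ in $\Omega$. Suppose that $$m>2\,c_p\,(M_1+\alpha)>0,$$ where $c_p$ is the constant of the Poincaré inequality. Then there exist positive constants $C$ and $\eta$ such that $$E(t)\le C\,E(0)\,e^{-\eta t}\qquad\text{for all }t\ge 0,$$ where $E(t)=\frac12\int_\Omega\bigl[\,|u(x,t)|^2+|v(x,t)|^2\,\bigr]\,dx$.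
   Context: $\Omega\subset\mathbb{R}^n$ is a bounded domain with boundary $\partial\Omega$ of class $C^2$; $\alpha>0$ is a constant. The function $f:\mathbb{R}\to\mathbb{R}$ is Lipschitz: $|f(s)-f(t)|\le M_1|s-t|$ for all $s,t\in\mathbb{R}$, with $M_1>0$. The function $a:\mathbb{R}\to\mathbb{R}$ is Lipschitz: $|a(s)-a(t)|\le M_2|s-t|$ for all $s,t\in\mathbb{R}$, with $M_2>0$, and $a(\xi)\ge m>0$ for all $\xi\in\mathbb{R}$. $l:L^2(\Omega)\to\mathbb{R}$ is a continuous linear form, and $l(u)$ denotes $t\mapsto l(u(\cdot,t))$. The Poincaré constant $c_p>0$ is such that $\int_\Omega|w|^2\,dx\le c_p\int_\Omega|\nabla w|^2\,dx$ for all $w\in H_0^1(\Omega)$. $(\cdot,\cdot)$ denotes the inner product of $L^2(\Omega)$. A weak solution is a pair $(u,v)$ such that for every $0<T<\infty$: $u,v\in L^2(0,T;H_0^1(\Omega))\cap C([0,T);L^2(\Omega))$, $u_t,v_t\in L^2(0,T;H^{-1}(\Omega))$, $u(\cdot,0)=u_0$, $v(\cdot,0)=v_0$, and for all $h_1,h_2\in H_0^1(\Omega)$, as equalities in $\mathcal{D}'(0,T)$, $$\frac{d}{dt}(u,h_1)+a(l(u))\int_\Omega\nabla u\cdot\nabla h_1\,dx=-\int_\Omega f(u-v)\,h_1\,dx+\int_\Omega\alpha(u-v)\,h_1\,dx,$$ $$\frac{d}{dt}(v,h_2)+a(l(v))\int_\Omega\nabla v\cdot\nabla h_2\,dx=\int_\Omega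 f(u-v)\,h_2\,dx-\int_\Omega\alpha(u-v)\,h_2\,dx.$$
   Formalization: The formal theorem adds the hypothesis f(0)=0; without it the claim is false (e.g. f≡1 on Ω=(0,π), with a constant and l=0, admits a nonzero stationary solution), and exponential decay of any solution forces f(0)=0. *)

theory Defs
  imports "HOL-Analysis.Analysis"
begin

text \<open>
  Elements of \<open>L\<^sup>2\<close>, \<open>H\<^sup>1\<close> and \<open>H\<^sub>0\<^sup>1\<close> are represented by functions on the whole space whose
  values outside \<open>\<Omega>\<close> are irrelevant; equality in these spaces is equality almost everywhere
  in \<open>\<Omega>\<close>, i.e. the norms below are seminorms on representatives.
\<close>

section \<open>Domains with boundary of class C2\<close>

definition C2_fun :: "('a::euclidean_space \<Rightarrow> real) \<Rightarrow> bool" where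
  "C2_fun g \<longleftrightarrow> (\<exists>(g' :: 'a \<Rightarrow> ('a \<Rightarrow>\<^sub>L real)) (g'' :: 'a \<Rightarrow> ('a \<Rightarrow>\<^sub>L ('a \<Rightarrow>\<^sub>L real))).
     (\<forall>x. (g has_derivative blinfun_apply (g' x)) (at x)) \<and>
     (\<forall>x. (g' has_derivative blinfun_apply (g'' x)) (at x)) \<and>
     continuous_on UNIV g'')"

text \<open>
  Near each boundary point, \<open>\<Omega>\<close> lies strictly above the graph of a C2 function over the
  hyperplane orthogonal to a unit vector \<open>\<nu>\<close>; \<open>x - (x \<bullet> \<nu>) *\<^sub>R \<nu>\<close> is the orthogonal projection
  of \<open>x\<close> onto that hyperplane, so only the restriction of \<open>\<gamma>\<close> to the hyperplane matters.
\<close>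

definition C2_boundary :: "'a::euclidean_space set \<Rightarrow> bool" where
  "C2_boundary \<Omega> \<longleftrightarrow> (\<forall>x0\<in>frontier \<Omega>. \<exists>r>0. \<exists>\<nu> \<gamma>. norm \<nu> = 1 \<and> C2_fun \<gamma> \<and>
     \<Omega> \<inter> ball x0 r = {x \<in> ball x0 r. \<gamma> (x - (x \<bullet> \<nu>) *\<^sub>R \<nu>) < x \<bullet> \<nu>})"

definition bounded_C2_domain :: "'a::euclidean_space set \<Rightarrow> bool" where
  "bounded_C2_domain \<Omega> \<longleftrightarrow>
     open \<Omega> \<and> connected \<Omega> \<and> \<Omega> \<noteq> {} \<and> bounded \<Omega> \<and> C2_boundary \<Omega>"

section \<open>Test functions\<close>

primrec partials :: "'a::euclidean_space list \<Rightarrow> ('a \<Rightarrow> real) \<Rightarrow> 'a \<Rightarrow> real" where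
  "partials [] \<phi> = \<phi>"
| "partials (b # bs) \<phi> = (\<lambda>x. frechet_derivative (partials bs \<phi>) (at x) b)"

definition smooth_fun :: "('a::euclidean_space \<Rightarrow> real) \<Rightarrow> bool" where
  "smooth_fun \<phi> \<longleftrightarrow>
     (\<forall>bs. set bs \<subseteq> Basis \<longrightarrow> (\<forall>x. partials bs \<phi> differentiable (at x)))"

definition test_functions :: "'a::euclidean_space set \<Rightarrow> ('a \<Rightarrow> real) set" where
  "test_functions U =
     {\<phi>. smooth_fun \<phi> \<and> compact (closure {x. \<phi> x \<noteq> 0}) \<and> closure {x. \<phi> x \<noteq> 0} \<subseteq> U}"

section \<open>Lebesgue and Sobolev spaces\<close>

definition L2_space :: "'a::euclidean_space set \<Rightarrow> ('a \<Rightarrow> real) set" where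
  "L2_space \<Omega> = {w. w \<in> borel_measurable (lebesgue_on \<Omega>) \<and>
                    integrable (lebesgue_on \<Omega>) (\<lambda>x. (w x)\<^sup>2)}"

definition L2_inner :: "'a::euclidean_space set \<Rightarrow> ('a \<Rightarrow> real) \<Rightarrow> ('a \<Rightarrow> real) \<Rightarrow> real" where
  "L2_inner \<Omega> w z = (LINT x|lebesgue_on \<Omega>. w x * z x)"

definition L2_norm :: "'a::euclidean_space set \<Rightarrow> ('a \<Rightarrow> real) \<Rightarrow> real" where
  "L2_norm \<Omega> w = sqrt (LINT x|lebesgue_on \<Omega>. (w x)\<^sup>2)"

definition continuous_linear_form_L2 ::
    "'a::euclidean_space set \<Rightarrow> (('a \<Rightarrow> real) \<Rightarrow> real) \<Rightarrow> bool" where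
  "continuous_linear_form_L2 \<Omega> l \<longleftrightarrow>
     (\<forall>w\<in>L2_space \<Omega>. \<forall>z\<in>L2_space \<Omega>. l (\<lambda>x. w x + z x) = l w + l z) \<and>
     (\<forall>w\<in>L2_space \<Omega>. \<forall>c. l (\<lambda>x. c * w x) = c * l w) \<and>
     (\<forall>w\<in>L2_space \<Omega>. \<forall>\<epsilon>>0. \<exists>\<delta>>0. \<forall>z\<in>L2_space \<Omega>.
        L2_norm \<Omega> (\<lambda>x. z x - w x) < \<delta> \<longrightarrow> \<bar>l z - l w\<bar> < \<epsilon>)"

definition weak_gradient ::
    "'a::euclidean_space set \<Rightarrow> ('a \<Rightarrow> real) \<Rightarrow> ('a \<Rightarrow> 'a) \<Rightarrow> bool" where
  "weak_gradient \<Omega> w G \<longleftrightarrow> (\<forall>b\<in>Basis. (\<lambda>x. G x \<bullet> b) \<in> L2_space \<Omega> \<and>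
     (\<forall>\<phi>\<in>test_functions \<Omega>.
        L2_inner \<Omega> w (\<lambda>x. frechet_derivative \<phi> (at x) b) = - L2_inner \<Omega> (\<lambda>x. G x \<bullet> b) \<phi>))"

definition H1_space :: "'a::euclidean_space set \<Rightarrow> ('a \<Rightarrow> real) set" where
  "H1_space \<Omega> = {w \<in> L2_space \<Omega>. \<exists>G. weak_gradient \<Omega> w G}"

text \<open>A representative of the weak gradient, which is unique up to null sets.\<close>

definition grad :: "'a::euclidean_space set \<Rightarrow> ('a \<Rightarrow> real) \<Rightarrow> 'a \<Rightarrow> 'a" where
  "grad \<Omega> w = (SOME G. weak_gradient \<Omega> w G)"

definition grad_inner :: "'a::euclidean_space set \<Rightarrow> ('a \<Rightarrow> real) \<Rightarrow> ('a \<Rightarrow> real) \<Rightarrow> real" where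
  "grad_inner \<Omega> w z = (LINT x|lebesgue_on \<Omega>. grad \<Omega> w x \<bullet> grad \<Omega> z x)"

definition H1_norm :: "'a::euclidean_space set \<Rightarrow> ('a \<Rightarrow> real) \<Rightarrow> real" where
  "H1_norm \<Omega> w = sqrt ((LINT x|lebesgue_on \<Omega>. (w x)\<^sup>2) +
                        (LINT x|lebesgue_on \<Omega>. (norm (grad \<Omega> w x))\<^sup>2))"

text \<open>The closure of the test functions in \<open>H\<^sup>1(\<Omega>)\<close>.\<close>

definition H10_space :: "'a::euclidean_space set \<Rightarrow> ('a \<Rightarrow> real) set" where
  "H10_space \<Omega> = {w \<in> H1_space \<Omega>. \<exists>\<phi> :: nat \<Rightarrow> 'a \<Rightarrow> real.
     (\<forall>k. \<phi> k \<in> test_functions \<Omega>) \<and>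
     (\<lambda>k. H1_norm \<Omega> (\<lambda>x. \<phi> k x - w x)) \<longlonglongrightarrow> 0}"

text \<open>
  The dual of \<open>H\<^sub>0\<^sup>1(\<Omega>)\<close>. Boundedness forces a functional to take the same value on
  almost everywhere equal representatives; its values outside \<open>H\<^sub>0\<^sup>1(\<Omega>)\<close> are irrelevant.
\<close>

definition Hm1_space :: "'a::euclidean_space set \<Rightarrow> (('a \<Rightarrow> real) \<Rightarrow> real) set" where
  "Hm1_space \<Omega> = {F.
     (\<forall>w\<in>H10_space \<Omega>. \<forall>z\<in>H10_space \<Omega>. F (\<lambda>x. w x + z x) = F w + F z) \<and>
     (\<forall>w\<in>H10_space \<Omega>. \<forall>c. F (\<lambda>x. c * w x) = c * F w) \<and>
     (\<exists>K. \<forall>w\<in>H10_space \<Omega>. \<bar>F w\<bar> \<le> K * H1_norm \<Omega> w)}"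

definition Hm1_norm :: "'a::euclidean_space set \<Rightarrow> (('a \<Rightarrow> real) \<Rightarrow> real) \<Rightarrow> real" where
  "Hm1_norm \<Omega> F = Sup {\<bar>F w\<bar> | w. w \<in> H10_space \<Omega> \<and> H1_norm \<Omega> w \<le> 1}"

section \<open>Spaces of functions of time\<close>

text \<open>
  \<open>L\<^sup>2(0,T;X)\<close> for a seminormed space \<open>X\<close> of real functions with seminorm \<open>N\<close>: strong (Bochner)
  measurability, i.e. almost everywhere approximation by \<open>X\<close>-valued simple functions, together
  with square integrability of the norm.
\<close>

definition bochner_L2 ::
    "('p \<Rightarrow> real) set \<Rightarrow> (('p \<Rightarrow> real) \<Rightarrow> real) \<Rightarrow> real \<Rightarrow> (real \<Rightarrow> 'p \<Rightarrow> real) \<Rightarrow> bool" where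
  "bochner_L2 X N T u \<longleftrightarrow>
     (\<exists>s :: nat \<Rightarrow> real \<Rightarrow> 'p \<Rightarrow> real.
        (\<forall>k. simple_function (lebesgue_on {0<..<T}) (s k) \<and> (\<forall>t\<in>{0<..<T}. s k t \<in> X)) \<and>
        (AE t in lebesgue_on {0<..<T}.
           u t \<in> X \<and> (\<lambda>k. N (\<lambda>p. s k t p - u t p)) \<longlonglongrightarrow> 0)) \<and>
     integrable (lebesgue_on {0<..<T}) (\<lambda>t. (N (u t))\<^sup>2)"

definition continuous_in_L2 ::
    "'a::euclidean_space set \<Rightarrow> real \<Rightarrow> (real \<Rightarrow> 'a \<Rightarrow> real) \<Rightarrow> bool" where
  "continuous_in_L2 \<Omega> T u \<longleftrightarrow>
     (\<forall>t\<in>{0..<T}. u t \<in> L2_space \<Omega>) \<and>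
     (\<forall>t\<in>{0..<T}. ((\<lambda>s. L2_norm \<Omega> (\<lambda>x. u s x - u t x)) \<longlongrightarrow> 0) (at t within {0..<T}))"

text \<open>Action on \<open>\<psi>\<close> of the distribution on \<open>(0,T)\<close> given by \<open>g\<close>, and of its derivative.\<close>

definition regular_distr :: "real \<Rightarrow> (real \<Rightarrow> real) \<Rightarrow> (real \<Rightarrow> real) \<Rightarrow> real" where
  "regular_distr T g \<psi> = (LINT t|lebesgue_on {0<..<T}. g t * \<psi> t)"

definition regular_distr_deriv :: "real \<Rightarrow> (real \<Rightarrow> real) \<Rightarrow> (real \<Rightarrow> real) \<Rightarrow> real" where
  "regular_distr_deriv T g \<psi> = - regular_distr T g (deriv \<psi>)"

text \<open>
  The weak time derivative of \<open>u\<close> exists and lies in \<open>L\<^sup>2(0,T;H\<^sup>-\<^sup>1(\<Omega>))\<close>. The identity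
  \<open>\<integral> u \<psi>' dt = - \<integral> g \<psi> dt\<close> in \<open>H\<^sup>-\<^sup>1(\<Omega>)\<close> is evaluated at each element \<open>h\<close> of \<open>H\<^sub>0\<^sup>1(\<Omega>)\<close>, where
  \<open>u t\<close> acts on \<open>h\<close> through the inner product of \<open>L\<^sup>2(\<Omega>)\<close>.
\<close>

definition weak_time_deriv_in_L2_Hm1 ::
    "'a::euclidean_space set \<Rightarrow> real \<Rightarrow> (real \<Rightarrow> 'a \<Rightarrow> real) \<Rightarrow> bool" where
  "weak_time_deriv_in_L2_Hm1 \<Omega> T u \<longleftrightarrow>
     (\<exists>g. bochner_L2 (Hm1_space \<Omega>) (Hm1_norm \<Omega>) T g \<and>
        (\<forall>h\<in>H10_space \<Omega>. \<forall>\<psi>\<in>test_functions {0<..<T}.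
           regular_distr_deriv T (\<lambda>t. L2_inner \<Omega> (u t) h) \<psi> = regular_distr T (\<lambda>t. g t h) \<psi>))"

section \<open>Weak solutions and energy\<close>

definition weak_solution ::
    "'a::euclidean_space set \<Rightarrow> real \<Rightarrow> (real \<Rightarrow> real) \<Rightarrow> (real \<Rightarrow> real) \<Rightarrow>
     (('a \<Rightarrow> real) \<Rightarrow> real) \<Rightarrow> ('a \<Rightarrow> real) \<Rightarrow> ('a \<Rightarrow> real) \<Rightarrow>
     (real \<Rightarrow> 'a \<Rightarrow> real) \<Rightarrow> (real \<Rightarrow> 'a \<Rightarrow> real) \<Rightarrow> bool" where
  "weak_solution \<Omega> \<alpha> f a l u0 v0 u v \<longleftrightarrow>
     (\<forall>T>0.
        bochner_L2 (H10_space \<Omega>) (H1_norm \<Omega>) T u \<and> continuous_in_L2 \<Omega> T u \<and>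
        bochner_L2 (H10_space \<Omega>) (H1_norm \<Omega>) T v \<and> continuous_in_L2 \<Omega> T v \<and>
        weak_time_deriv_in_L2_Hm1 \<Omega> T u \<and> weak_time_deriv_in_L2_Hm1 \<Omega> T v \<and>
        (AE x in lebesgue_on \<Omega>. u 0 x = u0 x) \<and>
        (AE x in lebesgue_on \<Omega>. v 0 x = v0 x) \<and>
        (\<forall>h1\<in>H10_space \<Omega>. \<forall>\<psi>\<in>test_functions {0<..<T}.
           regular_distr_deriv T (\<lambda>t. L2_inner \<Omega> (u t) h1) \<psi>
             + regular_distr T (\<lambda>t. a (l (u t)) * grad_inner \<Omega> (u t) h1) \<psi>
           = regular_distr T (\<lambda>t. - (LINT x|lebesgue_on \<Omega>. f (u t x - v t x) * h1 x)
                          + (LINT x|lebesgue_on \<Omega>. \<alpha> * (u t x - v t x) * h1 x)) \<psi>) \<and>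
        (\<forall>h2\<in>H10_space \<Omega>. \<forall>\<psi>\<in>test_functions {0<..<T}.
           regular_distr_deriv T (\<lambda>t. L2_inner \<Omega> (v t) h2) \<psi>
             + regular_distr T (\<lambda>t. a (l (v t)) * grad_inner \<Omega> (v t) h2) \<psi>
           = regular_distr T (\<lambda>t. (LINT x|lebesgue_on \<Omega>. f (u t x - v t x) * h2 x)
                          - (LINT x|lebesgue_on \<Omega>. \<alpha> * (u t x - v t x) * h2 x)) \<psi>))"

definition energy ::
    "'a::euclidean_space set \<Rightarrow> (real \<Rightarrow> 'a \<Rightarrow> real) \<Rightarrow> (real \<Rightarrow> 'a \<Rightarrow> real) \<Rightarrow> real \<Rightarrow> real" where
  "energy \<Omega> u v t = 1/2 * (LINT x|lebesgue_on \<Omega>. \<bar>u t x\<bar>\<^sup>2 + \<bar>v t x\<bar>\<^sup>2)"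

end

theory Submission
  imports Defs
begin

text \<open>
  Formally, testing the first equation with \<open>u\<close>, the second with \<open>v\<close> and adding gives, for
  \<open>Y t = \<parallel>u t\<parallel>\<^sup>2 + \<parallel>v t\<parallel>\<^sup>2\<close> and \<open>\<phi> s = \<alpha> * s - f s\<close>,

    \<open>Y' / 2 = - a(l u) \<parallel>\<nabla>u\<parallel>\<^sup>2 - a(l v) \<parallel>\<nabla>v\<parallel>\<^sup>2 + (\<phi>(u - v), u - v)\<close>.

  The diffusion is at most \<open>- (m / cp) Y\<close> by the Poincare inequality. Since \<open>f 0 = 0\<close>, the
  reaction term is at most \<open>(M1 + \<alpha>) \<parallel>u - v\<parallel>\<^sup>2 \<le> 2 (M1 + \<alpha>) Y\<close>, because the right-hand
  sides of the two equations are opposite. The smallness assumption says that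
  \<open>\<eta> = 2 m / cp - 4 (M1 + \<alpha>)\<close> is positive, and the Gronwall lemma gives decay at rate \<open>\<eta>\<close>
  with \<open>C = 1\<close>.

  The difficulty is that \<open>u\<close> and \<open>v\<close> may not be used as test functions directly: the equations
  hold in the sense of distributions in time against a fixed \<open>h\<close> in \<open>H\<^sub>0\<^sup>1\<close>. The proof rests on
  the inequality \<open>\<parallel>u t2\<parallel>\<^sup>2 - \<parallel>u t1\<parallel>\<^sup>2 \<le> \<integral> 2 (F, u) - 2 (m / cp) \<parallel>u\<parallel>\<^sup>2\<close>, where \<open>F\<close> is the
  right-hand side (\<open>parabolic_energy_inequality\<close>); all integrals over time in its derivation are
  integrals of real functions. By \<open>weak_derivative_FTC\<close> the equation for a fixed \<open>h\<close>
  integrates to \<open>(u r2 - u r1, h) = \<integral> (F, h) - A (\<nabla>u, \<nabla>h)\<close>. For almost every \<open>s\<close> the choice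
  \<open>h = u s\<close> is allowed, and convexity of the square gives

    \<open>\<parallel>u s\<parallel>\<^sup>2 - \<parallel>u (s - \<delta>)\<parallel>\<^sup>2 \<le> 2 (u s - u (s - \<delta>), u s)
        = 2 \<integral>\<^bsub>s-\<delta>\<^esub>\<^bsup>s\<^esup> (F \<tau>, u s) - A \<tau> (\<nabla>u \<tau>, \<nabla>u s) d\<tau>\<close>.

  By polarization \<open>- 2 (\<nabla>u \<tau>, \<nabla>u s)\<close> is \<open>- \<parallel>\<nabla>u \<tau>\<parallel>\<^sup>2 - \<parallel>\<nabla>u s\<parallel>\<^sup>2\<close>, to which the Poincare inequality
  applies, plus the error \<open>\<parallel>\<nabla>u \<tau> - \<nabla>u s\<parallel>\<^sup>2\<close>. The error is small after averaging over \<open>s\<close>,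
  because \<open>\<nabla>u\<close> is close in \<open>L\<^sup>2\<close> of space-time to a curve that is continuous in \<open>L\<^sup>2\<close>
  (\<open>strongly_measurable_approx_continuous\<close>). Averaging over \<open>s\<close> and then letting the
  approximation error tend to zero yields the inequality (\<open>energy_inequality_eps\<close>).

  That \<open>\<nabla>\<close> may be treated as linear in these computations rests on the uniqueness of weak
  gradients (\<open>weak_gradient_unique\<close>), for which smooth approximations of the indicator functions
  of boxes are constructed. The same smooth step function serves as cut-off in time.
\<close>

section \<open>Smooth step functions and their products\<close>

text \<open>
  Smoothness on the line is encoded by counting derivatives, so that closure under products and
  inverses can be shown by induction on that number.
\<close>

primrec times_diff :: "nat \<Rightarrow> (real \<Rightarrow> real) \<Rightarrow> bool" where
  "times_diff 0 g \<longleftrightarrow> True"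
| "times_diff (Suc n) g \<longleftrightarrow>
     (\<exists>g'. (\<forall>x. (g has_real_derivative g' x) (at x)) \<and> times_diff n g')"

definition smooth_real :: "(real \<Rightarrow> real) \<Rightarrow> bool" where
  "smooth_real g \<longleftrightarrow> (\<forall>n. times_diff n g)"

lemma times_diff_Suc_D: "times_diff (Suc n) g \<Longrightarrow> times_diff n g"
proof (induction n arbitrary: g)
  case (Suc n)
  then obtain g' where "\<forall>x. (g has_real_derivative g' x) (at x)" "times_diff (Suc n) g'"
    by auto
  then show ?case using Suc.IH[of g'] by auto
qed simp

lemma times_diff_add: "times_diff n f \<Longrightarrow> times_diff n g \<Longrightarrow> times_diff n (\<lambda>x. f x + g x)"
proof (induction n arbitrary: f g)
  case (Suc n)
  then obtain f' g' where "\<forall>x. (f has_real_derivative f' x) (at x)" "times_diff n f'"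
    "\<forall>x. (g has_real_derivative g' x) (at x)" "times_diff n g'" by auto
  then show ?case using Suc.IH[of f' g']
    by (auto intro!: exI[of _ "\<lambda>x. f' x + g' x"] derivative_intros)
qed simp

lemma times_diff_mult: "times_diff n f \<Longrightarrow> times_diff n g \<Longrightarrow> times_diff n (\<lambda>x. f x * g x)"
proof (induction n arbitrary: f g)
  case (Suc n)
  then obtain f' g' where d: "\<forall>x. (f has_real_derivative f' x) (at x)" "times_diff n f'"
    "\<forall>x. (g has_real_derivative g' x) (at x)" "times_diff n g'" by auto
  have "times_diff n f" "times_diff n g" using Suc.prems times_diff_Suc_D by blast+
  then have "times_diff n (\<lambda>x. f' x * g x + f x * g' x)"
    using d Suc.IH by (intro times_diff_add) auto
  moreover have "((\<lambda>x. f x * g x) has_real_derivative f' x * g x + f x * g' x) (at x)" for x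
    using d by (auto intro!: derivative_eq_intros)
  ultimately show ?case unfolding times_diff.simps(2)
    by (intro exI[of _ "\<lambda>x. f' x * g x + f x * g' x"]) auto
qed simp

lemma times_diff_const: "times_diff n (\<lambda>x. c)"
proof (induction n arbitrary: c)
  case (Suc n)
  then show ?case by (auto intro!: exI[of _ "\<lambda>x. 0"] derivative_eq_intros)
qed simp

lemma times_diff_inverse:
  assumes nz: "\<And>x. f x \<noteq> 0" and f: "times_diff n f"
  shows "times_diff n (\<lambda>x. inverse (f x))"
  using f
proof (induction n)
  case (Suc n)
  then obtain f' where d: "\<forall>x. (f has_real_derivative f' x) (at x)" "times_diff n f'" by auto
  have "times_diff n (\<lambda>x. inverse (f x))" using Suc times_diff_Suc_D by blast
  then have "times_diff n (\<lambda>x. (-1) * f' x * (inverse (f x) * inverse (f x)))"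
    using d by (intro times_diff_mult times_diff_const) auto
  moreover have "((\<lambda>x. inverse (f x)) has_real_derivative
      (-1) * f' x * (inverse (f x) * inverse (f x))) (at x)" for x
    using d nz by (auto intro!: derivative_eq_intros)
  ultimately show ?case unfolding times_diff.simps(2) by (intro exI conjI) auto
qed simp

lemma times_diff_affine: "times_diff n f \<Longrightarrow> times_diff n (\<lambda>x. f (c * x + d))"
proof (induction n arbitrary: f)
  case (Suc n)
  then obtain f' where d: "\<forall>x. (f has_real_derivative f' x) (at x)" "times_diff n f'" by auto
  have "times_diff n (\<lambda>x. c * f' (c * x + d))"
    using Suc.IH[OF d(2)] by (intro times_diff_mult times_diff_const)
  moreover have "((\<lambda>x. f (c * x + d)) has_real_derivative c * f' (c * x + d)) (at x)" for x
  proof -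
    have "((\<lambda>x. f (c * x + d)) has_real_derivative f' (c * x + d) * c) (at x)"
      by (rule DERIV_chain2[where f=f and g="\<lambda>x. c * x + d"])
        (use d in \<open>auto intro!: derivative_eq_intros\<close>)
    then show ?thesis by (simp add: mult.commute)
  qed
  ultimately show ?case unfolding times_diff.simps(2) by (intro exI conjI) auto
qed simp

lemma smooth_real_deriv:
  assumes "smooth_real g"
  obtains g' where "\<And>x. (g has_real_derivative g' x) (at x)" "smooth_real g'"
proof -
  from assms have "\<forall>n. times_diff (Suc n) g" unfolding smooth_real_def by blast
  then obtain g' where g': "\<And>n x. (g has_real_derivative g' n x) (at x)" "\<And>n. times_diff n (g' n)"
    by (simp only: times_diff.simps) metis
  have "g' n = g' 0" for n using g'(1) DERIV_unique by blast
  with g' have "smooth_real (g' 0)" unfolding smooth_real_def by metis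
  with g'(1) that show ?thesis by blast
qed

text \<open>
  The functions \<open>x\<^sup>-\<^sup>j exp (- 1 / x)\<close>, extended by zero to the left: up to linear combinations this
  family is closed under differentiation, so the smoothness of \<open>exp (- 1 / x)\<close> at the origin reduces
  to the fact that every member tends to zero there.
\<close>

definition flat :: "nat \<Rightarrow> real \<Rightarrow> real" where
  "flat j x = (if x > 0 then (1/x)^j * exp (- (1/x)) else 0)"

lemma flat_tendsto: "(flat j \<longlongrightarrow> 0) (at 0)"
proof -
  have "((\<lambda>y::real. y^j / exp y) \<longlongrightarrow> 0) at_top" by (rule tendsto_power_div_exp_0)
  then have "((\<lambda>x::real. (inverse x)^j / exp (inverse x)) \<longlongrightarrow> 0) (at_right 0)"
    by (rule filterlim_compose) (rule filterlim_inverse_at_top_right)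
  then have r: "(flat j \<longlongrightarrow> 0) (at_right 0)"
    by (rule Lim_transform_eventually)
      (auto simp: eventually_at_filter flat_def exp_minus field_simps)
  have l: "(flat j \<longlongrightarrow> 0) (at_left 0)"
    by (rule Lim_transform_eventually[OF tendsto_const])
      (auto simp: eventually_at_filter flat_def)
  show ?thesis using r l by (simp add: filterlim_split_at)
qed

lemma flat_has_derivative:
  "(flat j has_real_derivative flat (j+2) x - real j * flat (j+1) x) (at x)"
proof -
  consider "x > 0" | "x < 0" | "x = 0" by linarith
  then show ?thesis
  proof cases
    case 1
    have i: "((\<lambda>x. 1/x) has_real_derivative - ((1/x)^2)) (at x)"
      using 1 by (auto intro!: derivative_eq_intros simp: power2_eq_square)
    have "((\<lambda>x. (1/x)^j * exp (- (1/x))) has_real_derivative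
       real j * (1/x)^(j - Suc 0) * (- ((1/x)^2)) * exp (- (1/x))
       + (exp (- (1/x)) * (1/x)^2) * (1/x)^j) (at x)"
      by (rule derivative_eq_intros i refl | simp)+
    moreover have "real j * y^(j - Suc 0) * (- (y^2)) = - real j * y^(j+1)" for y :: real
      by (cases j) (auto simp: power2_eq_square algebra_simps)
    ultimately have "((\<lambda>x. (1/x)^j * exp (- (1/x))) has_real_derivative
       flat (j+2) x - real j * flat (j+1) x) (at x)"
      using 1 by (simp only: flat_def power_add if_True) (simp add: algebra_simps)
    then show ?thesis
      by (rule has_field_derivative_transform_within_open[where S="{0<..}"])
        (use 1 in \<open>auto simp: flat_def\<close>)
  next
    case 2
    have "((\<lambda>x. 0) has_real_derivative flat (j+2) x - real j * flat (j+1) x) (at x)"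
      using 2 by (auto simp: flat_def)
    then show ?thesis
      by (rule has_field_derivative_transform_within_open[where S="{..<0}"])
        (use 2 in \<open>auto simp: flat_def\<close>)
  next
    case 3
    \<comment> \<open>The difference quotient at the origin is the next member of the family.\<close>
    have "((\<lambda>h. (flat j (0+h) - flat j 0) / h) \<longlongrightarrow> 0) (at 0)"
      by (rule Lim_transform_eventually[OF flat_tendsto[of "j+1"]])
        (auto simp: eventually_at_filter flat_def)
    then show ?thesis using 3 by (simp add: DERIV_def flat_def)
  qed
qed

lemma flat_smooth: "smooth_real (flat j)"
proof -
  have "times_diff n (flat j)" for n
  proof (induction n arbitrary: j)
    case (Suc n)
    have "times_diff n (\<lambda>x. flat (j+2) x + (- real j) * flat (j+1) x)"
      by (intro times_diff_add times_diff_mult times_diff_const Suc)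
    then show ?case using flat_has_derivative[of j]
      by (auto intro!: exI[of _ "\<lambda>x. flat (j+2) x - real j * flat (j+1) x"])
  qed simp
  then show ?thesis by (simp add: smooth_real_def)
qed

definition smooth_step :: "real \<Rightarrow> real" where
  "smooth_step x = flat 0 x / (flat 0 x + flat 0 (1 - x))"

lemma flat0_nonneg: "flat 0 x \<ge> 0" and flat0_pos: "x > 0 \<Longrightarrow> flat 0 x > 0"
  and flat0_zero: "x \<le> 0 \<Longrightarrow> flat 0 x = 0"
  by (auto simp: flat_def)

lemma smooth_step_denominator: "flat 0 x + flat 0 (1 - x) > 0"
  using flat0_pos[of x] flat0_pos[of "1-x"] flat0_nonneg[of x] flat0_nonneg[of "1-x"]
  by (cases "x > 0") auto

lemma smooth_step_left: "x \<le> 0 \<Longrightarrow> smooth_step x = 0"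
  and smooth_step_right: "x \<ge> 1 \<Longrightarrow> smooth_step x = 1"
  and smooth_step_bounds: "0 \<le> smooth_step x" "smooth_step x \<le> 1"
  using smooth_step_denominator[of x] flat0_nonneg[of x] flat0_nonneg[of "1-x"]
  by (auto simp: smooth_step_def flat0_zero divide_simps)

lemma smooth_step_smooth: "smooth_real smooth_step"
proof -
  have "times_diff n smooth_step" for n
  proof -
    have f: "times_diff n (flat 0)" using flat_smooth smooth_real_def by blast
    have "times_diff n (\<lambda>x. flat 0 x * inverse (flat 0 x + flat 0 ((-1) * x + 1)))"
      using smooth_step_denominator
      by (intro times_diff_mult times_diff_inverse times_diff_add times_diff_affine f)
         (metis add.commute diff_conv_add_uminus less_irrefl mult_minus1)
    moreover have "smooth_step = (\<lambda>x. flat 0 x * inverse (flat 0 x + flat 0 ((-1) * x + 1)))"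
      by (auto simp: smooth_step_def divide_inverse)
    ultimately show ?thesis by simp
  qed
  then show ?thesis by (simp add: smooth_real_def)
qed

lemma smooth_real_mult: "smooth_real f \<Longrightarrow> smooth_real g \<Longrightarrow> smooth_real (\<lambda>x. f x * g x)"
  and smooth_real_affine: "smooth_real f \<Longrightarrow> smooth_real (\<lambda>x. f (c * x + d))"
  and smooth_real_const: "smooth_real (\<lambda>x. k)"
  and smooth_real_add: "smooth_real f \<Longrightarrow> smooth_real g \<Longrightarrow> smooth_real (\<lambda>x. f x + g x)"
  by (auto simp: smooth_real_def times_diff_mult times_diff_affine times_diff_const times_diff_add)

lemma smooth_real_diff:
  assumes "smooth_real f" "smooth_real g" shows "smooth_real (\<lambda>x. f x - g x)"
  using smooth_real_add[OF assms(1) smooth_real_mult[OF smooth_real_const[of "-1"] assms(2)]]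
  by simp

text \<open>
  A product of smooth functions of the coordinates stays of this form under each partial
  derivative, which only replaces the factor of that coordinate by its derivative; iterating this
  avoids any calculus of mixed derivatives.
\<close>

lemma partials_product:
  fixes g :: "'a::euclidean_space \<Rightarrow> real \<Rightarrow> real"
  assumes "\<And>i. smooth_real (g i)" "set bs \<subseteq> Basis"
  shows "\<exists>g'. (\<forall>i. smooth_real (g' i)) \<and>
     partials bs (\<lambda>x. \<Prod>i\<in>Basis. g i (x \<bullet> i)) = (\<lambda>x. \<Prod>i\<in>Basis. g' i (x \<bullet> i))"
  using assms(2)
proof (induction bs)
  case Nil
  then show ?case using assms(1) by auto
next
  case (Cons b bs)
  then obtain G where G: "\<And>i. smooth_real (G i)"
    "partials bs (\<lambda>x. \<Prod>i\<in>Basis. g i (x \<bullet> i)) = (\<lambda>x. \<Prod>i\<in>Basis. G i (x \<bullet> i))" by auto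
  have b: "b \<in> Basis" using Cons.prems by auto
  have "\<forall>i. \<exists>H. (\<forall>x. (G i has_real_derivative H x) (at x)) \<and> smooth_real H"
    using smooth_real_deriv[OF G(1)] by metis
  then obtain H where H: "\<And>i x. (G i has_real_derivative H i x) (at x)" "\<And>i. smooth_real (H i)"
    by metis
  let ?D = "\<lambda>x y. \<Sum>i\<in>Basis. (H i (x \<bullet> i) * (y \<bullet> i)) * (\<Prod>j\<in>Basis - {i}. G j (x \<bullet> j))"
  have D: "((\<lambda>x. \<Prod>i\<in>Basis. G i (x \<bullet> i)) has_derivative ?D x) (at x)" for x
  proof (rule has_derivative_prod)
    fix i :: 'a
    have "((\<lambda>x. x \<bullet> i) has_derivative (\<lambda>y. y \<bullet> i)) (at x)"
      by (rule has_derivative_inner_left[OF has_derivative_ident])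
    then show "((\<lambda>x. G i (x \<bullet> i)) has_derivative (\<lambda>y. H i (x \<bullet> i) * (y \<bullet> i))) (at x)"
      using has_derivative_compose[of "\<lambda>x. x \<bullet> i" "\<lambda>y. y \<bullet> i" x UNIV "G i" "\<lambda>y. H i (x \<bullet> i) * y"]
        H(1)[of i "x \<bullet> i"] by (simp add: has_field_derivative_def)
  qed
  let ?G' = "G(b := H b)"
  have "frechet_derivative (\<lambda>x. \<Prod>i\<in>Basis. G i (x \<bullet> i)) (at x) b = (\<Prod>i\<in>Basis. ?G' i (x \<bullet> i))" for x
  proof -
    have "frechet_derivative (\<lambda>x. \<Prod>i\<in>Basis. G i (x \<bullet> i)) (at x) = ?D x"
      using frechet_derivative_at[OF D[of x]] by simp
    then have "frechet_derivative (\<lambda>x. \<Prod>i\<in>Basis. G i (x \<bullet> i)) (at x) b = ?D x b" by simp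
    also have "\<dots> = (\<Sum>i\<in>Basis. if i = b then H b (x \<bullet> b) * (\<Prod>j\<in>Basis - {b}. G j (x \<bullet> j)) else 0)"
      using b by (intro sum.cong refl) (auto simp: inner_Basis)
    also have "\<dots> = H b (x \<bullet> b) * (\<Prod>j\<in>Basis - {b}. G j (x \<bullet> j))" using b by simp
    also have "\<dots> = (\<Prod>i\<in>Basis. ?G' i (x \<bullet> i))"
      using b by (subst prod.remove[of _ b]) (auto intro!: prod.cong)
    finally show ?thesis .
  qed
  then show ?case using G H(2) by (auto intro!: exI[of _ ?G'])
qed

lemma smooth_fun_product:
  fixes g :: "'a::euclidean_space \<Rightarrow> real \<Rightarrow> real"
  assumes "\<And>i. smooth_real (g i)"
  shows "smooth_fun (\<lambda>x. \<Prod>i\<in>Basis. g i (x \<bullet> i))"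
  unfolding smooth_fun_def
proof (intro allI impI)
  fix bs :: "'a list" and x :: 'a
  assume bs: "set bs \<subseteq> Basis"
  obtain g' where g': "\<forall>i. smooth_real (g' i)"
    "partials bs (\<lambda>x. \<Prod>i\<in>Basis. g i (x \<bullet> i)) = (\<lambda>x. \<Prod>i\<in>Basis. g' i (x \<bullet> i))"
    using partials_product[where g=g, OF assms bs] by (elim exE conjE)
  have "(\<lambda>x. g' i (x \<bullet> i)) differentiable (at x)" for i
  proof -
    obtain H where "\<And>x. (g' i has_real_derivative H x) (at x)"
      using smooth_real_deriv[of "g' i"] g'(1) by blast
    then have "g' i differentiable (at (x \<bullet> i))"
      using real_differentiable_def by blast
    moreover have "(\<lambda>x. x \<bullet> i) differentiable (at x)" by simp
    ultimately show ?thesis using differentiable_chain_at[of "\<lambda>x. x \<bullet> i" x "g' i"]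
      by (simp add: o_def)
  qed
  then obtain D where "\<And>i. ((\<lambda>x. g' i (x \<bullet> i)) has_derivative D i) (at x)"
    unfolding differentiable_def by metis
  then have "(\<lambda>x. \<Prod>i\<in>Basis. g' i (x \<bullet> i)) differentiable (at x)"
    unfolding differentiable_def by (intro exI, rule has_derivative_prod)
  then show "partials bs (\<lambda>x. \<Prod>i\<in>Basis. g i (x \<bullet> i)) differentiable (at x)" using g' by simp
qed

lemma smooth_real_smooth_fun: "smooth_real g \<Longrightarrow> smooth_fun (g :: real \<Rightarrow> real)"
  using smooth_fun_product[of "\<lambda>i::real. g"] by simp

section \<open>Vector-valued square-integrable functions\<close>

text \<open>
  Gradients are vector-valued and products with them are needed as often as products of scalar
  functions. The \<open>L\<^sup>2\<close> calculus is therefore set up once, for functions with values in a Euclidean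
  space, on representatives and with a seminorm.
\<close>

definition square_integrable :: "'a measure \<Rightarrow> ('a \<Rightarrow> 'b::euclidean_space) \<Rightarrow> bool" where
  "square_integrable M w \<longleftrightarrow>
     w \<in> borel_measurable M \<and> integrable M (\<lambda>x. (norm (w x))\<^sup>2)"

definition ip :: "'a measure \<Rightarrow> ('a \<Rightarrow> 'b::euclidean_space) \<Rightarrow> ('a \<Rightarrow> 'b) \<Rightarrow> real" where
  "ip M w z = (LINT x|M. w x \<bullet> z x)"

definition nrm :: "'a measure \<Rightarrow> ('a \<Rightarrow> 'b::euclidean_space) \<Rightarrow> real" where
  "nrm M w = sqrt (LINT x|M. (norm (w x))\<^sup>2)"

lemma nrm_nonneg [simp]: "nrm M w \<ge> 0"
  by (simp add: nrm_def)

lemma nrm_square: "(nrm M w)\<^sup>2 = ip M w w"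
  by (simp add: nrm_def ip_def dot_square_norm)

lemma ip_integrable:
  assumes "square_integrable M w" "square_integrable M z"
  shows "integrable M (\<lambda>x. w x \<bullet> z x)"
proof (rule Bochner_Integration.integrable_bound)
  show "integrable M (\<lambda>x. (norm (w x))\<^sup>2 + (norm (z x))\<^sup>2)"
    using assms by (auto simp: square_integrable_def)
  show "(\<lambda>x. w x \<bullet> z x) \<in> borel_measurable M"
    using assms by (auto simp: square_integrable_def)
  have "\<bar>a \<bullet> b\<bar> \<le> (norm a)\<^sup>2 + (norm b)\<^sup>2" for a b :: 'b
  proof -
    have "2 * (norm a * norm b) \<le> (norm a)\<^sup>2 + (norm b)\<^sup>2"
      using sum_squares_bound[of "norm a" "norm b"] by simp
    moreover have "0 \<le> norm a * norm b" by simp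
    ultimately show ?thesis using Cauchy_Schwarz_ineq2[of a b] by linarith
  qed
  then show "AE x in M. norm (w x \<bullet> z x) \<le> norm ((norm (w x))\<^sup>2 + (norm (z x))\<^sup>2)" by auto
qed

lemma square_integrable_scaleR:
  assumes "square_integrable M w" shows "square_integrable M (\<lambda>x. c *\<^sub>R w x)"
  using assms by (auto simp: square_integrable_def power_mult_distrib)

lemma square_integrable_add:
  assumes "square_integrable M w" "square_integrable M z"
  shows "square_integrable M (\<lambda>x. w x + z x)"
  unfolding square_integrable_def
proof
  show m: "(\<lambda>x. w x + z x) \<in> borel_measurable M" using assms by (auto simp: square_integrable_def)
  have "integrable M (\<lambda>x. (norm (w x))\<^sup>2 + (norm (z x))\<^sup>2 + 2 * (w x \<bullet> z x))"
    using assms ip_integrable[OF assms] by (auto simp: square_integrable_def)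
  then show "integrable M (\<lambda>x. (norm (w x + z x))\<^sup>2)"
    by (simp add: power2_norm_eq_inner inner_simps inner_commute algebra_simps)
qed

lemma square_integrable_diff:
  assumes "square_integrable M w" "square_integrable M z"
  shows "square_integrable M (\<lambda>x. w x - z x)"
  using square_integrable_add[OF assms(1) square_integrable_scaleR[OF assms(2), of "-1"]] by simp

lemma square_integrable_zero: "square_integrable M (\<lambda>x. 0)"
  by (simp add: square_integrable_def)

lemma square_integrable_sum:
  assumes "\<And>i. i \<in> I \<Longrightarrow> square_integrable M (w i)"
  shows "square_integrable M (\<lambda>x. \<Sum>i\<in>I. w i x)"
  using assms by (induction I rule: infinite_finite_induct)
    (auto simp: square_integrable_zero intro: square_integrable_add)

lemma ip_commute: "ip M w z = ip M z w"
  by (simp add: ip_def inner_commute)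

lemma ip_scaleR_left: "ip M (\<lambda>x. c *\<^sub>R w x) z = c * ip M w z"
  by (simp add: ip_def)

lemma ip_scaleR_right: "ip M w (\<lambda>x. c *\<^sub>R z x) = c * ip M w z"
  by (simp add: ip_def)

lemma ip_add_left:
  assumes "square_integrable M w" "square_integrable M w'" "square_integrable M z"
  shows "ip M (\<lambda>x. w x + w' x) z = ip M w z + ip M w' z"
  using ip_integrable[OF assms(1,3)] ip_integrable[OF assms(2,3)] by (simp add: ip_def inner_add_left)

lemma ip_diff_left:
  assumes "square_integrable M w" "square_integrable M w'" "square_integrable M z"
  shows "ip M (\<lambda>x. w x - w' x) z = ip M w z - ip M w' z"
  using ip_integrable[OF assms(1,3)] ip_integrable[OF assms(2,3)] by (simp add: ip_def inner_diff_left)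

lemma ip_add_right:
  assumes "square_integrable M w" "square_integrable M w'" "square_integrable M z"
  shows "ip M z (\<lambda>x. w x + w' x) = ip M z w + ip M z w'"
  using ip_add_left[OF assms] by (simp add: ip_commute)

lemma ip_diff_right:
  assumes "square_integrable M w" "square_integrable M w'" "square_integrable M z"
  shows "ip M z (\<lambda>x. w x - w' x) = ip M z w - ip M z w'"
  using ip_diff_left[OF assms] by (simp add: ip_commute)

lemma ip_sum_right:
  assumes "\<And>i. i \<in> I \<Longrightarrow> square_integrable M (w i)" "square_integrable M z"
  shows "ip M z (\<lambda>x. \<Sum>i\<in>I. w i x) = (\<Sum>i\<in>I. ip M z (w i))"
  using assms(1)
proof (induction I rule: infinite_finite_induct)
  case (insert i I)
  then show ?case using assms(2) by (simp add: ip_add_right square_integrable_sum)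
qed (auto simp: ip_def)

lemma nrm_diff_square:
  assumes "square_integrable M w" "square_integrable M z"
  shows "(nrm M (\<lambda>x. w x - z x))\<^sup>2 = (nrm M w)\<^sup>2 + (nrm M z)\<^sup>2 - 2 * ip M w z"
  using assms by (simp add: nrm_square ip_diff_left ip_diff_right square_integrable_diff ip_commute)

lemma ip_Cauchy_Schwarz:
  assumes "square_integrable M w" "square_integrable M z"
  shows "\<bar>ip M w z\<bar> \<le> nrm M w * nrm M z"
proof -
  define b where "b = ip M w z"
  have q: "0 \<le> (nrm M w)\<^sup>2 + t\<^sup>2 * (nrm M z)\<^sup>2 - 2 * t * b" for t
  proof -
    have "0 \<le> (nrm M (\<lambda>x. w x - t *\<^sub>R z x))\<^sup>2" by simp
    also have "\<dots> = (nrm M w)\<^sup>2 + (nrm M (\<lambda>x. t *\<^sub>R z x))\<^sup>2 - 2 * ip M w (\<lambda>x. t *\<^sub>R z x)"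
      by (rule nrm_diff_square[OF assms(1) square_integrable_scaleR[OF assms(2)]])
    also have "\<dots> = (nrm M w)\<^sup>2 + t\<^sup>2 * (nrm M z)\<^sup>2 - 2 * t * b"
      by (simp add: nrm_square ip_scaleR_left ip_scaleR_right b_def) (simp add: power2_eq_square)
    finally show ?thesis .
  qed
  have "b\<^sup>2 \<le> (nrm M w)\<^sup>2 * (nrm M z)\<^sup>2"
  proof (cases "nrm M z = 0")
    case True
    have "b = 0"
    proof (rule ccontr)
      assume "b \<noteq> 0"
      then show False using q[of "((nrm M w)\<^sup>2 + 1) / (2 * b)"] True by simp
    qed
    then show ?thesis by simp
  next
    case False
    then have p: "(nrm M z)\<^sup>2 > 0" by simp
    have "(b / c)\<^sup>2 * c - 2 * (b / c) * b = - (b\<^sup>2 / c)" if "c > 0" for c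
      using that by (simp add: power2_eq_square)
    from this[OF p] have "0 \<le> (nrm M w)\<^sup>2 - b\<^sup>2 / (nrm M z)\<^sup>2"
      using q[of "b / (nrm M z)\<^sup>2"] by linarith
    then show ?thesis using p by (simp add: field_simps)
  qed
  then have "b\<^sup>2 \<le> (nrm M w * nrm M z)\<^sup>2" by (simp add: power_mult_distrib)
  then have "\<bar>b\<bar> \<le> \<bar>nrm M w * nrm M z\<bar>" by (simp only: abs_le_square_iff)
  then show ?thesis by (simp add: b_def)
qed

lemma nrm_triangle:
  assumes "square_integrable M w" "square_integrable M z"
  shows "nrm M (\<lambda>x. w x + z x) \<le> nrm M w + nrm M z"
proof (rule power2_le_imp_le)
  have "(nrm M (\<lambda>x. w x + z x))\<^sup>2 = (nrm M w)\<^sup>2 + (nrm M z)\<^sup>2 + 2 * ip M w z"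
    using assms by (simp add: nrm_square ip_add_left ip_add_right square_integrable_add ip_commute)
  also have "\<dots> \<le> (nrm M w)\<^sup>2 + (nrm M z)\<^sup>2 + 2 * (nrm M w * nrm M z)"
    using ip_Cauchy_Schwarz[OF assms] by simp
  finally show "(nrm M (\<lambda>x. w x + z x))\<^sup>2 \<le> (nrm M w + nrm M z)\<^sup>2"
    by (simp add: power2_sum)
qed simp

lemma nrm_scaleR: "nrm M (\<lambda>x. c *\<^sub>R w x) = \<bar>c\<bar> * nrm M w"
  by (simp add: nrm_def power_mult_distrib real_sqrt_mult)

lemma nrm_minus_commute: "nrm M (\<lambda>x. w x - z x) = nrm M (\<lambda>x. z x - w x)"
  by (simp add: nrm_def norm_minus_commute)

lemma nrm_triangle_diff:
  assumes "square_integrable M w" "square_integrable M y" "square_integrable M z"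
  shows "nrm M (\<lambda>x. w x - z x) \<le> nrm M (\<lambda>x. w x - y x) + nrm M (\<lambda>x. y x - z x)"
  using nrm_triangle[OF square_integrable_diff[OF assms(1,2)] square_integrable_diff[OF assms(2,3)]]
  by simp

lemma nrm_triangle_reverse:
  assumes "square_integrable M w" "square_integrable M z"
  shows "\<bar>nrm M w - nrm M z\<bar> \<le> nrm M (\<lambda>x. w x - z x)"
  using nrm_triangle[OF square_integrable_diff[OF assms] assms(2)]
    nrm_triangle[OF square_integrable_diff[OF assms(2,1)] assms(1)] nrm_minus_commute[of M w z]
  by simp

lemma nrm_sum_le:
  assumes "\<And>i. i \<in> I \<Longrightarrow> square_integrable M (w i)"
  shows "nrm M (\<lambda>x. \<Sum>i\<in>I. w i x) \<le> (\<Sum>i\<in>I. nrm M (w i))"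
  using assms
proof (induction I rule: infinite_finite_induct)
  case (insert i I)
  have "nrm M (\<lambda>x. w i x + (\<Sum>i\<in>I. w i x)) \<le> nrm M (w i) + nrm M (\<lambda>x. \<Sum>i\<in>I. w i x)"
    using insert by (intro nrm_triangle square_integrable_sum) auto
  then show ?case using insert by simp
qed (auto simp: nrm_def)

lemma ip_cong_AE:
  assumes "square_integrable M w" "square_integrable M z" "square_integrable M w'"
    "square_integrable M z'" "AE x in M. w x = w' x" "AE x in M. z x = z' x"
  shows "ip M w z = ip M w' z'"
  unfolding ip_def
proof (rule integral_cong_AE)
  show "AE x in M. w x \<bullet> z x = w' x \<bullet> z' x" using assms(5,6) by eventually_elim simp
qed (use assms in \<open>auto simp: square_integrable_def\<close>)

definition L2_continuous :: "'a measure \<Rightarrow> real set \<Rightarrow> (real \<Rightarrow> 'a \<Rightarrow> 'b::euclidean_space) \<Rightarrow> bool" where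
  "L2_continuous M S u \<longleftrightarrow> (\<forall>t\<in>S. square_integrable M (u t)) \<and>
     (\<forall>t\<in>S. ((\<lambda>s. nrm M (\<lambda>x. u s x - u t x)) \<longlongrightarrow> 0) (at t within S))"

lemma L2_continuous_subset: "L2_continuous M S u \<Longrightarrow> R \<subseteq> S \<Longrightarrow> L2_continuous M R u"
  unfolding L2_continuous_def by (meson subsetD tendsto_within_subset)

lemma L2_continuous_const: "square_integrable M h \<Longrightarrow> L2_continuous M S (\<lambda>t. h)"
  by (simp add: L2_continuous_def nrm_def)

lemma L2_continuous_ip:
  assumes u: "L2_continuous M S u" and v: "L2_continuous M S v"
  shows "continuous_on S (\<lambda>t. ip M (u t) (v t))"
  unfolding continuous_on_def
proof
  fix t assume t: "t \<in> S"
  let ?du = "\<lambda>s. nrm M (\<lambda>x. u s x - u t x)" and ?dv = "\<lambda>s. nrm M (\<lambda>x. v s x - v t x)"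
  have du: "(?du \<longlongrightarrow> 0) (at t within S)" and dv: "(?dv \<longlongrightarrow> 0) (at t within S)"
    using u v t by (auto simp: L2_continuous_def)
  have lim: "((\<lambda>s. ?du s * (?dv s + nrm M (v t)) + nrm M (u t) * ?dv s) \<longlongrightarrow> 0) (at t within S)"
    by (rule tendsto_eq_intros du dv refl | simp)+
  have "((\<lambda>s. ip M (u s) (v s) - ip M (u t) (v t)) \<longlongrightarrow> 0) (at t within S)"
  proof (rule Lim_null_comparison[OF _ lim])
    have "\<bar>ip M (u s) (v s) - ip M (u t) (v t)\<bar> \<le> ?du s * (?dv s + nrm M (v t)) + nrm M (u t) * ?dv s"
      if s: "s \<in> S" for s
    proof -
      have sq: "square_integrable M (u s)" "square_integrable M (v s)"
        "square_integrable M (u t)" "square_integrable M (v t)"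
        using u v s t by (auto simp: L2_continuous_def)
      have "ip M (u s) (v s) - ip M (u t) (v t)
          = ip M (\<lambda>x. u s x - u t x) (v s) + ip M (u t) (\<lambda>x. v s x - v t x)"
        using sq by (simp add: ip_diff_left ip_diff_right)
      moreover have "\<bar>ip M (\<lambda>x. u s x - u t x) (v s)\<bar> \<le> ?du s * nrm M (v s)"
        "\<bar>ip M (u t) (\<lambda>x. v s x - v t x)\<bar> \<le> nrm M (u t) * ?dv s"
        using sq by (auto intro!: ip_Cauchy_Schwarz square_integrable_diff)
      moreover have "?du s * nrm M (v s) \<le> ?du s * (?dv s + nrm M (v t))"
        using nrm_triangle_reverse[OF sq(2,4)] by (intro mult_left_mono) auto
      ultimately show ?thesis by linarith
    qed
    then show "\<forall>\<^sub>F s in at t within S. norm (ip M (u s) (v s) - ip M (u t) (v t))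
        \<le> ?du s * (?dv s + nrm M (v t)) + nrm M (u t) * ?dv s"
      by (auto simp: eventually_at_filter)
  qed
  then show "((\<lambda>s. ip M (u s) (v s)) \<longlongrightarrow> ip M (u t) (v t)) (at t within S)"
    by (simp add: LIM_zero_iff)
qed

lemma L2_continuous_norm_square:
  "L2_continuous M S u \<Longrightarrow> continuous_on S (\<lambda>t. (nrm M (u t))\<^sup>2)"
  unfolding nrm_square by (rule L2_continuous_ip)

text \<open>
  This is the theorem of Heine and Cantor, but curves into a seminormed set of functions do not
  live in a metric space type, so the compactness argument is carried out on sequences of times.
\<close>

lemma L2_continuous_uniform:
  assumes u: "L2_continuous M S u" and S: "compact S" and e: "e > 0"
  obtains d where "d > 0" "\<And>s t. s \<in> S \<Longrightarrow> t \<in> S \<Longrightarrow> \<bar>s - t\<bar> < d \<Longrightarrow> nrm M (\<lambda>x. u s x - u t x) < e"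
proof -
  have sq: "square_integrable M (u s)" if "s \<in> S" for s using that u by (auto simp: L2_continuous_def)
  have "\<exists>d>0. \<forall>s\<in>S. \<forall>t\<in>S. \<bar>s - t\<bar> < d \<longrightarrow> nrm M (\<lambda>x. u s x - u t x) < e"
  proof (rule ccontr)
    assume neg: "\<not> ?thesis"
    have "\<exists>s t. s \<in> S \<and> t \<in> S \<and> \<bar>s - t\<bar> < inverse (real (Suc n)) \<and> e \<le> nrm M (\<lambda>x. u s x - u t x)" for n
    proof -
      have "inverse (real (Suc n)) > 0" by simp
      then show ?thesis using neg by (meson not_le)
    qed
    then obtain s t where st: "\<And>n. s n \<in> S" "\<And>n. t n \<in> S"
      "\<And>n. \<bar>s n - t n\<bar> < inverse (real (Suc n))" "\<And>n. e \<le> nrm M (\<lambda>x. u (s n) x - u (t n) x)"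
      by metis
    obtain l r where l: "l \<in> S" "strict_mono (r :: nat \<Rightarrow> nat)" "(s \<circ> r) \<longlonglongrightarrow> l"
      using S st(1) unfolding compact_def by metis
    have "(\<lambda>n. \<bar>s n - t n\<bar>) \<longlonglongrightarrow> 0"
      by (rule tendsto_sandwich[OF _ _ tendsto_const LIMSEQ_inverse_real_of_nat])
        (auto intro!: always_eventually less_imp_le st(3)[simplified])
    then have "(\<lambda>n. s n - t n) \<longlonglongrightarrow> 0" by (simp add: tendsto_rabs_zero_iff)
    then have "((\<lambda>n. s n - t n) \<circ> r) \<longlonglongrightarrow> 0" using l(2) by (rule LIMSEQ_subseq_LIMSEQ)
    from tendsto_diff[OF l(3) this] have lt: "(t \<circ> r) \<longlonglongrightarrow> l" by (simp add: o_def)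
    have lim: "(\<lambda>n. nrm M (\<lambda>x. u (y n) x - u l x)) \<longlonglongrightarrow> 0" if "y \<longlonglongrightarrow> l" "\<And>n. y n \<in> S" for y
    proof -
      have "continuous (at l within S) (\<lambda>s. nrm M (\<lambda>x. u s x - u l x))"
        using u l(1) by (auto simp: L2_continuous_def continuous_within nrm_def)
      then have "((\<lambda>s. nrm M (\<lambda>x. u s x - u l x)) \<circ> y) \<longlonglongrightarrow> nrm M (\<lambda>x. u l x - u l x)"
        using that unfolding continuous_within_sequentially by blast
      then show ?thesis by (simp add: o_def nrm_def)
    qed
    have "(\<lambda>n. nrm M (\<lambda>x. u ((s \<circ> r) n) x - u l x) + nrm M (\<lambda>x. u ((t \<circ> r) n) x - u l x)) \<longlonglongrightarrow> 0 + 0"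
      using st by (intro tendsto_add lim l lt) auto
    then have "(\<lambda>n. nrm M (\<lambda>x. u ((s \<circ> r) n) x - u l x) + nrm M (\<lambda>x. u ((t \<circ> r) n) x - u l x)) \<longlonglongrightarrow> 0" by simp
    then have "e \<le> 0"
    proof (rule LIMSEQ_le_const, intro exI allI impI)
      fix n
      show "e \<le> nrm M (\<lambda>x. u ((s \<circ> r) n) x - u l x) + nrm M (\<lambda>x. u ((t \<circ> r) n) x - u l x)"
        using st(4)[of "r n"] nrm_triangle_diff[of M "u (s (r n))" "u l" "u (t (r n))"]
          sq st(1,2) l(1) nrm_minus_commute[of M "u (t (r n))" "u l"] by fastforce
    qed
    then show False using e by simp
  qed
  then show ?thesis using that by blast
qed

lemma L2_continuous_add:
  assumes "L2_continuous M S u" "L2_continuous M S v"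
  shows "L2_continuous M S (\<lambda>t x. u t x + v t x)"
  unfolding L2_continuous_def
proof (intro conjI ballI)
  fix t assume t: "t \<in> S"
  show "square_integrable M (\<lambda>x. u t x + v t x)"
    using assms t by (auto simp: L2_continuous_def intro: square_integrable_add)
  have lim: "((\<lambda>s. nrm M (\<lambda>x. u s x - u t x) + nrm M (\<lambda>x. v s x - v t x)) \<longlongrightarrow> 0) (at t within S)"
    using assms t by (auto simp: L2_continuous_def intro!: tendsto_add_zero)
  show "((\<lambda>s. nrm M (\<lambda>x. u s x + v s x - (u t x + v t x))) \<longlongrightarrow> 0) (at t within S)"
  proof (rule Lim_null_comparison[OF _ lim])
    have "nrm M (\<lambda>x. u s x + v s x - (u t x + v t x))
        \<le> nrm M (\<lambda>x. u s x - u t x) + nrm M (\<lambda>x. v s x - v t x)" if "s \<in> S" for s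
      using nrm_triangle[of M "\<lambda>x. u s x - u t x" "\<lambda>x. v s x - v t x"] assms t that
      by (auto simp: L2_continuous_def algebra_simps intro: square_integrable_diff)
    then show "\<forall>\<^sub>F s in at t within S. norm (nrm M (\<lambda>x. u s x + v s x - (u t x + v t x)))
       \<le> nrm M (\<lambda>x. u s x - u t x) + nrm M (\<lambda>x. v s x - v t x)"
      by (auto simp: eventually_at_filter)
  qed
qed

lemma L2_continuous_scaleR:
  assumes \<phi>: "continuous_on S \<phi>" and h: "square_integrable M h"
  shows "L2_continuous M S (\<lambda>t x. \<phi> t *\<^sub>R h x)"
proof -
  have "((\<lambda>s. nrm M (\<lambda>x. \<phi> s *\<^sub>R h x - \<phi> t *\<^sub>R h x)) \<longlongrightarrow> 0) (at t within S)" if "t \<in> S" for t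
  proof -
    have "((\<lambda>s. \<bar>\<phi> s - \<phi> t\<bar> * nrm M h) \<longlongrightarrow> \<bar>\<phi> t - \<phi> t\<bar> * nrm M h) (at t within S)"
      using \<phi> that by (intro tendsto_intros) (auto simp: continuous_on_def)
    then show ?thesis by (simp add: nrm_scaleR flip: scaleR_diff_left)
  qed
  then show ?thesis using h by (auto simp: L2_continuous_def intro: square_integrable_scaleR)
qed

lemma L2_continuous_sum:
  assumes "\<And>i. i \<in> I \<Longrightarrow> L2_continuous M S (u i)"
  shows "L2_continuous M S (\<lambda>t x. \<Sum>i\<in>I. u i t x)"
  using assms
proof (induction I rule: infinite_finite_induct)
  case (insert i I)
  then show ?case using L2_continuous_add[of M S "u i" "\<lambda>t x. \<Sum>i\<in>I. u i t x"] by simp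
qed (auto simp: L2_continuous_const square_integrable_zero)

section \<open>Uniqueness of weak gradients\<close>

lemma sq_L2_space: "w \<in> L2_space \<Omega> \<longleftrightarrow> square_integrable (lebesgue_on \<Omega>) w"
  by (simp add: L2_space_def square_integrable_def)

lemma smooth_real_continuous_on:
  assumes "smooth_real g" shows "continuous_on S g"
proof -
  obtain g' where "\<And>x. (g has_real_derivative g' x) (at x)" using smooth_real_deriv[OF assms] by blast
  then show ?thesis
    by (intro continuous_at_imp_continuous_on ballI) (rule DERIV_isCont)
qed

text \<open>
  These products approximate the indicator function of the open box from inside as \<open>k\<close> grows.
\<close>

lemma test_function_box:
  fixes a b :: "'a::euclidean_space"
  assumes sub: "cbox a b \<subseteq> U" and "k > 0"
  shows "(\<lambda>x. \<Prod>i\<in>Basis. smooth_step (k * (x \<bullet> i - a \<bullet> i)) * smooth_step (k * (b \<bullet> i - x \<bullet> i)))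
    \<in> test_functions U"
proof -
  define g where "g i t = smooth_step (k * t + (- k * (a \<bullet> i))) * smooth_step ((- k) * t + k * (b \<bullet> i))" for i t
  have g: "smooth_real (g i)" for i unfolding g_def
    by (intro smooth_real_mult smooth_real_affine smooth_step_smooth)
  have eq: "(\<lambda>x. \<Prod>i\<in>Basis. smooth_step (k * (x \<bullet> i - a \<bullet> i)) * smooth_step (k * (b \<bullet> i - x \<bullet> i)))
      = (\<lambda>x. \<Prod>i\<in>Basis. g i (x \<bullet> i))" (is "?f = _")
    by (simp add: g_def algebra_simps)
  have "{x. ?f x \<noteq> 0} \<subseteq> cbox a b"
  proof
    fix x assume "x \<in> {x. ?f x \<noteq> 0}"
    then have nz: "smooth_step (k * (x \<bullet> i - a \<bullet> i)) \<noteq> 0" "smooth_step (k * (b \<bullet> i - x \<bullet> i)) \<noteq> 0"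
      if "i \<in> Basis" for i using that by auto
    have "a \<bullet> i \<le> x \<bullet> i" "x \<bullet> i \<le> b \<bullet> i" if "i \<in> Basis" for i
    proof -
      have "\<not> k * (x \<bullet> i - a \<bullet> i) \<le> 0" "\<not> k * (b \<bullet> i - x \<bullet> i) \<le> 0"
        using nz[OF that] smooth_step_left by blast+
      then show "a \<bullet> i \<le> x \<bullet> i" "x \<bullet> i \<le> b \<bullet> i"
        using \<open>k > 0\<close> by (auto simp: mult_le_0_iff not_le zero_less_mult_iff)
    qed
    then show "x \<in> cbox a b" by (simp add: mem_box)
  qed
  then have cl: "closure {x. ?f x \<noteq> 0} \<subseteq> cbox a b" by (rule closure_minimal[OF _ closed_cbox])
  have "bounded (closure {x. ?f x \<noteq> 0})" using cl bounded_cbox bounded_subset by blast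
  then have "compact (closure {x. ?f x \<noteq> 0})"
    by (simp only: compact_eq_bounded_closed closed_closure simp_thms)
  moreover have "smooth_fun ?f" unfolding eq by (rule smooth_fun_product[where g=g, OF g])
  moreover have "closure {x. ?f x \<noteq> 0} \<subseteq> U" using cl sub by (rule subset_trans)
  ultimately show ?thesis unfolding test_functions_def mem_Collect_eq by (intro conjI)
qed

lemma smooth_step_scaled_tendsto:
  "(\<lambda>n. smooth_step (real n * c)) \<longlonglongrightarrow> (if c > 0 then 1 else 0)"
proof (cases "c > 0")
  case True
  have "eventually (\<lambda>n. real n * c \<ge> 1) sequentially"
    using eventually_ge_at_top[of "nat \<lceil>1 / c\<rceil>"]
  proof eventually_elim
    case (elim n)
    then have "1 / c \<le> real n" by linarith
    then show ?case using True by (simp add: field_simps)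
  qed
  then have "eventually (\<lambda>n. smooth_step (real n * c) = 1) sequentially"
    by eventually_elim (rule smooth_step_right)
  then show ?thesis using True by (simp add: tendsto_eventually)
next
  case False
  then have "smooth_step (real n * c) = 0" for n
    by (intro smooth_step_left) (simp add: mult_nonneg_nonpos)
  then show ?thesis using False by simp
qed

lemma smooth_step_box_tendsto:
  fixes a b x :: "'a::euclidean_space"
  shows "(\<lambda>n. \<Prod>i\<in>Basis. smooth_step (real n * (x \<bullet> i - a \<bullet> i)) * smooth_step (real n * (b \<bullet> i - x \<bullet> i)))
    \<longlonglongrightarrow> indicator (box a b) x"
proof -
  have "(\<lambda>n. \<Prod>i\<in>Basis. smooth_step (real n * (x \<bullet> i - a \<bullet> i)) * smooth_step (real n * (b \<bullet> i - x \<bullet> i)))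
     \<longlonglongrightarrow> (\<Prod>i\<in>Basis. (if x \<bullet> i - a \<bullet> i > 0 then 1 else 0) * (if b \<bullet> i - x \<bullet> i > 0 then 1 else 0))"
    by (intro tendsto_prod tendsto_mult smooth_step_scaled_tendsto)
  also have "(\<Prod>i\<in>Basis. (if x \<bullet> i - a \<bullet> i > 0 then 1 else 0) * (if b \<bullet> i - x \<bullet> i > 0 then 1 else 0))
     = (indicator (box a b) x :: real)"
  proof (cases "x \<in> box a b")
    case True
    then show ?thesis by (simp add: mem_box)
  next
    case False
    then obtain i where "i \<in> Basis" "\<not> (a \<bullet> i < x \<bullet> i \<and> x \<bullet> i < b \<bullet> i)" by (auto simp: mem_box)
    then show ?thesis using False
      by (auto intro!: prod_zero bexI[of _ i] simp: indicator_def)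
  qed
  finally show ?thesis .
qed

text \<open>
  The fundamental lemma of the calculus of variations. Test functions that converge to indicator
  functions of boxes show that the integral over every box in \<open>U\<close> vanishes; almost every
  point is a limit of averages over small cubes, so the function vanishes almost everywhere.
\<close>

lemma integrable_zero_if_orthogonal_test_functions:
  fixes g :: "'a::euclidean_space \<Rightarrow> real"
  assumes U: "open U" and g: "integrable (lebesgue_on U) g"
    and zero: "\<And>\<phi>. \<phi> \<in> test_functions U \<Longrightarrow> (LINT x|lebesgue_on U. g x * \<phi> x) = 0"
  shows "AE x in lebesgue_on U. g x = 0"
proof -
  have Us: "U \<in> sets lebesgue" using U by simp
  define f where "f x = (if x \<in> U then g x else 0)" for x
  have fi: "integrable lebesgue f"
    unfolding f_def using g Lebesgue_Measure.integrable_restrict_UNIV[OF Us, of g] by blast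
  have f_on: "f absolutely_integrable_on S" if "S \<in> sets lebesgue" for S
    using fi that unfolding set_integrable_def by (rule integrable_mult_indicator[rotated])
  have box0: "integral (cbox a b) f = 0" if ab: "cbox a b \<subseteq> U" for a b
  proof -
    let ?\<phi> = "\<lambda>n x. \<Prod>i\<in>Basis. smooth_step (real n * (x \<bullet> i - a \<bullet> i)) * smooth_step (real n * (b \<bullet> i - x \<bullet> i))"
    have m: "?\<phi> n \<in> borel_measurable (lebesgue_on U)" for n
    proof -
      have sc: "continuous_on UNIV (\<lambda>x::'a. smooth_step (c x))" if "continuous_on UNIV c" for c
        using continuous_on_compose2[OF smooth_real_continuous_on[OF smooth_step_smooth] that, of UNIV] by auto
      have "continuous_on UNIV (?\<phi> n)"
        by (intro continuous_on_prod continuous_on_mult sc continuous_on_diff continuous_on_inner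
            continuous_on_const continuous_on_id)
      then show ?thesis
        by (intro continuous_imp_measurable_on_sets_lebesgue[OF continuous_on_subset]) (use Us in auto)
    qed
    have bd: "norm (?\<phi> n x) \<le> 1" for n x
      unfolding prod_norm[symmetric]
      by (intro prod_le_1) (auto simp: abs_mult smooth_step_bounds intro!: mult_le_one)
    have "(\<lambda>n. LINT x|lebesgue_on U. g x * ?\<phi> n x) \<longlonglongrightarrow> (LINT x|lebesgue_on U. g x * indicator (box a b) x)"
    proof (rule integral_dominated_convergence)
      show "integrable (lebesgue_on U) (\<lambda>x. norm (g x))" using g by simp
      show "AE x in lebesgue_on U. (\<lambda>n. g x * ?\<phi> n x) \<longlonglongrightarrow> g x * indicator (box a b) x"
        by (intro AE_I2 tendsto_mult tendsto_const smooth_step_box_tendsto)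
      show "AE x in lebesgue_on U. norm (g x * ?\<phi> n x) \<le> norm (g x)" for n
        using bd by (intro AE_I2) (simp add: abs_mult mult_left_le)
      show "(\<lambda>x. g x * indicator (box a b) x) \<in> borel_measurable (lebesgue_on U)"
        by (intro borel_measurable_times borel_measurable_integrable[OF g]
            measurable_restrict_space1[OF borel_measurable_indicator]) auto
    qed (use g m Us in \<open>auto intro!: borel_measurable_times\<close>)
    moreover have "\<forall>\<^sub>F n in sequentially. (LINT x|lebesgue_on U. g x * ?\<phi> n x) = 0"
      using eventually_gt_at_top[of 0]
      by eventually_elim (auto intro!: zero test_function_box ab)
    ultimately have "(LINT x|lebesgue_on U. g x * indicator (box a b) x) = 0"
      by (rule LIMSEQ_unique[OF _ tendsto_eventually])
    also have "(LINT x|lebesgue_on U. g x * indicator (box a b) x)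
        = (LINT x|lebesgue. indicator (box a b) x *\<^sub>R f x)"
      by (subst Lebesgue_Measure.integral_restrict_UNIV[OF Us, symmetric])
        (auto simp: f_def intro!: Bochner_Integration.integral_cong split: split_indicator)
    also have "\<dots> = integral (box a b) f"
      using set_lebesgue_integral_eq_integral(2)[OF f_on[of "box a b"]]
      by (simp add: set_lebesgue_integral_def)
    finally show ?thesis by (simp add: integral_open_interval)
  qed
  obtain N where N: "negligible N"
    "\<And>x e. \<lbrakk>x \<notin> N; 0 < e\<rbrakk> \<Longrightarrow> \<exists>d>0. \<forall>h. 0 < h \<and> h < d \<longrightarrow>
        norm (integral (cbox x (x + h *\<^sub>R One)) f /\<^sub>R h ^ DIM('a) - f x) < e"
  proof (rule integrable_ccontinuous_explicit[of f])
    show "f integrable_on cbox a b" for a b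
      using f_on[of "cbox a b"] set_lebesgue_integral_eq_integral(1) by auto
  qed blast
  have "g x = 0" if x: "x \<in> U" "x \<notin> N" for x
  proof (rule ccontr)
    assume nz: "g x \<noteq> 0"
    obtain r where r: "r > 0" "ball x r \<subseteq> U" using U x openE by blast
    define C where "C = norm (One :: 'a)"
    obtain d where d: "d > 0" "\<And>h. 0 < h \<Longrightarrow> h < d \<Longrightarrow>
        norm (integral (cbox x (x + h *\<^sub>R One)) f /\<^sub>R h ^ DIM('a) - f x) < \<bar>g x\<bar>"
      using N(2)[OF x(2), of "\<bar>g x\<bar>"] nz by auto
    \<comment> \<open>Small enough for the averaging estimate and for the cube of side \<open>h\<close>, whose diameter is \<open>h * C\<close>, to lie in \<open>U\<close>.\<close>
    define h where "h = min (d/2) (r / (2 * (C + 1)))"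
    have C: "C \<ge> 0" by (simp add: C_def)
    then have h: "h > 0" "h < d" "h * C < r"
    proof -
      show "h > 0" using d(1) r(1) C by (auto simp: h_def)
      show "h < d" using d(1) by (auto simp: h_def)
      have "h * C \<le> r / (2 * (C + 1)) * C" using C by (intro mult_right_mono) (auto simp: h_def)
      also have "\<dots> < r" using C r(1) by (simp add: field_simps add_nonneg_pos)
      finally show "h * C < r" .
    qed
    have "cbox x (x + h *\<^sub>R One) \<subseteq> ball x r"
    proof
      fix y assume "y \<in> cbox x (x + h *\<^sub>R One)"
      then have "norm (y - x) \<le> norm (h *\<^sub>R One :: 'a)"
        by (intro norm_le_componentwise) (auto simp: mem_box inner_simps)
      then show "y \<in> ball x r" using h by (simp add: dist_norm norm_minus_commute C_def)
    qed
    then have "integral (cbox x (x + h *\<^sub>R One)) f = 0" using r box0 by blast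
    then show False using d(2)[OF h(1,2)] x by (simp add: f_def)
  qed
  then have "{x \<in> space (lebesgue_on U). g x \<noteq> 0} \<subseteq> N" by auto
  moreover have "AE x in lebesgue. x \<notin> N"
    using N(1) by (simp add: AE_not_in negligible_iff_null_sets)
  ultimately have "AE x in lebesgue. x \<in> U \<longrightarrow> g x = 0" by (auto elim!: eventually_mono)
  then show ?thesis using Us by (simp add: AE_restrict_space_iff)
qed


lemma continuous_square_integrable:
  fixes \<phi> :: "'a::euclidean_space \<Rightarrow> real"
  assumes c: "continuous_on UNIV \<phi>" and \<Omega>: "open \<Omega>" "bounded \<Omega>"
  shows "square_integrable (lebesgue_on \<Omega>) \<phi>"
proof -
  have fin: "finite_measure (lebesgue_on \<Omega>)"
    using \<Omega> by (intro finite_measure_lebesgue_on lmeasurable_open)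
  have m: "\<phi> \<in> borel_measurable (lebesgue_on \<Omega>)"
    using c \<Omega> by (intro continuous_imp_measurable_on_sets_lebesgue[OF continuous_on_subset[OF c]]) auto
  have "compact (\<phi> ` closure \<Omega>)"
    using \<Omega> c by (intro compact_continuous_image continuous_on_subset[OF c]) (auto simp: compact_closure)
  then obtain B where B: "\<And>y. y \<in> \<phi> ` closure \<Omega> \<Longrightarrow> norm y \<le> B"
    using compact_imp_bounded bounded_iff by metis
  have "integrable (lebesgue_on \<Omega>) (\<lambda>x. (norm (\<phi> x))\<^sup>2)"
  proof (rule finite_measure.integrable_const_bound[OF fin])
    have "\<bar>\<phi> x\<bar>\<^sup>2 \<le> B\<^sup>2" if "x \<in> \<Omega>" for x
      using B[of "\<phi> x"] that closure_subset[of \<Omega>] by (intro power_mono) auto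
    then show "AE x in lebesgue_on \<Omega>. norm ((norm (\<phi> x))\<^sup>2) \<le> B\<^sup>2" by (intro AE_I2) auto
  qed (use m in auto)
  then show ?thesis using m by (simp add: square_integrable_def)
qed

lemma smooth_fun_continuous: "smooth_fun \<phi> \<Longrightarrow> continuous_on UNIV \<phi>"
  and smooth_fun_partial_continuous:
    "smooth_fun \<phi> \<Longrightarrow> b \<in> Basis \<Longrightarrow> continuous_on UNIV (\<lambda>x. frechet_derivative \<phi> (at x) b)"
proof -
  assume s: "smooth_fun \<phi>"
  have c: "continuous_on UNIV (partials bs \<phi>)" if "set bs \<subseteq> Basis" for bs
    using s that unfolding smooth_fun_def
    by (intro continuous_at_imp_continuous_on ballI differentiable_imp_continuous_within) auto
  show "continuous_on UNIV \<phi>" using c[of "[]"] by simp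
  show "continuous_on UNIV (\<lambda>x. frechet_derivative \<phi> (at x) b)" if "b \<in> Basis"
    using c[of "[b]"] that by simp
qed

lemma test_function_square_integrable:
  assumes "\<phi> \<in> test_functions \<Omega>" "open \<Omega>" "bounded \<Omega>"
  shows "square_integrable (lebesgue_on \<Omega>) \<phi>"
    and "b \<in> Basis \<Longrightarrow> square_integrable (lebesgue_on \<Omega>) (\<lambda>x. frechet_derivative \<phi> (at x) b)"
proof -
  have s: "smooth_fun \<phi>" using assms(1) by (simp add: test_functions_def)
  show "square_integrable (lebesgue_on \<Omega>) \<phi>"
    by (rule continuous_square_integrable[OF smooth_fun_continuous[OF s] assms(2,3)])
  show "square_integrable (lebesgue_on \<Omega>) (\<lambda>x. frechet_derivative \<phi> (at x) b)" if "b \<in> Basis"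
    by (rule continuous_square_integrable[OF smooth_fun_partial_continuous[OF s that] assms(2,3)])
qed

lemma L2_inner_ip: "L2_inner \<Omega> = ip (lebesgue_on \<Omega>)"
  by (intro ext) (simp add: L2_inner_def ip_def)

lemma weak_gradient_square_integrable:
  assumes "weak_gradient \<Omega> w G"
  shows "square_integrable (lebesgue_on \<Omega>) G"
proof -
  have c: "(\<lambda>x. G x \<bullet> b) \<in> borel_measurable (lebesgue_on \<Omega>)"
      "integrable (lebesgue_on \<Omega>) (\<lambda>x. (G x \<bullet> b)\<^sup>2)" if "b \<in> Basis" for b
    using assms that by (auto simp: weak_gradient_def L2_space_def)
  have "(\<lambda>x. (norm (G x))\<^sup>2) = (\<lambda>x. \<Sum>b\<in>Basis. (G x \<bullet> b)\<^sup>2)"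
  proof
    fix x show "(norm (G x))\<^sup>2 = (\<Sum>b\<in>Basis. (G x \<bullet> b)\<^sup>2)"
      using euclidean_inner[of "G x" "G x"] by (simp only: power2_norm_eq_inner) (simp add: power2_eq_square)
  qed
  moreover have "integrable (lebesgue_on \<Omega>) (\<lambda>x. \<Sum>b\<in>Basis. (G x \<bullet> b)\<^sup>2)"
    using c(2) by (rule Bochner_Integration.integrable_sum)
  moreover have "G \<in> borel_measurable (lebesgue_on \<Omega>)"
    by (rule borel_measurable_euclidean_space[THEN iffD2]) (use c(1) in blast)
  ultimately show ?thesis by (simp only: square_integrable_def)
qed

lemma weak_gradient_diff:
  assumes \<Omega>: "open \<Omega>" "bounded \<Omega>" and w: "w \<in> L2_space \<Omega>" and z: "z \<in> L2_space \<Omega>"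
    and G: "weak_gradient \<Omega> w G" and H: "weak_gradient \<Omega> z H"
  shows "weak_gradient \<Omega> (\<lambda>x. w x - z x) (\<lambda>x. G x - H x)"
  unfolding weak_gradient_def
proof (intro ballI conjI)
  fix b :: 'a assume b: "b \<in> Basis"
  let ?M = "lebesgue_on \<Omega>"
  have sq: "square_integrable ?M (\<lambda>x. G x \<bullet> b)" "square_integrable ?M (\<lambda>x. H x \<bullet> b)"
    "square_integrable ?M w" "square_integrable ?M z"
    using G H w z b by (auto simp: weak_gradient_def sq_L2_space)
  show "(\<lambda>x. (G x - H x) \<bullet> b) \<in> L2_space \<Omega>"
    using square_integrable_diff[OF sq(1,2)] by (simp add: sq_L2_space inner_diff_left)
  fix \<phi> assume \<phi>: "\<phi> \<in> test_functions \<Omega>"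
  have "L2_inner \<Omega> w (\<lambda>x. frechet_derivative \<phi> (at x) b) = - L2_inner \<Omega> (\<lambda>x. G x \<bullet> b) \<phi>"
    "L2_inner \<Omega> z (\<lambda>x. frechet_derivative \<phi> (at x) b) = - L2_inner \<Omega> (\<lambda>x. H x \<bullet> b) \<phi>"
    using G H b \<phi> by (auto simp: weak_gradient_def)
  then show "L2_inner \<Omega> (\<lambda>x. w x - z x) (\<lambda>x. frechet_derivative \<phi> (at x) b)
      = - L2_inner \<Omega> (\<lambda>x. (G x - H x) \<bullet> b) \<phi>"
    using sq test_function_square_integrable[OF \<phi> \<Omega>] b
    by (simp add: L2_inner_ip ip_diff_left inner_diff_left)
qed

text \<open>
  Each component of the difference is orthogonal to all test functions. It is integrable because
  a bounded set has finite measure.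
\<close>

lemma weak_gradient_unique:
  fixes \<Omega> :: "'a::euclidean_space set"
  assumes \<Omega>: "open \<Omega>" "bounded \<Omega>"
    and G: "weak_gradient \<Omega> w G" and H: "weak_gradient \<Omega> w H"
  shows "AE x in lebesgue_on \<Omega>. G x = H x"
proof -
  let ?M = "lebesgue_on \<Omega>"
  have "AE x in ?M. \<forall>b\<in>Basis. G x \<bullet> b - H x \<bullet> b = 0"
  proof (rule AE_finite_allI[OF finite_Basis])
    fix b :: 'a assume b: "b \<in> Basis"
    have sq: "square_integrable ?M (\<lambda>x. G x \<bullet> b)" "square_integrable ?M (\<lambda>x. H x \<bullet> b)"
      using G H b by (auto simp: weak_gradient_def sq_L2_space)
    have one: "square_integrable ?M (\<lambda>x. 1::real)"
      by (rule continuous_square_integrable[OF _ \<Omega>]) simp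
    show "AE x in ?M. G x \<bullet> b - H x \<bullet> b = 0"
    proof (rule integrable_zero_if_orthogonal_test_functions[OF \<Omega>(1)])
      show "integrable ?M (\<lambda>x. G x \<bullet> b - H x \<bullet> b)"
        using ip_integrable[OF square_integrable_diff[OF sq] one] by simp
      fix \<phi> assume \<phi>: "\<phi> \<in> test_functions \<Omega>"
      have "L2_inner \<Omega> (\<lambda>x. G x \<bullet> b) \<phi> = L2_inner \<Omega> (\<lambda>x. H x \<bullet> b) \<phi>"
        using G H b \<phi> by (auto simp: weak_gradient_def)
      then show "(LINT x|?M. (G x \<bullet> b - H x \<bullet> b) * \<phi> x) = 0"
        using ip_diff_left[OF sq test_function_square_integrable(1)[OF \<phi> \<Omega>]]
        by (simp add: L2_inner_ip) (simp add: ip_def)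
    qed
  qed
  then show ?thesis
  proof eventually_elim
    case (elim x)
    then show ?case by (intro euclidean_eqI[of "G x" "H x"]) simp
  qed
qed

lemma grad_weak_gradient:
  assumes "w \<in> H1_space \<Omega>" shows "weak_gradient \<Omega> w (grad \<Omega> w)"
proof -
  from assms have "\<exists>G. weak_gradient \<Omega> w G" by (simp add: H1_space_def)
  then show ?thesis unfolding grad_def by (rule someI_ex)
qed

lemma grad_square_integrable: "w \<in> H1_space \<Omega> \<Longrightarrow> square_integrable (lebesgue_on \<Omega>) (grad \<Omega> w)"
  by (rule weak_gradient_square_integrable[OF grad_weak_gradient])

text \<open>
  The chosen representative of the gradient of a difference agrees almost everywhere with the
  difference of the chosen representatives. This transfers convergence in the \<open>H\<^sup>1\<close> norm to
  convergence of the gradients.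
\<close>

lemma nrm_grad_diff_le_H1_norm:
  assumes \<Omega>: "open \<Omega>" "bounded \<Omega>" and w: "w \<in> H1_space \<Omega>" and z: "z \<in> H1_space \<Omega>"
  shows "nrm (lebesgue_on \<Omega>) (\<lambda>x. grad \<Omega> w x - grad \<Omega> z x) \<le> H1_norm \<Omega> (\<lambda>x. w x - z x)"
proof -
  let ?M = "lebesgue_on \<Omega>" and ?d = "\<lambda>x. w x - z x"
  have wg: "weak_gradient \<Omega> ?d (\<lambda>x. grad \<Omega> w x - grad \<Omega> z x)"
    using w z by (intro weak_gradient_diff \<Omega> grad_weak_gradient) (auto simp: H1_space_def)
  from someI[of "weak_gradient \<Omega> ?d", OF wg] have "weak_gradient \<Omega> ?d (grad \<Omega> ?d)"
    by (simp add: grad_def)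
  then have ae: "AE x in ?M. grad \<Omega> w x - grad \<Omega> z x = grad \<Omega> ?d x"
    and sq: "square_integrable ?M (grad \<Omega> ?d)"
    by (rule weak_gradient_unique[OF \<Omega> wg], rule weak_gradient_square_integrable)
  have sq': "square_integrable ?M (\<lambda>x. grad \<Omega> w x - grad \<Omega> z x)"
    using wg by (rule weak_gradient_square_integrable)
  have "(nrm ?M (\<lambda>x. grad \<Omega> w x - grad \<Omega> z x))\<^sup>2 = (nrm ?M (grad \<Omega> ?d))\<^sup>2"
    unfolding nrm_square by (rule ip_cong_AE) (use sq sq' ae in auto)
  then have "nrm ?M (\<lambda>x. grad \<Omega> w x - grad \<Omega> z x) = nrm ?M (grad \<Omega> ?d)" by simp
  also have "\<dots> \<le> H1_norm \<Omega> ?d" by (simp add: nrm_def H1_norm_def)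
  finally show ?thesis .
qed

section \<open>Approximating a measurable curve by a continuous one\<close>

lemma borel_measurable_AE_lim:
  fixes f :: "nat \<Rightarrow> 'a::euclidean_space \<Rightarrow> real"
  assumes A: "A \<in> sets lebesgue" and f: "\<And>k. f k \<in> borel_measurable (lebesgue_on A)"
    and lim: "AE x in lebesgue_on A. (\<lambda>k. f k x) \<longlonglongrightarrow> g x"
  shows "g \<in> borel_measurable (lebesgue_on A)"
proof -
  define h where "h x = lim (\<lambda>k. f k x)" for x
  have h: "h \<in> borel_measurable (lebesgue_on A)"
    unfolding h_def by (rule borel_measurable_lim_metric[OF f])
  have "AE x in lebesgue_on A. h x = g x"
    using lim by eventually_elim (simp add: h_def limI)
  then have "AE x in lebesgue. (if x \<in> A then h x else 0) = (if x \<in> A then g x else 0)"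
    using A by (auto simp: AE_restrict_space_iff elim!: eventually_mono)
  then have "(\<lambda>x. if x \<in> A then g x else 0) \<in> borel_measurable lebesgue"
    by (rule borel_measurable_AE[rotated]) (rule borel_measurable_if_I[OF h A])
  then show ?thesis by (rule borel_measurable_if_D)
qed

text \<open>
  Approximation by simple functions almost everywhere in time, stated for the seminorm on
  vector-valued functions so that it applies to the gradients of a solution.
\<close>

definition strongly_measurable ::
    "'a measure \<Rightarrow> real \<Rightarrow> (real \<Rightarrow> 'a \<Rightarrow> 'b::euclidean_space) \<Rightarrow> bool" where
  "strongly_measurable M T g \<longleftrightarrow> (\<exists>S :: nat \<Rightarrow> real \<Rightarrow> 'a \<Rightarrow> 'b.
     (\<forall>k. simple_function (lebesgue_on {0<..<T}) (S k) \<and>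
          (\<forall>t\<in>{0<..<T}. square_integrable M (S k t))) \<and>
     (AE t in lebesgue_on {0<..<T}. square_integrable M (g t) \<and>
          (\<lambda>k. nrm M (\<lambda>x. S k t x - g t x)) \<longlonglongrightarrow> 0))"

lemma borel_measurable_nrm_diff_simple:
  assumes g: "strongly_measurable M T g"
    and \<sigma>: "simple_function (lebesgue_on {0<..<T}) \<sigma>" "\<And>t. t \<in> {0<..<T} \<Longrightarrow> square_integrable M (\<sigma> t)"
  shows "(\<lambda>t. nrm M (\<lambda>x. g t x - \<sigma> t x)) \<in> borel_measurable (lebesgue_on {0<..<T})"
proof -
  let ?L = "lebesgue_on {0<..<T}"
  obtain S where S: "\<And>k. simple_function ?L (S k)"
    "\<And>k t. t \<in> {0<..<T} \<Longrightarrow> square_integrable M (S k t)"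
    "AE t in ?L. square_integrable M (g t) \<and> (\<lambda>k. nrm M (\<lambda>x. S k t x - g t x)) \<longlonglongrightarrow> 0"
    using g unfolding strongly_measurable_def by blast
  show ?thesis
  proof (rule borel_measurable_AE_lim[where f = "\<lambda>k t. nrm M (\<lambda>x. S k t x - \<sigma> t x)"])
    show "(\<lambda>t. nrm M (\<lambda>x. S k t x - \<sigma> t x)) \<in> borel_measurable ?L" for k
      by (rule borel_measurable_simple_function[OF
            simple_function_compose2[OF S(1)[of k] \<sigma>(1), of "\<lambda>a b. nrm M (\<lambda>x. a x - b x)"]])
    show "AE t in ?L. (\<lambda>k. nrm M (\<lambda>x. S k t x - \<sigma> t x)) \<longlonglongrightarrow> nrm M (\<lambda>x. g t x - \<sigma> t x)"
      using S(3) AE_space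
    proof eventually_elim
      case (elim t)
      then have t: "t \<in> {0<..<T}" by simp
      have "\<bar>nrm M (\<lambda>x. S k t x - \<sigma> t x) - nrm M (\<lambda>x. g t x - \<sigma> t x)\<bar> \<le> nrm M (\<lambda>x. S k t x - g t x)" for k
        using nrm_triangle_reverse[OF square_integrable_diff[OF S(2)[OF t] \<sigma>(2)[OF t]]
            square_integrable_diff[OF conjunct1[OF elim(1)] \<sigma>(2)[OF t]], of k] by simp
      then have "(\<lambda>k. nrm M (\<lambda>x. S k t x - \<sigma> t x) - nrm M (\<lambda>x. g t x - \<sigma> t x)) \<longlonglongrightarrow> 0"
        by (intro Lim_null_comparison[OF _ conjunct2[OF elim(1)]] always_eventually allI)
          (simp only: real_norm_def)
      then show ?case by (rule LIM_zero_cancel)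
    qed
  qed auto
qed

lemma borel_measurable_nrm:
  assumes "strongly_measurable M T g"
  shows "(\<lambda>t. nrm M (g t)) \<in> borel_measurable (lebesgue_on {0<..<T})"
  using borel_measurable_nrm_diff_simple[OF assms, of "\<lambda>t x. 0"] by (simp add: square_integrable_zero)

text \<open>
  Polarization expresses the inner product by norms of differences, whose measurability is known.
\<close>

lemma borel_measurable_ip:
  assumes g: "strongly_measurable M T g" and h: "square_integrable M h"
  shows "(\<lambda>t. ip M (g t) h) \<in> borel_measurable (lebesgue_on {0<..<T})"
proof -
  let ?L = "lebesgue_on {0<..<T}"
  have a: "AE t in ?L. square_integrable M (g t)"
    using g unfolding strongly_measurable_def by (auto elim!: eventually_mono)
  have m: "(\<lambda>t. ((nrm M (g t))\<^sup>2 + (nrm M h)\<^sup>2 - (nrm M (\<lambda>x. g t x - h x))\<^sup>2) / 2) \<in> borel_measurable ?L"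
    using borel_measurable_nrm[OF g] borel_measurable_nrm_diff_simple[OF g, of "\<lambda>t. h"] h by auto
  show ?thesis
  proof (rule borel_measurable_AE_lim[OF _ m])
    show "AE t in ?L. (\<lambda>k::nat. ((nrm M (g t))\<^sup>2 + (nrm M h)\<^sup>2 - (nrm M (\<lambda>x. g t x - h x))\<^sup>2) / 2)
        \<longlonglongrightarrow> ip M (g t) h"
      using a by eventually_elim (simp add: nrm_diff_square h)
  qed auto
qed

text \<open>
  By regularity \<open>A\<close> lies between a closed set \<open>K\<close> and an open set \<open>U\<close> that differ from it by
  sets of small measure; the Urysohn function of \<open>K\<close> and the complement of \<open>U\<close> differs from the
  indicator function of \<open>A\<close> only between \<open>K\<close> and \<open>U\<close>.
\<close>

lemma indicator_approx_continuous:
  fixes A B :: "real set"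
  assumes A: "A \<in> sets lebesgue" and B: "B \<in> sets lebesgue" and \<delta>: "\<delta> > 0"
  obtains \<phi> :: "real \<Rightarrow> real" where "continuous_on UNIV \<phi>" "\<And>t. 0 \<le> \<phi> t" "\<And>t. \<phi> t \<le> 1"
    "integrable (lebesgue_on B) (\<lambda>t. \<bar>indicator A t - \<phi> t\<bar>)"
    "(LINT t|lebesgue_on B. \<bar>indicator A t - \<phi> t\<bar>) \<le> \<delta>"
proof -
  obtain U where U: "open U" "A \<subseteq> U" "U - A \<in> lmeasurable" "emeasure lebesgue (U - A) < ennreal (\<delta>/2)"
    using sets_lebesgue_outer_open[OF A, of "\<delta>/2"] \<delta> by auto
  obtain K where K: "closed K" "K \<subseteq> A" "A - K \<in> lmeasurable" "emeasure lebesgue (A - K) < ennreal (\<delta>/2)"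
    using sets_lebesgue_inner_closed[OF A, of "\<delta>/2"] \<delta> by auto
  obtain \<phi> :: "real \<Rightarrow> real" where \<phi>: "continuous_on UNIV \<phi>" "\<And>t. \<phi> t \<in> closed_segment 1 0"
      "\<And>t. t \<in> K \<Longrightarrow> \<phi> t = 1" "\<And>t. t \<in> - U \<Longrightarrow> \<phi> t = 0"
    using Urysohn[of K "- U" 1 0] K(1,2) U(1,2) by (auto simp: closed_Compl)
  have b: "0 \<le> \<phi> t" "\<phi> t \<le> 1" for t using \<phi>(2)[of t] by (auto simp: closed_segment_eq_real_ivl)
  let ?D = "(A - K) \<union> (U - A)"
  have D: "?D \<in> lmeasurable" using U K by blast
  have le: "\<bar>indicator A t - \<phi> t\<bar> \<le> indicator ?D t" for t
    using b[of t] \<phi>(3,4)[of t] U(2) K(2) by (auto simp: indicator_def)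
  have mU: "measure lebesgue ?D \<le> \<delta>"
  proof -
    have "measure lebesgue (U - A) < \<delta>/2" "measure lebesgue (A - K) < \<delta>/2"
      using U(3,4) K(3,4) \<delta> by (simp_all add: emeasure_eq_measure2 ennreal_less_iff)
    then show ?thesis using measure_Un_le[of "A - K" lebesgue "U - A"] U(3) K(3)
      by (simp add: fmeasurableD)
  qed
  have iD: "integrable lebesgue (indicator ?D :: real \<Rightarrow> real)" using D by (simp add: lmeasurable_iff_integrable)
  then have iB: "integrable (lebesgue_on B) (indicator ?D :: real \<Rightarrow> real)"
    using integrable_mult_indicator[OF B iD] B by (simp add: integrable_restrict_space)
  have m: "(\<lambda>t. \<bar>indicator A t - \<phi> t\<bar>) \<in> borel_measurable (lebesgue_on B)"
    using A B continuous_imp_measurable_on_sets_lebesgue[OF continuous_on_subset[OF \<phi>(1)], of B]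
    by (intro borel_measurable_abs borel_measurable_diff measurable_restrict_space1[OF borel_measurable_indicator]) auto
  have i: "integrable (lebesgue_on B) (\<lambda>t. \<bar>indicator A t - \<phi> t\<bar>)"
    by (rule Bochner_Integration.integrable_bound[OF iB m]) (use le in auto)
  have "(LINT t|lebesgue_on B. \<bar>indicator A t - \<phi> t\<bar>) \<le> (LINT t|lebesgue_on UNIV. indicator ?D t)"
  proof (rule integral_mono_lebesgue_on_AE)
    show "integrable (lebesgue_on UNIV) (indicator ?D :: real \<Rightarrow> real)"
      using iD by (simp only: lebesgue_on_UNIV_eq)
    show "AE t in lebesgue_on B. \<bar>indicator A t - \<phi> t\<bar> \<le> indicator ?D t"
      by (rule AE_I2) (rule le)
    show "AE t in lebesgue_on UNIV. 0 \<le> (indicator ?D t :: real)"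
      by (rule AE_I2) (rule indicator_pos_le)
  qed (use B in auto)
  also have "\<dots> \<le> \<delta>" using mU by (simp add: lebesgue_on_UNIV_eq)
  finally show ?thesis by (rule that[OF \<phi>(1) b i])
qed


text \<open>
  A simple function is a finite sum of indicator functions times fixed elements; each indicator
  function is replaced by a continuous one. The function \<open>b\<close> is an explicit integrable majorant.
\<close>

lemma simple_function_approx_continuous:
  fixes \<sigma> :: "real \<Rightarrow> 'a \<Rightarrow> 'b::euclidean_space"
  assumes \<sigma>: "simple_function (lebesgue_on {0<..<T}) \<sigma>"
      "\<And>t. t \<in> {0<..<T} \<Longrightarrow> square_integrable M (\<sigma> t)"
    and \<eta>: "\<eta> > 0"
  obtains I :: "('a \<Rightarrow> 'b) set" and \<phi> b where
    "finite I" "\<And>h. h \<in> I \<Longrightarrow> square_integrable M h"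
    "\<And>h. continuous_on UNIV (\<phi> h)" 
    "integrable (lebesgue_on {0<..<T}) b" "(LINT t|lebesgue_on {0<..<T}. b t) < \<eta>"
    "\<And>t. t \<in> {0<..<T} \<Longrightarrow> (nrm M (\<lambda>x. \<sigma> t x - (\<Sum>h\<in>I. \<phi> h t *\<^sub>R h x)))\<^sup>2 \<le> b t"
proof -
  let ?L = "lebesgue_on {0<..<T}"
  define I where "I = \<sigma> ` {0<..<T}"
  define A where "A h = \<sigma> -` {h} \<inter> {0<..<T}" for h
  define C where "C = (\<Sum>h\<in>I. nrm M h)"
  have C: "C \<ge> 0" by (simp add: C_def sum_nonneg)
  \<comment> \<open>The final bound is \<open>C\<^sup>2 * \<delta>\<close>; the summand 1 keeps it below \<open>\<eta>\<close> and covers the case \<open>C = 0\<close>.\<close>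
  define \<delta> where "\<delta> = \<eta> / (C\<^sup>2 + 1)"
  have pos: "C\<^sup>2 + 1 > 0" by (intro add_nonneg_pos) auto
  have \<delta>: "\<delta> > 0" "C\<^sup>2 * \<delta> < \<eta>" using \<eta> pos by (auto simp: \<delta>_def field_simps)
  have I: "finite I" "\<And>h. h \<in> I \<Longrightarrow> square_integrable M h"
    using \<sigma> by (auto simp: I_def simple_function_def)
  have A: "A h \<in> sets lebesgue" for h
  proof (cases "h \<in> I")
    case True
    then have "A h \<in> sets ?L" using \<sigma>(1) by (auto simp: A_def I_def simple_function_def)
    then show ?thesis by (simp add: sets_restrict_space_iff)
  next
    case False
    then have "A h = {}" by (auto simp: A_def I_def)
    then show ?thesis by simp
  qed
  have "\<forall>h. \<exists>\<phi>. continuous_on UNIV \<phi> \<and> (\<forall>t. 0 \<le> \<phi> t \<and> \<phi> t \<le> 1) \<and>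
      integrable ?L (\<lambda>t. \<bar>indicator (A h) t - \<phi> t\<bar>) \<and> (LINT t|?L. \<bar>indicator (A h) t - \<phi> t\<bar>) \<le> \<delta>"
    by (intro allI, rule indicator_approx_continuous[OF A _ \<delta>(1), of "{0<..<T}"]) auto
  from choice[OF this] obtain \<phi> :: "('a \<Rightarrow> 'b) \<Rightarrow> real \<Rightarrow> real" where
    *: "\<forall>h. continuous_on UNIV (\<phi> h) \<and> (\<forall>t. 0 \<le> \<phi> h t \<and> \<phi> h t \<le> 1) \<and>
      integrable ?L (\<lambda>t. \<bar>indicator (A h) t - \<phi> h t\<bar>) \<and> (LINT t|?L. \<bar>indicator (A h) t - \<phi> h t\<bar>) \<le> \<delta>"
    by (rule exE)
  have \<phi>: "continuous_on UNIV (\<phi> h)" "0 \<le> \<phi> h t \<and> \<phi> h t \<le> 1"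
    "integrable ?L (\<lambda>t. \<bar>indicator (A h) t - \<phi> h t\<bar>)"
    "(LINT t|?L. \<bar>indicator (A h) t - \<phi> h t\<bar>) \<le> \<delta>" for h t
    using *[rule_format, of h] by auto
  \<comment> \<open>Both the distance and \<open>C\<close> bound the distance of the curves, so their product bounds its square.\<close>
  define b where "b t = C * (\<Sum>h\<in>I. \<bar>indicator (A h) t - \<phi> h t\<bar> * nrm M h)" for t
  have bi: "integrable ?L b" unfolding b_def using \<phi>(3) by auto
  have "(LINT t|?L. b t) = C * (\<Sum>h\<in>I. (LINT t|?L. \<bar>indicator (A h) t - \<phi> h t\<bar>) * nrm M h)"
    unfolding b_def using \<phi>(3) by (simp add: Bochner_Integration.integral_sum)
  also have "\<dots> \<le> C * (\<Sum>h\<in>I. \<delta> * nrm M h)"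
    using C \<phi>(4) by (intro mult_left_mono sum_mono mult_right_mono) auto
  also have "\<dots> = C\<^sup>2 * \<delta>" by (simp add: C_def power2_eq_square sum_distrib_left mult_ac)
  also have "\<dots> < \<eta>" by (rule \<delta>)
  finally have bl: "(LINT t|?L. b t) < \<eta>" .
  have "(nrm M (\<lambda>x. \<sigma> t x - (\<Sum>h\<in>I. \<phi> h t *\<^sub>R h x)))\<^sup>2 \<le> b t" if t: "t \<in> {0<..<T}" for t
  proof -
    let ?d = "\<lambda>h. \<bar>indicator (A h) t - \<phi> h t\<bar>"
    have s: "\<sigma> t x = (\<Sum>h\<in>I. indicator (A h) t *\<^sub>R h x)" for x
    proof -
      have "(\<Sum>h\<in>I. indicator (A h) t *\<^sub>R h x) = (\<Sum>h\<in>I. if h = \<sigma> t then h x else 0)"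
        using t by (intro sum.cong) (auto simp: A_def indicator_def)
      then show ?thesis using t I(1) by (simp add: I_def)
    qed
    have "(\<lambda>x. \<sigma> t x - (\<Sum>h\<in>I. \<phi> h t *\<^sub>R h x)) = (\<lambda>x. \<Sum>h\<in>I. (indicator (A h) t - \<phi> h t) *\<^sub>R h x)"
      by (simp add: s scaleR_diff_left sum_subtractf)
    then have le: "nrm M (\<lambda>x. \<sigma> t x - (\<Sum>h\<in>I. \<phi> h t *\<^sub>R h x)) \<le> (\<Sum>h\<in>I. ?d h * nrm M h)"
      using nrm_sum_le[of I M "\<lambda>h x. (indicator (A h) t - \<phi> h t) *\<^sub>R h x"] I(2)
      by (simp add: square_integrable_scaleR nrm_scaleR)
    have d1: "?d h \<le> 1" for h using \<phi>(2)[of h t] by (auto simp: indicator_def)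
    have "(\<Sum>h\<in>I. ?d h * nrm M h) \<le> C"
      unfolding C_def using d1 by (intro sum_mono mult_left_le_one_le) auto
    then show ?thesis
      unfolding b_def power2_eq_square using le by (intro mult_mono) (auto simp: C sum_nonneg)
  qed
  from that[OF I \<phi>(1) bi bl this] show ?thesis .
qed

text \<open>
  The approximating simple functions converge only almost everywhere. Replacing them by zero where
  their norm exceeds twice that of the limit keeps the convergence and makes \<open>9 \<parallel>g t\<parallel>\<^sup>2\<close> a
  dominating function.
\<close>

lemma strongly_measurable_approx_simple:
  fixes g :: "real \<Rightarrow> 'a \<Rightarrow> 'b::euclidean_space"
  assumes g: "strongly_measurable M T g"
    and gi: "integrable (lebesgue_on {0<..<T}) (\<lambda>t. (nrm M (g t))\<^sup>2)" and \<epsilon>: "\<epsilon> > 0"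
  obtains \<sigma> where "simple_function (lebesgue_on {0<..<T}) \<sigma>"
      "\<And>t. t \<in> {0<..<T} \<Longrightarrow> square_integrable M (\<sigma> t)"
      "integrable (lebesgue_on {0<..<T}) (\<lambda>t. (nrm M (\<lambda>x. g t x - \<sigma> t x))\<^sup>2)"
      "(LINT t|lebesgue_on {0<..<T}. (nrm M (\<lambda>x. g t x - \<sigma> t x))\<^sup>2) < \<epsilon>"
proof -
  let ?L = "lebesgue_on {0<..<T}"
  obtain S where S: "\<And>k. simple_function ?L (S k)"
    "\<And>k t. t \<in> {0<..<T} \<Longrightarrow> square_integrable M (S k t)"
    "AE t in ?L. square_integrable M (g t) \<and> (\<lambda>k. nrm M (\<lambda>x. S k t x - g t x)) \<longlonglongrightarrow> 0"
    using g unfolding strongly_measurable_def by blast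
  define \<sigma> where "\<sigma> k t = (if nrm M (S k t) \<le> 2 * nrm M (g t) then S k t else (\<lambda>x. 0))" for k t
  have gm: "(\<lambda>t. nrm M (g t)) \<in> borel_measurable ?L" by (rule borel_measurable_nrm[OF g])
  have \<sigma>: "simple_function ?L (\<sigma> k)" for k
  proof -
    have "(\<lambda>t. nrm M (S k t)) \<in> borel_measurable ?L"
      by (rule borel_measurable_simple_function[OF simple_function_compose1[OF S(1)]])
    then have "{t \<in> space ?L. nrm M (S k t) \<le> 2 * nrm M (g t)} \<in> sets ?L"
      using gm by (intro borel_measurable_le) auto
    then have "simple_function ?L (\<lambda>t. if nrm M (S k t) \<le> 2 * nrm M (g t) then S k t else (\<lambda>x. 0))"
      using S(1)[of k] by (intro simple_function_If) auto
    then show ?thesis by (simp add: \<sigma>_def[abs_def])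
  qed
  have \<sigma>sq: "square_integrable M (\<sigma> k t)" if "t \<in> {0<..<T}" for k t
    using S(2)[OF that] by (simp add: \<sigma>_def square_integrable_zero)
  let ?p = "\<lambda>k t. (nrm M (\<lambda>x. g t x - \<sigma> k t x))\<^sup>2"
  have pm: "?p k \<in> borel_measurable ?L" for k
    using borel_measurable_nrm_diff_simple[OF g \<sigma> \<sigma>sq] by simp
  have bound: "AE t in ?L. norm (?p k t) \<le> 9 * (nrm M (g t))\<^sup>2" for k
    using S(3) AE_space
  proof eventually_elim
    case (elim t)
    then have t: "t \<in> {0<..<T}" by simp
    have "nrm M (\<lambda>x. g t x + (-1) *\<^sub>R \<sigma> k t x) \<le> nrm M (g t) + nrm M (\<lambda>x. (-1) *\<^sub>R \<sigma> k t x)"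
      using elim \<sigma>sq[OF t] by (intro nrm_triangle square_integrable_scaleR) auto
    also have "nrm M (\<lambda>x. (-1) *\<^sub>R \<sigma> k t x) = nrm M (\<sigma> k t)" by (simp add: nrm_def)
    also have "nrm M (\<sigma> k t) \<le> 2 * nrm M (g t)" by (auto simp: \<sigma>_def nrm_def)
    finally have "nrm M (\<lambda>x. g t x - \<sigma> k t x) \<le> 3 * nrm M (g t)" by simp
    then have "?p k t \<le> (3 * nrm M (g t))\<^sup>2" by (intro power_mono) auto
    then show ?case by (simp add: power_mult_distrib)
  qed
  have lim: "AE t in ?L. (\<lambda>k. ?p k t) \<longlonglongrightarrow> 0"
    using S(3) AE_space
  proof eventually_elim
    case (elim t)
    then have t: "t \<in> {0<..<T}" by simp
    let ?e = "\<lambda>k. nrm M (\<lambda>x. S k t x - g t x)"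
    have e: "?e \<longlonglongrightarrow> 0" using elim by simp
    have ev: "\<forall>\<^sub>F k in sequentially. nrm M (\<lambda>x. g t x - \<sigma> k t x) \<le> ?e k"
    proof (cases "nrm M (g t) = 0")
      case True
      have "nrm M (\<lambda>x. g t x - \<sigma> k t x) \<le> ?e k" for k
        using True by (auto simp: \<sigma>_def nrm_minus_commute[of M "g t" "S k t"])
      then show ?thesis by simp
    next
      case False
      then have "nrm M (g t) > 0" using nrm_nonneg[of M "g t"] by linarith
      then have "\<forall>\<^sub>F k in sequentially. ?e k < nrm M (g t)" by (rule order_tendstoD(2)[OF e])
      then show ?thesis
      proof eventually_elim
        case (elim k)
        have "nrm M (S k t) \<le> 2 * nrm M (g t)"
          using elim nrm_triangle_reverse[OF S(2)[OF t, of k], of "g t"] \<open>square_integrable M (g t) \<and> _\<close> by linarith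
        then show ?case by (simp add: \<sigma>_def nrm_minus_commute[of M "g t" "S k t"])
      qed
    qed
    have "(\<lambda>k. nrm M (\<lambda>x. g t x - \<sigma> k t x)) \<longlonglongrightarrow> 0"
      by (rule tendsto_sandwich[OF _ ev tendsto_const e]) simp
    then show ?case by (rule tendsto_eq_intros) simp_all
  qed
  have "(\<lambda>k. LINT t|?L. ?p k t) \<longlonglongrightarrow> (LINT t|?L. 0)"
    by (rule integral_dominated_convergence[OF _ pm _ lim bound]) (use gi in auto)
  then have "\<forall>\<^sub>F k in sequentially. (LINT t|?L. ?p k t) < \<epsilon>" using \<epsilon> by (intro order_tendstoD) auto
  then obtain k where k: "(LINT t|?L. ?p k t) < \<epsilon>" using eventually_happens by fastforce
  have "integrable ?L (?p k)"
    by (rule Bochner_Integration.integrable_bound[OF integrable_mult_right[OF gi, of 9] pm])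
      (use bound in \<open>auto elim!: eventually_mono\<close>)
  from that[OF \<sigma> \<sigma>sq this k] show ?thesis .
qed

text \<open>
  Density of continuous curves in \<open>L\<^sup>2(0,T;L\<^sup>2)\<close>: in the squared norm a simple function is within
  \<open>\<epsilon>/4\<close> of \<open>g\<close> and a continuous curve within \<open>\<epsilon>/4\<close> of it; the square of a sum costs a factor two.
\<close>

lemma strongly_measurable_approx_continuous:
  fixes g :: "real \<Rightarrow> 'a \<Rightarrow> 'b::euclidean_space"
  assumes g: "strongly_measurable M T g"
    and gi: "integrable (lebesgue_on {0<..<T}) (\<lambda>t. (nrm M (g t))\<^sup>2)" and \<epsilon>: "\<epsilon> > 0"
  obtains z where "L2_continuous M UNIV z"
      "integrable (lebesgue_on {0<..<T}) (\<lambda>t. (nrm M (\<lambda>x. g t x - z t x))\<^sup>2)"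
      "(LINT t|lebesgue_on {0<..<T}. (nrm M (\<lambda>x. g t x - z t x))\<^sup>2) < \<epsilon>"
proof -
  let ?L = "lebesgue_on {0<..<T}"
  obtain \<sigma> where \<sigma>: "simple_function ?L \<sigma>" "\<And>t. t \<in> {0<..<T} \<Longrightarrow> square_integrable M (\<sigma> t)"
      "integrable ?L (\<lambda>t. (nrm M (\<lambda>x. g t x - \<sigma> t x))\<^sup>2)"
      "(LINT t|?L. (nrm M (\<lambda>x. g t x - \<sigma> t x))\<^sup>2) < \<epsilon>/4"
    using strongly_measurable_approx_simple[OF g gi, of "\<epsilon>/4"] \<epsilon> by auto
  have \<epsilon>4: "\<epsilon>/4 > 0" using \<epsilon> by simp
  obtain I :: "('a \<Rightarrow> 'b) set" and \<phi> b where I: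
    "finite I" "\<And>h. h \<in> I \<Longrightarrow> square_integrable M h"
    "\<And>h. continuous_on UNIV (\<phi> h)"
    "integrable ?L b" "(LINT t|?L. b t) < \<epsilon>/4"
    "\<And>t. t \<in> {0<..<T} \<Longrightarrow> (nrm M (\<lambda>x. \<sigma> t x - (\<Sum>h\<in>I. \<phi> h t *\<^sub>R h x)))\<^sup>2 \<le> b t"
    by (rule simple_function_approx_continuous[OF \<sigma>(1,2) \<epsilon>4], assumption, rule that)
  define z where "z t x = (\<Sum>h\<in>I. \<phi> h t *\<^sub>R h x)" for t x
  have z: "L2_continuous M UNIV z"
    unfolding z_def by (intro L2_continuous_sum L2_continuous_scaleR I(2,3))
  then have zsq: "square_integrable M (z t)" for t by (simp add: L2_continuous_def)
  have gsq: "AE t in ?L. square_integrable M (g t)"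
    using g unfolding strongly_measurable_def by (auto elim!: eventually_mono)
  let ?p = "\<lambda>t. (nrm M (\<lambda>x. g t x - z t x))\<^sup>2"
  let ?q = "\<lambda>t. (nrm M (g t))\<^sup>2 + (nrm M (z t))\<^sup>2 - 2 * (\<Sum>h\<in>I. \<phi> h t * ip M (g t) h)"
  let ?B = "\<lambda>t. 2 * (nrm M (\<lambda>x. g t x - \<sigma> t x))\<^sup>2 + 2 * b t"
  have cm: "f \<in> borel_measurable ?L" if "continuous_on UNIV f" for f :: "real \<Rightarrow> real"
    by (rule continuous_imp_measurable_on_sets_lebesgue[OF continuous_on_subset[OF that]]) auto
  have qm: "?q \<in> borel_measurable ?L"
    by (intro borel_measurable_diff borel_measurable_add borel_measurable_power borel_measurable_nrm[OF g]
        cm L2_continuous_norm_square[OF z] borel_measurable_times borel_measurable_const borel_measurable_sum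
        I(3) borel_measurable_ip[OF g I(2)])
  have "AE t in ?L. (\<lambda>k::nat. ?q t) \<longlonglongrightarrow> ?p t"
    using gsq
  proof eventually_elim
    case (elim t)
    have "ip M (g t) (z t) = (\<Sum>h\<in>I. \<phi> h t * ip M (g t) h)"
      unfolding z_def using elim I(2)
      by (subst ip_sum_right) (auto simp: ip_scaleR_right square_integrable_scaleR)
    then show ?case using nrm_diff_square[OF elim zsq[of t]] by simp
  qed
  then have pm: "?p \<in> borel_measurable ?L" by (rule borel_measurable_AE_lim[OF _ qm, rotated]) simp
  have Bi: "integrable ?L ?B" using \<sigma>(3) I(4) by auto
  have le: "AE t in ?L. ?p t \<le> ?B t"
    using gsq AE_space
  proof eventually_elim
    case (elim t)
    then have t: "t \<in> {0<..<T}" by simp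
    have "nrm M (\<lambda>x. g t x - z t x) \<le> nrm M (\<lambda>x. g t x - \<sigma> t x) + nrm M (\<lambda>x. \<sigma> t x - z t x)"
      using elim(1) \<sigma>(2)[OF t] zsq[of t] by (rule nrm_triangle_diff)
    then have "?p t \<le> (nrm M (\<lambda>x. g t x - \<sigma> t x) + nrm M (\<lambda>x. \<sigma> t x - z t x))\<^sup>2"
      by (intro power_mono) auto
    also have "\<dots> \<le> 2 * (nrm M (\<lambda>x. g t x - \<sigma> t x))\<^sup>2 + 2 * (nrm M (\<lambda>x. \<sigma> t x - z t x))\<^sup>2"
      using sum_squares_bound[of "nrm M (\<lambda>x. g t x - \<sigma> t x)" "nrm M (\<lambda>x. \<sigma> t x - z t x)"]
      by (simp add: power2_sum)
    also have "\<dots> \<le> ?B t" using I(6)[OF t] by (simp add: z_def)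
    finally show ?case .
  qed
  have pi: "integrable ?L ?p"
    by (rule Bochner_Integration.integrable_bound[OF Bi pm]) (use le in \<open>auto elim!: eventually_mono\<close>)
  have "(LINT t|?L. ?p t) \<le> (LINT t|?L. ?B t)" using pi Bi le by (rule integral_mono_AE)
  also have "\<dots> = 2 * (LINT t|?L. (nrm M (\<lambda>x. g t x - \<sigma> t x))\<^sup>2) + 2 * (LINT t|?L. b t)"
    using \<sigma>(3) I(4) by simp
  also have "\<dots> < \<epsilon>" using \<sigma>(4) I(5) by simp
  finally show ?thesis by (rule that[OF z pi])
qed

section \<open>From the distributional to the integrated equation\<close>

lemma smooth_step_derivative:
  obtains \<theta>' C where "\<And>x. (smooth_step has_real_derivative \<theta>' x) (at x)" "continuous_on UNIV \<theta>'"
    "\<And>x. x < 0 \<Longrightarrow> \<theta>' x = 0" "\<And>x. x > 1 \<Longrightarrow> \<theta>' x = 0" "\<And>x. \<bar>\<theta>' x\<bar> \<le> C" "C > 0"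
proof -
  obtain \<theta>' where \<theta>': "\<And>x. (smooth_step has_real_derivative \<theta>' x) (at x)" "smooth_real \<theta>'"
    using smooth_real_deriv[OF smooth_step_smooth] by blast
  have c: "continuous_on UNIV \<theta>'" by (rule smooth_real_continuous_on[OF \<theta>'(2)])
  have l: "\<theta>' x = 0" if "x < 0" for x
  proof (rule DERIV_unique[OF \<theta>'(1)])
    show "(smooth_step has_real_derivative 0) (at x)"
      by (rule has_field_derivative_transform_within_open[OF DERIV_const[of 0], where S="{..<0}"])
        (use that in \<open>auto simp: smooth_step_left\<close>)
  qed
  have r: "\<theta>' x = 0" if "x > 1" for x
  proof (rule DERIV_unique[OF \<theta>'(1)])
    show "(smooth_step has_real_derivative 0) (at x)"
      by (rule has_field_derivative_transform_within_open[OF DERIV_const[of 1], where S="{1<..}"])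
        (use that in \<open>auto simp: smooth_step_right\<close>)
  qed
  have "compact (\<theta>' ` {0..1})" by (intro compact_continuous_image continuous_on_subset[OF c]) auto
  then obtain B where B: "\<And>y. y \<in> \<theta>' ` {0..1} \<Longrightarrow> norm y \<le> B"
    using compact_imp_bounded bounded_iff by metis
  have "\<bar>\<theta>' x\<bar> \<le> max B 1" for x
  proof -
    consider "x < 0" | "x > 1" | "x \<in> {0..1}" by force
    then show ?thesis
    proof cases
      case 3
      then have "\<bar>\<theta>' x\<bar> \<le> B" using B[of "\<theta>' x"] by simp
      then show ?thesis by simp
    qed (use l r in auto)
  qed
  then show ?thesis using that[OF \<theta>'(1) c l r, of "max B 1"] by auto
qed

lemma integral_step_kernel:
  assumes \<theta>': "\<And>x. (smooth_step has_real_derivative \<theta>' x) (at x)" and n: "n > 0"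
  shows "((\<lambda>t. n * \<theta>' (n * (t - s))) has_integral 1) {s..s + 1/n}"
proof -
  have "((\<lambda>t. n * \<theta>' (n * (t - s))) has_integral
      smooth_step (n * (s + 1/n - s)) - smooth_step (n * (s - s))) {s..s + 1/n}"
  proof (rule fundamental_theorem_of_calculus)
    show "s \<le> s + 1/n" using n by simp
    fix t
    have "((\<lambda>t. smooth_step (n * (t - s))) has_real_derivative \<theta>' (n * (t - s)) * n) (at t)"
      by (rule DERIV_chain2[OF \<theta>']) (auto intro!: derivative_eq_intros)
    then show "((\<lambda>t. smooth_step (n * (t - s))) has_vector_derivative n * \<theta>' (n * (t - s))) (at t within {s..s + 1/n})"
      by (simp add: mult.commute has_real_derivative_iff_has_vector_derivative has_vector_derivative_at_within)
  qed
  then show ?thesis using n by (simp add: smooth_step_left smooth_step_right)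
qed

text \<open>
  The derivative of the rescaled step is an approximate identity concentrated on \<open>[s, s + 1/n]\<close>. It
  is bounded by \<open>n * C\<close> on this interval, so its absolute value has integral at most \<open>C\<close> for every \<open>n\<close>.
\<close>

lemma step_kernel_tendsto:
  fixes g :: "real \<Rightarrow> real"
  assumes \<theta>': "\<And>x. (smooth_step has_real_derivative \<theta>' x) (at x)" "continuous_on UNIV \<theta>'"
    "\<And>x. x < 0 \<Longrightarrow> \<theta>' x = 0" "\<And>x. x > 1 \<Longrightarrow> \<theta>' x = 0" "\<And>x. \<bar>\<theta>' x\<bar> \<le> C" "C > 0"
    and g: "continuous_on {0..T} g" and s: "0 < s" "s < T"
  shows "(\<lambda>n. LINT t|lebesgue_on {0<..<T}. g t * (real n * \<theta>' (real n * (t - s)))) \<longlonglongrightarrow> g s"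
    "\<And>n. integrable (lebesgue_on {0<..<T}) (\<lambda>t. g t * (real n * \<theta>' (real n * (t - s))))"
proof -
  let ?L = "lebesgue_on {0<..<T}"
  let ?f = "\<lambda>n t. g t * (real n * \<theta>' (real n * (t - s)))"
  have cont: "continuous_on {0..T} (?f n)" for n
    by (intro continuous_on_mult g continuous_on_const continuous_on_compose2[OF \<theta>'(2)]
        continuous_on_diff continuous_on_id) auto
  show int: "integrable ?L (?f n)" for n
  proof -
    have "?f n absolutely_integrable_on {0..T}" by (rule absolutely_integrable_continuous_real[OF cont])
    then have "?f n absolutely_integrable_on {0<..<T}" by (rule set_integrable_subset) auto
    then show ?thesis by (rule absolutely_integrable_imp_integrable) simp
  qed
  show "(\<lambda>n. LINT t|?L. ?f n t) \<longlonglongrightarrow> g s"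
  proof (rule LIMSEQ_I)
    fix e :: real assume e: "e > 0"
    have "isCont g s" using g s by (simp add: continuous_on_interior)
    then obtain d where d: "d > 0" "\<And>t. \<bar>t - s\<bar> < d \<Longrightarrow> \<bar>g t - g s\<bar> < e / (2 * C)"
      unfolding continuous_at_eps_delta dist_real_def using e \<theta>'(6) by (metis divide_pos_pos mult_pos_pos zero_less_numeral)
    obtain N :: nat where N: "1 / min d (T - s) < real N" using reals_Archimedean2 by blast
    have "norm ((LINT t|?L. ?f n t) - g s) < e" if n: "n \<ge> N" for n
    proof -
      define \<mu> where "\<mu> = min d (T - s)"
      have m: "\<mu> > 0" using d s by (simp add: \<mu>_def)
      have *: "1 / \<mu> < real n" using N n unfolding \<mu>_def by linarith
      have "0 < 1 / \<mu>" using m by simp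
      with * have np: "real n > 0" by linarith
      with * m have "1 / real n < \<mu>" by (simp add: field_simps)
      then have n1: "real n > 0" "1 / real n < d" "1 / real n < T - s"
        using np by (auto simp: \<mu>_def)
      let ?J = "{s..s + 1/real n}"
      have fJ: "(?f n) integrable_on ?J"
        by (rule integrable_continuous_real[OF continuous_on_subset[OF cont]]) (use s n1 in auto)
      have "((?f n) has_integral integral ?J (?f n)) {0<..<T}"
      proof (rule has_integral_on_superset[OF integrable_integral[OF fJ]])
        show "?J \<subseteq> {0<..<T}" using s n1 by auto
        fix t assume "t \<notin> ?J"
        then have "real n * (t - s) < 0 \<or> real n * (t - s) > 1"
          using n1(1) by (auto simp: mult_less_0_iff field_simps)
        then show "?f n t = 0" using \<theta>'(3,4) by auto
      qed
      moreover have "((?f n) has_integral (LINT t|?L. ?f n t)) {0<..<T}"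
        by (rule has_integral_integral_lebesgue_on[OF int]) simp
      ultimately have eq: "(LINT t|?L. ?f n t) = integral ?J (?f n)" by (rule has_integral_unique[symmetric])
      have k: "((\<lambda>t. real n * \<theta>' (real n * (t - s))) has_integral 1) ?J"
        using \<theta>'(1) n1(1) by (rule integral_step_kernel)
      have "((\<lambda>t. ?f n t - g s * (real n * \<theta>' (real n * (t - s)))) has_integral
          integral ?J (?f n) - g s * 1) (cbox s (s + 1/real n))"
        unfolding cbox_interval by (intro has_integral_diff has_integral_mult_right k integrable_integral fJ)
      then have "norm (integral ?J (?f n) - g s * 1) \<le> (e/2 * real n) * measure lborel (cbox s (s + 1 / real n))"
      proof (rule has_integral_bound[rotated])
        show "0 \<le> e/2 * real n" using e by simp
        fix t assume "t \<in> cbox s (s + 1 / real n)"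
        then have "\<bar>t - s\<bar> < d" using n1 by auto
        then have "\<bar>g t - g s\<bar> \<le> e / (2 * C)" using d(2) by (simp add: less_imp_le)
        then have "\<bar>g t - g s\<bar> * (real n * \<bar>\<theta>' (real n * (t - s))\<bar>) \<le> e / (2 * C) * (real n * C)"
          using \<theta>'(5,6) e by (intro mult_mono mult_left_mono) auto
        also have "\<dots> = e/2 * real n" using \<theta>'(6) by simp
        finally show "norm (?f n t - g s * (real n * \<theta>' (real n * (t - s)))) \<le> e/2 * real n"
          by (simp add: abs_mult flip: left_diff_distrib)
      qed
      also have "\<dots> = e/2" using n1(1) by simp
      finally show ?thesis using e unfolding eq by simp
    qed
    then show "\<exists>N. \<forall>n\<ge>N. norm ((LINT t|?L. ?f n t) - g s) < e" by blast
  qed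
qed


text \<open>
  Test functions that are smoothed indicator functions of \<open>{s..r}\<close> turn the distributional
  equation \<open>g' = k\<close> into its integrated form. Their derivative is a kernel near \<open>s\<close> minus a kernel
  near \<open>r\<close>, which reproduces the values of the continuous function \<open>g\<close> at these points.
\<close>

lemma weak_derivative_FTC:
  fixes g k :: "real \<Rightarrow> real"
  assumes g: "continuous_on {0..T} g" and k: "integrable (lebesgue_on {0<..<T}) k"
    and weak: "\<And>\<psi>. \<psi> \<in> test_functions {0<..<T} \<Longrightarrow>
      - (LINT t|lebesgue_on {0<..<T}. g t * deriv \<psi> t) = (LINT t|lebesgue_on {0<..<T}. k t * \<psi> t)"
    and sr: "0 < s" "s \<le> r" "r < T"
  shows "g r - g s = integral {s..r} k"
proof -
  let ?L = "lebesgue_on {0<..<T}"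
  obtain \<theta>' C where \<theta>': "\<And>x. (smooth_step has_real_derivative \<theta>' x) (at x)" "continuous_on UNIV \<theta>'"
    "\<And>x. x < 0 \<Longrightarrow> \<theta>' x = 0" "\<And>x. x > 1 \<Longrightarrow> \<theta>' x = 0" "\<And>x. \<bar>\<theta>' x\<bar> \<le> C" "C > 0"
    using smooth_step_derivative by blast
  define \<psi> where "\<psi> n t = smooth_step (real n * (t - s)) - smooth_step (real n * (t - r))" for n t
  let ?k = "\<lambda>c n t. real n * \<theta>' (real n * (t - c))"
  have step_d: "((\<lambda>t. smooth_step (real n * (t - c))) has_real_derivative ?k c n t) (at t)" for n c t
  proof -
    have "((\<lambda>t. smooth_step (real n * (t - c))) has_real_derivative \<theta>' (real n * (t - c)) * real n) (at t)"
      by (rule DERIV_chain2[OF \<theta>'(1)]) (auto intro!: derivative_eq_intros)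
    then show ?thesis by (simp add: mult.commute)
  qed
  have d: "deriv (\<psi> n) t = ?k s n t - ?k r n t" for n t
    unfolding \<psi>_def[abs_def] by (intro DERIV_imp_deriv DERIV_diff step_d)
  have smooth: "smooth_real (\<psi> n)" for n
  proof -
    have "smooth_real (\<lambda>t. smooth_step (real n * t + (- real n * s)) - smooth_step (real n * t + (- real n * r)))"
      by (intro smooth_real_diff smooth_real_affine smooth_step_smooth)
    then show ?thesis by (simp add: \<psi>_def[abs_def] algebra_simps)
  qed
  have test: "\<psi> n \<in> test_functions {0<..<T}" if n: "real n > 0" "r + 1 / real n < T" for n
  proof -
    have "{t. \<psi> n t \<noteq> 0} \<subseteq> {s..r + 1/real n}"
    proof (rule subsetI, rule ccontr)
      fix t assume t: "t \<in> {t. \<psi> n t \<noteq> 0}" "t \<notin> {s..r + 1/real n}"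
      show False
      proof (cases "t < s")
        case True
        then have "real n * (t - s) \<le> 0" "real n * (t - r) \<le> 0" using n sr by (auto simp: mult_le_0_iff)
        then show False using t(1) by (simp add: \<psi>_def smooth_step_left)
      next
        case False
        then have "t - r \<ge> 1 / real n" using t(2) by auto
        then have "real n * (t - r) \<ge> 1" using n by (simp add: field_simps)
        moreover have "real n * (t - s) \<ge> real n * (t - r)" using sr by (intro mult_left_mono) auto
        ultimately show False using t(1) by (simp add: \<psi>_def smooth_step_right)
      qed
    qed
    then have cl: "closure {t. \<psi> n t \<noteq> 0} \<subseteq> {s..r + 1/real n}" by (rule closure_minimal) simp
    then have "bounded (closure {t. \<psi> n t \<noteq> 0})" using bounded_closed_interval bounded_subset by blast
    then have "compact (closure {t. \<psi> n t \<noteq> 0})" using compact_eq_bounded_closed closed_closure by blast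
    moreover have "{s..r + 1/real n} \<subseteq> {0<..<T}" using sr n by auto
    ultimately show ?thesis using cl smooth_real_smooth_fun[OF smooth[of n]]
      unfolding test_functions_def by blast
  qed
  have lhs: "(\<lambda>n. - (LINT t|?L. g t * deriv (\<psi> n) t)) \<longlonglongrightarrow> - (g s - g r)"
  proof -
    have int: "integrable ?L (\<lambda>t. g t * ?k c n t)" if "0 < c" "c < T" for c n
      by (rule step_kernel_tendsto(2)[OF \<theta>' g that])
    have "(LINT t|?L. g t * deriv (\<psi> n) t) = (LINT t|?L. g t * ?k s n t) - (LINT t|?L. g t * ?k r n t)" for n
    proof -
      have "(LINT t|?L. g t * deriv (\<psi> n) t) = (LINT t|?L. g t * ?k s n t - g t * ?k r n t)"
        by (simp add: d algebra_simps)
      also have "\<dots> = (LINT t|?L. g t * ?k s n t) - (LINT t|?L. g t * ?k r n t)"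
        by (rule Bochner_Integration.integral_diff[OF int int]) (use sr in auto)
      finally show ?thesis .
    qed
    moreover have "(\<lambda>n. (LINT t|?L. g t * ?k s n t) - (LINT t|?L. g t * ?k r n t)) \<longlonglongrightarrow> g s - g r"
      using sr by (intro tendsto_diff step_kernel_tendsto(1)[OF \<theta>' g]) auto
    ultimately have "(\<lambda>n. LINT t|?L. g t * deriv (\<psi> n) t) \<longlonglongrightarrow> g s - g r" by simp
    then show ?thesis by (rule tendsto_minus)
  qed
  have rhs: "(\<lambda>n. LINT t|?L. k t * \<psi> n t) \<longlonglongrightarrow> (LINT t|?L. k t * indicator {s<..r} t)"
  proof (rule integral_dominated_convergence)
    show "integrable ?L (\<lambda>t. norm (k t))" using k by simp
    show "AE t in ?L. (\<lambda>n. k t * \<psi> n t) \<longlonglongrightarrow> k t * indicator {s<..r} t"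
    proof (rule AE_I2)
      fix t
      have "(\<lambda>n. \<psi> n t) \<longlonglongrightarrow> (if t - s > 0 then 1 else 0) - (if t - r > 0 then 1 else 0)"
        unfolding \<psi>_def by (intro tendsto_diff smooth_step_scaled_tendsto)
      also have "(if t - s > 0 then 1 else 0) - (if t - r > 0 then 1 else 0) = (indicator {s<..r} t :: real)"
        using sr by (auto simp: indicator_def)
      finally show "(\<lambda>n. k t * \<psi> n t) \<longlonglongrightarrow> k t * indicator {s<..r} t" by (intro tendsto_mult tendsto_const)
    qed
    show "AE t in ?L. norm (k t * \<psi> n t) \<le> norm (k t)" for n
    proof (rule AE_I2)
      fix t
      have "\<bar>\<psi> n t\<bar> \<le> 1"
        using smooth_step_bounds[of "real n * (t - s)"] smooth_step_bounds[of "real n * (t - r)"]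
        unfolding \<psi>_def abs_le_iff by linarith
      then show "norm (k t * \<psi> n t) \<le> norm (k t)" by (simp add: abs_mult mult_left_le)
    qed
    have "\<psi> n \<in> borel_measurable ?L" for n
      by (rule continuous_imp_measurable_on_sets_lebesgue[OF smooth_real_continuous_on[OF smooth]]) simp
    then show "(\<lambda>t. k t * \<psi> n t) \<in> borel_measurable ?L" for n
      using k by (intro borel_measurable_times) auto
    show "(\<lambda>t. k t * indicator {s<..r} t) \<in> borel_measurable ?L"
      by (intro borel_measurable_times borel_measurable_integrable[OF k]
            measurable_restrict_space1[OF borel_measurable_indicator]) auto
  qed
  have "\<forall>\<^sub>F n in sequentially. - (LINT t|?L. g t * deriv (\<psi> n) t) = (LINT t|?L. k t * \<psi> n t)"
    using eventually_gt_at_top[of "nat \<lceil>1 / (T - r)\<rceil>"]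
  proof eventually_elim
    case (elim n)
    then have *: "1 / (T - r) < real n" by linarith
    have "0 < 1 / (T - r)" using sr by simp
    with * have n: "real n > 0" by linarith
    with * sr have "1 / real n < T - r" by (simp add: field_simps)
    then show ?case using n by (intro weak test) auto
  qed
  then have "(\<lambda>n. LINT t|?L. k t * \<psi> n t) \<longlonglongrightarrow> - (g s - g r)" by (rule Lim_transform_eventually[OF lhs])
  then have "g r - g s = (LINT t|?L. k t * indicator {s<..r} t)" using LIMSEQ_unique[OF rhs] by simp
  also have "\<dots> = (LINT t|?L. (if t \<in> {s<..r} then k t else 0))"
    by (rule Bochner_Integration.integral_cong) (auto simp: indicator_def)
  also have "\<dots> = (LINT t|lebesgue_on {s<..r}. k t)"
    by (rule integral_restrict) (use sr in auto)
  also have "\<dots> = integral {s<..r} k"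
  proof (rule lebesgue_integral_eq_integral)
    have "integrable ?L (\<lambda>t. indicator {s<..r} t *\<^sub>R k t)"
      by (rule integrable_mult_indicator[OF _ k]) (use sr in \<open>auto simp: sets_restrict_space_iff\<close>)
    moreover have "(\<lambda>t. indicator {0<..<T} t *\<^sub>R (indicator {s<..r} t *\<^sub>R k t)) = (\<lambda>t. indicator {s<..r} t *\<^sub>R k t)"
      using sr by (auto simp: indicator_def)
    ultimately show "integrable (lebesgue_on {s<..r}) k" by (simp add: integrable_restrict_space)
  qed simp
  also have "\<dots> = integral {s..r} k"
    by (rule integral_subset_negligible) (use sr in \<open>auto intro: negligible_subset[of "{s}"]\<close>)
  finally show ?thesis .
qed

section \<open>The energy inequality for one equation\<close>

lemma integral_mono_AE_Icc:
  fixes f g :: "real \<Rightarrow> real"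
  assumes f: "f integrable_on {a..b}" and g: "g integrable_on {a..b}"
    and le: "AE x in lebesgue. x \<in> {a..b} \<longrightarrow> f x \<le> g x"
  shows "integral {a..b} f \<le> integral {a..b} g"
proof -
  obtain N where N: "N \<in> null_sets lebesgue" "\<And>x. x \<notin> N \<Longrightarrow> x \<in> {a..b} \<longrightarrow> f x \<le> g x"
    using le unfolding completion.AE_iff_null_sets by auto
  have neg: "negligible N" using N(1) by (simp add: negligible_iff_null_sets)
  define h where "h x = (if x \<in> N then f x else g x)" for x
  have "h integrable_on {a..b}" by (rule integrable_spike[OF g neg]) (auto simp: h_def)
  moreover have "integral {a..b} g = integral {a..b} h" by (rule integral_spike[OF neg]) (auto simp: h_def)
  moreover have "\<And>x. x \<in> {a..b} \<Longrightarrow> f x \<le> h x" using N(2) by (auto simp: h_def)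
  ultimately show ?thesis using integral_le[OF f] by simp
qed

lemma integrable_on_subinterval_lebesgue_on:
  fixes f :: "real \<Rightarrow> real"
  assumes "integrable (lebesgue_on {0<..<T}) f" "0 < a" "b < T"
  shows "f integrable_on {a..b}"
proof -
  have "f integrable_on {0<..<T}" using integrable_on_lebesgue_on[OF assms(1)] by simp
  then have "f integrable_on {0..T}" by (simp add: integrable_on_Icc_iff_Ioo)
  then show ?thesis by (rule integrable_on_subinterval) (use assms in auto)
qed

lemma continuous_on_imp_integrable_lebesgue_on:
  fixes f :: "real \<Rightarrow> real"
  assumes "continuous_on {0..T} f"
  shows "integrable (lebesgue_on {0<..<T}) f"
proof -
  have "f absolutely_integrable_on {0..T}" by (rule absolutely_integrable_continuous_real[OF assms])
  then have "f absolutely_integrable_on {0<..<T}" by (rule set_integrable_subset) auto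
  then show ?thesis by (rule absolutely_integrable_imp_integrable) simp
qed

text \<open>
  Integrating a backward difference leaves two averages near the end points. This discrete
  fundamental theorem is applied both to the energy and to the primitive of the approximation error,
  where it takes the place of exchanging two integrations.
\<close>

lemma integral_diff_shift:
  fixes f :: "real \<Rightarrow> real"
  assumes f: "continuous_on {a - \<delta>..b} f" and ab: "a \<le> b" and \<delta>: "\<delta> \<ge> 0"
  shows "integral {a..b} (\<lambda>s. f s - f (s - \<delta>)) = integral {b - \<delta>..b} f - integral {a - \<delta>..a} f"
proof -
  have i: "f integrable_on {c..d}" if "a - \<delta> \<le> c" "d \<le> b" for c d
    by (rule integrable_continuous_real[OF continuous_on_subset[OF f]]) (use that in auto)
  have sh: "integral {a..b} (\<lambda>s. f (s - \<delta>)) = integral {a - \<delta>..b - \<delta>} f"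
    using integral_shift[of a "- \<delta>" b f] continuous_on_subset[OF f, of "{a - \<delta>..b - \<delta>}"] \<delta>
    by (simp add: o_def)
  have "(\<lambda>s. f (s - \<delta>)) integrable_on {a..b}"
    by (intro integrable_continuous_real continuous_on_compose2[OF f] continuous_intros) (use \<delta> in auto)
  then have "integral {a..b} (\<lambda>s. f s - f (s - \<delta>)) = integral {a..b} f - integral {a - \<delta>..b - \<delta>} f"
    using i[of a b] \<delta> sh by (simp add: Henstock_Kurzweil_Integration.integral_diff)
  moreover have "integral {a - \<delta>..a} f + integral {a..b} f = integral {a - \<delta>..b} f"
    by (rule Henstock_Kurzweil_Integration.integral_combine) (use i ab \<delta> in auto)
  moreover have "integral {a - \<delta>..b - \<delta>} f + integral {b - \<delta>..b} f = integral {a - \<delta>..b} f"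
    by (rule Henstock_Kurzweil_Integration.integral_combine) (use i ab \<delta> in auto)
  ultimately show ?thesis by simp
qed

lemma integrable_coefficient_ip:
  fixes A :: "real \<Rightarrow> real" and G :: "real \<Rightarrow> 'a \<Rightarrow> 'b::euclidean_space"
  assumes A: "continuous_on {0..T} A" and G: "strongly_measurable M T G"
    and Gi: "integrable (lebesgue_on {0<..<T}) (\<lambda>t. (nrm M (G t))\<^sup>2)" and h: "square_integrable M h"
  shows "integrable (lebesgue_on {0<..<T}) (\<lambda>t. A t * ip M (G t) h)"
proof -
  let ?L = "lebesgue_on {0<..<T}"
  have "compact (A ` {0..T})" by (rule compact_continuous_image[OF A]) simp
  then obtain B where B: "\<And>y. y \<in> A ` {0..T} \<Longrightarrow> norm y \<le> B"
    using compact_imp_bounded bounded_iff by metis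
  have Am: "A \<in> borel_measurable ?L"
    by (rule continuous_imp_measurable_on_sets_lebesgue[OF continuous_on_subset[OF A]]) auto
  have m: "(\<lambda>t. A t * ip M (G t) h) \<in> borel_measurable ?L"
    by (rule borel_measurable_times[OF Am borel_measurable_ip[OF G h]])
  have gsq: "AE t in ?L. square_integrable M (G t)"
    using G unfolding strongly_measurable_def by (auto elim!: eventually_mono)
  have bi: "integrable ?L (\<lambda>t. B * ((nrm M (G t))\<^sup>2 + (nrm M h)\<^sup>2))"
    using Gi continuous_on_imp_integrable_lebesgue_on[of T "\<lambda>t. (nrm M h)\<^sup>2"] by simp
  show ?thesis
  proof (rule Bochner_Integration.integrable_bound[OF bi m])
    show "AE t in ?L. norm (A t * ip M (G t) h) \<le> norm (B * ((nrm M (G t))\<^sup>2 + (nrm M h)\<^sup>2))"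
      using gsq AE_space
    proof eventually_elim
      case (elim t)
      have AB: "\<bar>A t\<bar> \<le> B" using B[of "A t"] elim(2) by simp
      have "\<bar>ip M (G t) h\<bar> \<le> nrm M (G t) * nrm M h" using elim(1) h by (rule ip_Cauchy_Schwarz)
      also have "\<dots> \<le> (nrm M (G t))\<^sup>2 + (nrm M h)\<^sup>2"
      proof -
        have "0 \<le> nrm M (G t) * nrm M h" by simp
        then show ?thesis using sum_squares_bound[of "nrm M (G t)" "nrm M h"] by linarith
      qed
      finally have "\<bar>A t\<bar> * \<bar>ip M (G t) h\<bar> \<le> B * ((nrm M (G t))\<^sup>2 + (nrm M h)\<^sup>2)"
        using AB by (intro mult_mono) auto
      moreover have "B \<ge> 0" using AB by linarith
      ultimately show ?case by (simp add: abs_mult)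
    qed
  qed
qed

lemma power2_sum3_le: "(a + b + c)\<^sup>2 \<le> 3 * (a\<^sup>2 + b\<^sup>2 + c\<^sup>2)" for a b c :: real
proof -
  have "0 \<le> (a - b)\<^sup>2 + (b - c)\<^sup>2 + (a - c)\<^sup>2" by simp
  then show ?thesis by (simp add: power2_eq_square algebra_simps)
qed

text \<open>
  The pointwise core of the energy inequality: by polarization the mixed term becomes
  \<open>At * (\<parallel>Gt - Gs\<parallel>\<^sup>2 - \<parallel>Gt\<parallel>\<^sup>2 - \<parallel>Gs\<parallel>\<^sup>2)\<close>. The first square is estimated through the
  nearby values \<open>zt\<close> and \<open>zs\<close> of a continuous curve, and the Poincare inequality applies to the
  other two.
\<close>

lemma integrand_bound:
  assumes sq: "square_integrable M Gt" "square_integrable M Gs" "square_integrable M zt" "square_integrable M zs"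
    and A: "m \<le> At" "At \<le> B" and pos: "m \<ge> 0" "cp > 0"
    and poin: "Et \<le> cp * (nrm M Gt)\<^sup>2" "Es \<le> cp * (nrm M Gs)\<^sup>2"
    and close: "(nrm M (\<lambda>x. zt x - zs x))\<^sup>2 \<le> \<epsilon>" "\<bar>Et - Es\<bar> \<le> \<epsilon>"
  shows "- 2 * (At * ip M Gt Gs) \<le>
    3 * B * ((nrm M (\<lambda>x. Gt x - zt x))\<^sup>2 + \<epsilon> + (nrm M (\<lambda>x. Gs x - zs x))\<^sup>2) + m / cp * (\<epsilon> - 2 * Es)"
proof -
  let ?a = "nrm M (\<lambda>x. Gt x - zt x)" and ?b = "nrm M (\<lambda>x. zt x - zs x)" and ?c = "nrm M (\<lambda>x. Gs x - zs x)"
  let ?d = "nrm M (\<lambda>x. Gt x - Gs x)"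
  have "?d \<le> ?a + nrm M (\<lambda>x. zt x - Gs x)" using sq by (intro nrm_triangle_diff)
  also have "nrm M (\<lambda>x. zt x - Gs x) \<le> ?b + nrm M (\<lambda>x. zs x - Gs x)" using sq by (intro nrm_triangle_diff)
  also have "nrm M (\<lambda>x. zs x - Gs x) = ?c" by (rule nrm_minus_commute)
  finally have "?d\<^sup>2 \<le> (?a + ?b + ?c)\<^sup>2" by (intro power_mono) auto
  also have "\<dots> \<le> 3 * (?a\<^sup>2 + ?b\<^sup>2 + ?c\<^sup>2)" by (rule power2_sum3_le)
  also have "\<dots> \<le> 3 * (?a\<^sup>2 + \<epsilon> + ?c\<^sup>2)" using close by simp
  finally have d: "?d\<^sup>2 \<le> 3 * (?a\<^sup>2 + \<epsilon> + ?c\<^sup>2)" .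
  have "- 2 * (At * ip M Gt Gs) = At * ?d\<^sup>2 - At * ((nrm M Gt)\<^sup>2 + (nrm M Gs)\<^sup>2)"
    unfolding nrm_diff_square[OF sq(1,2)] by (simp add: algebra_simps)
  moreover have "At * ?d\<^sup>2 \<le> B * (3 * (?a\<^sup>2 + \<epsilon> + ?c\<^sup>2))"
    using A pos d by (intro mult_mono) auto
  moreover have "m / cp * (Et + Es) \<le> At * ((nrm M Gt)\<^sup>2 + (nrm M Gs)\<^sup>2)"
  proof -
    have "m / cp * (Et + Es) \<le> m / cp * (cp * ((nrm M Gt)\<^sup>2 + (nrm M Gs)\<^sup>2))"
      using poin pos by (intro mult_left_mono) (auto simp: algebra_simps)
    also have "\<dots> = m * ((nrm M Gt)\<^sup>2 + (nrm M Gs)\<^sup>2)" using pos by simp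
    also have "\<dots> \<le> At * ((nrm M Gt)\<^sup>2 + (nrm M Gs)\<^sup>2)" using A by (intro mult_right_mono) auto
    finally show ?thesis .
  qed
  moreover have "m / cp * (2 * Es - \<epsilon>) \<le> m / cp * (Et + Es)"
    using close pos by (intro mult_left_mono) auto
  ultimately show ?thesis by (simp add: algebra_simps)
qed


lemma L2_continuous_bounded:
  assumes u: "L2_continuous M S u" and S: "compact S"
  obtains K where "K > 0" "\<And>t. t \<in> S \<Longrightarrow> nrm M (u t) \<le> K"
proof -
  have "continuous_on S (\<lambda>t. nrm M (u t))"
    using continuous_on_real_sqrt[OF L2_continuous_norm_square[OF u]] by simp
  then have "compact ((\<lambda>t. nrm M (u t)) ` S)" using S by (rule compact_continuous_image)
  then obtain K where K: "\<And>y. y \<in> (\<lambda>t. nrm M (u t)) ` S \<Longrightarrow> norm y \<le> K"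
    using compact_imp_bounded bounded_iff by metis
  have "nrm M (u t) \<le> max K 1" if "t \<in> S" for t using K[of "nrm M (u t)"] that by fastforce
  then show ?thesis using that[of "max K 1"] by auto
qed

text \<open>
  The inequality for \<open>s\<close> and \<open>s - \<delta>\<close>, obtained by testing with \<open>u s\<close>, is integrated over
  \<open>s \<in> {t1..t2}\<close> and divided by \<open>\<delta>\<close>. The step \<open>\<delta>\<close> is fixed by uniform continuity in terms of
  \<open>\<epsilon>\<close>, so that only \<open>\<epsilon>\<close> has to tend to zero afterwards. Here \<open>G\<close> stands for the gradient of
  \<open>u\<close>, to which it is tied by the Poincare inequality and the integrated equation.
\<close>

lemma energy_inequality_eps:
  fixes u F :: "real \<Rightarrow> 'a \<Rightarrow> real" and G :: "real \<Rightarrow> 'a \<Rightarrow> 'b::euclidean_space"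
  assumes u: "L2_continuous M {0..T} u" and F: "L2_continuous M {0..T} F"
    and A: "continuous_on {0..T} A" "\<And>t. t \<in> {0..T} \<Longrightarrow> m \<le> A t" and m: "m \<ge> 0" "cp > 0"
    and B: "\<And>t. t \<in> {0..T} \<Longrightarrow> A t \<le> B" "B \<ge> 0"
    and G: "strongly_measurable M T G"
    and Gi: "integrable (lebesgue_on {0<..<T}) (\<lambda>t. (nrm M (G t))\<^sup>2)"
    and poin: "AE t in lebesgue_on {0<..<T}. (nrm M (u t))\<^sup>2 \<le> cp * (nrm M (G t))\<^sup>2"
    and eq: "AE s in lebesgue_on {0<..<T}. \<forall>r1 r2. 0 < r1 \<and> r1 \<le> r2 \<and> r2 < T \<longrightarrow>
       ip M (u r2) (u s) - ip M (u r1) (u s)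
         = integral {r1..r2} (\<lambda>\<tau>. ip M (F \<tau>) (u s) - A \<tau> * ip M (G \<tau>) (G s))"
    and t: "0 < t1" "t1 \<le> t2" "t2 < T" and \<epsilon>: "\<epsilon> > 0"
  defines "R \<equiv> \<lambda>s. 2 * ip M (F s) (u s) - 2 * (m / cp) * (nrm M (u s))\<^sup>2"
  shows "(nrm M (u t2))\<^sup>2 - (nrm M (u t1))\<^sup>2 \<le> integral {t1..t2} R
     + \<epsilon> * (2 + 6 * B + (3 * B + m / cp + 1) * (t2 - t1))"
proof -
  let ?L = "lebesgue_on {0<..<T}"
  define E where "E t = (nrm M (u t))\<^sup>2" for t
  have Ec: "continuous_on {0..T} E" unfolding E_def by (rule L2_continuous_norm_square[OF u])
  have usq: "square_integrable M (u t)" if "t \<in> {0..T}" for t using u that by (auto simp: L2_continuous_def)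
  have Fsq: "square_integrable M (F t)" if "t \<in> {0..T}" for t using F that by (auto simp: L2_continuous_def)
  obtain z where z: "L2_continuous M UNIV z"
    "integrable ?L (\<lambda>t. (nrm M (\<lambda>x. G t x - z t x))\<^sup>2)"
    "(LINT t|?L. (nrm M (\<lambda>x. G t x - z t x))\<^sup>2) < \<epsilon>"
    using strongly_measurable_approx_continuous[OF G Gi \<epsilon>] by blast
  have zsq: "square_integrable M (z t)" for t using z(1) by (simp add: L2_continuous_def)
  \<comment> \<open>The squared distance to the continuous curve; its integral over the whole time interval is below \<open>\<epsilon>\<close>.\<close>
  define p where "p t = (nrm M (\<lambda>x. G t x - z t x))\<^sup>2" for t
  have pL: "integrable ?L p" "(LINT t|?L. p t) < \<epsilon>" using z(2,3) by (simp_all add: p_def[abs_def])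
  have p0: "p t \<ge> 0" for t by (simp add: p_def)
  obtain K where K: "K > 0" "\<And>t. t \<in> {0..T} \<Longrightarrow> nrm M (u t) \<le> K"
    using L2_continuous_bounded[OF u] by auto
  obtain d1 where d1: "d1 > 0" "\<And>s t. s \<in> {0..T} \<Longrightarrow> t \<in> {0..T} \<Longrightarrow> \<bar>s - t\<bar> < d1 \<Longrightarrow>
      nrm M (\<lambda>x. z s x - z t x) < sqrt \<epsilon>"
    using L2_continuous_uniform[OF L2_continuous_subset[OF z(1), of "{0..T}"], of "sqrt \<epsilon>"] \<epsilon> by auto
  obtain d2 where d2: "d2 > 0" "\<And>s t. s \<in> {0..T} \<Longrightarrow> t \<in> {0..T} \<Longrightarrow> \<bar>s - t\<bar> < d2 \<Longrightarrow>
      nrm M (\<lambda>x. F s x - F t x) < \<epsilon> / (2 * K)"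
    using L2_continuous_uniform[OF F, of "\<epsilon> / (2 * K)"] \<epsilon> K(1) by auto
  obtain d3 where d3: "d3 > 0" "\<And>s t. s \<in> {0..T} \<Longrightarrow> t \<in> {0..T} \<Longrightarrow> \<bar>s - t\<bar> < d3 \<Longrightarrow> \<bar>E s - E t\<bar> < \<epsilon>"
    using compact_uniformly_continuous[OF Ec] \<epsilon>
    unfolding uniformly_continuous_on_def dist_real_def by fastforce
  \<comment> \<open>The bound \<open>t1\<close> keeps \<open>s - \<delta>\<close> positive for all \<open>s \<ge> t1\<close>.\<close>
  define \<delta> where "\<delta> = min (min d1 d2) (min d3 t1) / 2"
  have \<delta>: "\<delta> > 0" "\<delta> < d1" "\<delta> < d2" "\<delta> < d3" "\<delta> < t1"
    using d1(1) d2(1) d3(1) t(1) by (auto simp: \<delta>_def)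
  define a0 where "a0 = t1 - \<delta>"
  have a0: "0 < a0" using \<delta> by (simp add: a0_def)
  have p_on: "p integrable_on {a..b}" if "0 < a" "b < T" for a b
    by (rule integrable_on_subinterval_lebesgue_on[OF pL(1) that])
  define P where "P s = integral {a0..s} p" for s
  have P_int: "integral {s - \<delta>..s} p = P s - P (s - \<delta>)" if "s \<in> {t1..t2}" for s
    using Henstock_Kurzweil_Integration.integral_combine[of a0 "s - \<delta>" s p] p_on[of a0 s] that a0 t \<delta>
    by (simp add: P_def a0_def)
  have Pc: "continuous_on {a0..t2} P"
    unfolding P_def by (rule indefinite_integral_continuous_1[OF p_on]) (use a0 t in auto)
  have Pb: "0 \<le> P s" "P s \<le> \<epsilon>" if "s \<in> {a0..t2}" for s
  proof -
    have i: "p integrable_on {a0..s}" by (rule p_on) (use a0 t that in auto)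
    show "0 \<le> P s" unfolding P_def by (rule Henstock_Kurzweil_Integration.integral_nonneg[OF i p0])
    have "P s \<le> integral {0<..<T} p" unfolding P_def
      by (rule integral_subset_le[OF _ i integrable_on_lebesgue_on[OF pL(1)]]) (use a0 t that p0 in auto)
    also have "\<dots> = (LINT t|?L. p t)" by (rule lebesgue_integral_eq_integral[OF pL(1), symmetric]) simp
    finally show "P s \<le> \<epsilon>" using pL(2) by simp
  qed
  define c where "c s = R s + \<epsilon> * (3 * B + m / cp + 1)" for s
  have gsq: "AE t in ?L. square_integrable M (G t)"
    using G unfolding strongly_measurable_def by (auto elim!: eventually_mono)
  \<comment> \<open>Testing with \<open>u s\<close>, which is possible for almost every \<open>s\<close>. The term \<open>p \<tau>\<close> is kept as an increment of its primitive \<open>P\<close>.\<close>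
  have key: "AE s in ?L. s \<in> {t1..t2} \<longrightarrow> E s - E (s - \<delta>) \<le> 3 * B * (P s - P (s - \<delta>)) + \<delta> * (3 * B * p s + c s)"
    using gsq poin eq AE_space
  proof eventually_elim
    case (elim s)
    show ?case
    proof
      assume s: "s \<in> {t1..t2}"
      let ?I = "{s - \<delta>..s}"
      have sT: "s \<in> {0..T}" "s - \<delta> \<in> {0..T}" "0 < s - \<delta>" "s < T" using s t \<delta> by auto
      let ?k = "\<lambda>\<tau>. ip M (F \<tau>) (u s) - A \<tau> * ip M (G \<tau>) (G s)"
      have kL: "integrable ?L ?k"
        by (intro Bochner_Integration.integrable_diff integrable_coefficient_ip A G Gi elim(1)
            continuous_on_imp_integrable_lebesgue_on L2_continuous_ip F L2_continuous_const usq sT(1))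
      have k_on: "?k integrable_on ?I" by (rule integrable_on_subinterval_lebesgue_on[OF kL sT(3,4)])
      have "E s - E (s - \<delta>) \<le> 2 * (ip M (u s) (u s) - ip M (u (s - \<delta>)) (u s))"
      proof -
        have "0 \<le> (nrm M (\<lambda>x. u s x - u (s - \<delta>) x))\<^sup>2" by simp
        then show ?thesis unfolding nrm_diff_square[OF usq[OF sT(1)] usq[OF sT(2)]] E_def
          by (simp add: nrm_square ip_commute[of M "u (s - \<delta>)" "u s"])
      qed
      also have "\<dots> = 2 * integral ?I ?k"
        using elim(3) sT(3,4) \<delta>(1) by simp
      also have "\<dots> = integral ?I (\<lambda>\<tau>. 2 * ?k \<tau>)"
        by (rule Henstock_Kurzweil_Integration.integral_mult_right[symmetric])
      also have "\<dots> \<le> integral ?I (\<lambda>\<tau>. 3 * B * p \<tau> + (3 * B * p s + c s))"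
      proof (rule integral_mono_AE_Icc)
        show "(\<lambda>\<tau>. 2 * ?k \<tau>) integrable_on ?I" by (rule integrable_on_mult_right[OF k_on])
        show "(\<lambda>\<tau>. 3 * B * p \<tau> + (3 * B * p s + c s)) integrable_on ?I"
          by (intro integrable_add integrable_on_mult_right p_on sT integrable_const_ivl)
        have "AE \<tau> in ?L. \<tau> \<in> ?I \<longrightarrow> 2 * ?k \<tau> \<le> 3 * B * p \<tau> + (3 * B * p s + c s)"
          using gsq poin AE_space
        proof (eventually_elim, intro impI)
          fix \<tau> assume G\<tau>: "square_integrable M (G \<tau>)" and p\<tau>: "(nrm M (u \<tau>))\<^sup>2 \<le> cp * (nrm M (G \<tau>))\<^sup>2"
            and \<tau>: "\<tau> \<in> space ?L" "\<tau> \<in> ?I"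
          have \<tau>T: "\<tau> \<in> {0..T}" and near: "\<bar>\<tau> - s\<bar> \<le> \<delta>" using \<tau> by auto
          have zc: "(nrm M (\<lambda>x. z \<tau> x - z s x))\<^sup>2 \<le> \<epsilon>"
          proof -
            have "nrm M (\<lambda>x. z \<tau> x - z s x) < sqrt \<epsilon>" using d1(2)[OF \<tau>T sT(1)] near \<delta> by linarith
            then have "(nrm M (\<lambda>x. z \<tau> x - z s x))\<^sup>2 \<le> (sqrt \<epsilon>)\<^sup>2" by (intro power_mono) auto
            then show ?thesis using \<epsilon> by simp
          qed
          have Ecl: "\<bar>E \<tau> - E s\<bar> \<le> \<epsilon>" using d3(2)[OF \<tau>T sT(1)] near \<delta> by linarith
          have Fc: "2 * ip M (F \<tau>) (u s) \<le> 2 * ip M (F s) (u s) + \<epsilon>"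
          proof -
            have "ip M (F \<tau>) (u s) - ip M (F s) (u s) = ip M (\<lambda>x. F \<tau> x - F s x) (u s)"
              by (rule ip_diff_left[OF Fsq[OF \<tau>T] Fsq[OF sT(1)] usq[OF sT(1)], symmetric])
            also have "\<dots> \<le> nrm M (\<lambda>x. F \<tau> x - F s x) * nrm M (u s)"
              using ip_Cauchy_Schwarz[OF square_integrable_diff[OF Fsq[OF \<tau>T] Fsq[OF sT(1)]] usq[OF sT(1)]] by linarith
            also have "\<dots> \<le> \<epsilon> / (2 * K) * K"
              using d2(2)[OF \<tau>T sT(1)] near \<delta> K(2)[OF sT(1)] \<epsilon> K(1) by (intro mult_mono) auto
            also have "\<dots> = \<epsilon> / 2" using K(1) by simp
            finally show ?thesis by simp
          qed
          have "- 2 * (A \<tau> * ip M (G \<tau>) (G s)) \<le> 3 * B * (p \<tau> + \<epsilon> + p s) + m / cp * (\<epsilon> - 2 * E s)"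
            unfolding p_def using zc Ecl p\<tau> elim(2)
            by (intro integrand_bound[where Et="E \<tau>"] G\<tau> elim(1) zsq A(2) B(1) \<tau>T m) (auto simp: E_def)
          then show "2 * ?k \<tau> \<le> 3 * B * p \<tau> + (3 * B * p s + c s)"
            using Fc unfolding c_def R_def E_def by (simp add: algebra_simps)
        qed
        then have "AE \<tau> in lebesgue. \<tau> \<in> {0<..<T} \<longrightarrow> \<tau> \<in> ?I \<longrightarrow> 2 * ?k \<tau> \<le> 3 * B * p \<tau> + (3 * B * p s + c s)"
          by (simp add: AE_restrict_space_iff)
        then show "AE \<tau> in lebesgue. \<tau> \<in> ?I \<longrightarrow> 2 * ?k \<tau> \<le> 3 * B * p \<tau> + (3 * B * p s + c s)"
          using sT by (elim eventually_mono) auto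
      qed
      also have "\<dots> = 3 * B * integral ?I p + \<delta> * (3 * B * p s + c s)"
      proof -
        have "integral ?I (\<lambda>\<tau>. 3 * B * p \<tau> + (3 * B * p s + c s))
            = integral ?I (\<lambda>\<tau>. 3 * B * p \<tau>) + integral ?I (\<lambda>\<tau>. 3 * B * p s + c s)"
          by (intro Henstock_Kurzweil_Integration.integral_add integrable_on_mult_right p_on sT integrable_const_ivl)
        then show ?thesis using \<delta>(1) by simp
      qed
      finally show "E s - E (s - \<delta>) \<le> 3 * B * (P s - P (s - \<delta>)) + \<delta> * (3 * B * p s + c s)"
        unfolding P_int[OF s] .
    qed
  qed
  let ?J = "{t1..t2}"
  have Ec': "continuous_on {t1 - \<delta>..t2} E" by (rule continuous_on_subset[OF Ec]) (use t \<delta> in auto)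
  have Pc': "continuous_on {t1 - \<delta>..t2} P" using Pc by (simp add: a0_def)
  have sub: "continuous_on ?J (\<lambda>s. f (s - \<delta>))" "continuous_on ?J f"
    if "continuous_on {t1 - \<delta>..t2} f" for f :: "real \<Rightarrow> real"
    using \<delta>(1) by (auto intro!: continuous_on_compose2[OF that] continuous_on_subset[OF that] continuous_intros)
  have Rc: "continuous_on ?J R"
    unfolding R_def
    by (intro continuous_on_diff continuous_on_mult continuous_on_const L2_continuous_ip L2_continuous_norm_square
        L2_continuous_subset[OF F] L2_continuous_subset[OF u]) (use t in auto)
  have R_on: "R integrable_on ?J" by (rule integrable_continuous_real[OF Rc])
  have pJ: "p integrable_on ?J" by (rule p_on) (use t in auto)
  have "integral ?J (\<lambda>s. E s - E (s - \<delta>))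
      \<le> integral ?J (\<lambda>s. 3 * B * (P s - P (s - \<delta>)) + \<delta> * (3 * B * p s + c s))"
  proof (rule integral_mono_AE_Icc)
    show "(\<lambda>s. E s - E (s - \<delta>)) integrable_on ?J"
      by (intro integrable_continuous_real continuous_on_diff sub Ec')
    show "(\<lambda>s. 3 * B * (P s - P (s - \<delta>)) + \<delta> * (3 * B * p s + c s)) integrable_on ?J"
      unfolding c_def
      by (intro integrable_add integrable_on_mult_right pJ R_on integrable_const_ivl
          integrable_continuous_real continuous_on_diff sub Pc')
    have "AE s in lebesgue. s \<in> {0<..<T} \<longrightarrow> s \<in> ?J \<longrightarrow>
       E s - E (s - \<delta>) \<le> 3 * B * (P s - P (s - \<delta>)) + \<delta> * (3 * B * p s + c s)"
      using key by (simp add: AE_restrict_space_iff)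
    then show "AE s in lebesgue. s \<in> ?J \<longrightarrow>
       E s - E (s - \<delta>) \<le> 3 * B * (P s - P (s - \<delta>)) + \<delta> * (3 * B * p s + c s)"
      using t by (elim eventually_mono) auto
  qed
  also have "\<dots> = 3 * B * integral ?J (\<lambda>s. P s - P (s - \<delta>))
      + \<delta> * (3 * B * integral ?J p + (integral ?J R + \<epsilon> * (3 * B + m / cp + 1) * (t2 - t1)))"
  proof -
    have "((\<lambda>s. 3 * B * (P s - P (s - \<delta>)) + \<delta> * (3 * B * p s + c s)) has_integral
      3 * B * integral ?J (\<lambda>s. P s - P (s - \<delta>))
      + \<delta> * (3 * B * integral ?J p + (integral ?J R + (t2 - t1) *\<^sub>R (\<epsilon> * (3 * B + m / cp + 1))))) ?J"
      unfolding c_def using has_integral_const_real[of "\<epsilon> * (3 * B + m / cp + 1)" t1 t2] t(2)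
      by (intro has_integral_add has_integral_mult_right integrable_integral pJ R_on
          integrable_continuous_real continuous_on_diff sub Pc') auto
    then show ?thesis by (simp add: integral_unique mult.commute)
  qed
  finally have main: "integral ?J (\<lambda>s. E s - E (s - \<delta>)) \<le> \<dots>" by simp
  have Eshift: "integral ?J (\<lambda>s. E s - E (s - \<delta>)) = integral {t2 - \<delta>..t2} E - integral {t1 - \<delta>..t1} E"
    by (rule integral_diff_shift[OF Ec' t(2)]) (use \<delta> in simp)
  have Pshift: "integral ?J (\<lambda>s. P s - P (s - \<delta>)) = integral {t2 - \<delta>..t2} P - integral {t1 - \<delta>..t1} P"
    by (rule integral_diff_shift[OF Pc' t(2)]) (use \<delta> in simp)
  have cont_on: "f integrable_on {a..b}" if "continuous_on {t1 - \<delta>..t2} f" "t1 - \<delta> \<le> a" "b \<le> t2"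
    for f :: "real \<Rightarrow> real" and a b
    by (rule integrable_continuous_real[OF continuous_on_subset[OF that(1)]]) (use that in auto)
  have lower: "\<delta> * y \<le> integral {r - \<delta>..r} f"
    if "continuous_on {t1 - \<delta>..t2} f" "r \<in> ?J" "\<And>s. s \<in> {r - \<delta>..r} \<Longrightarrow> y \<le> f s" for f :: "real \<Rightarrow> real" and r y
  proof -
    have "integral {r - \<delta>..r} (\<lambda>_. y) \<le> integral {r - \<delta>..r} f"
      by (rule integral_le[OF integrable_const_ivl cont_on[OF that(1)] that(3)]) (use that(2) in auto)
    then show ?thesis using \<delta>(1) by simp
  qed
  have upper: "integral {r - \<delta>..r} f \<le> \<delta> * y"
    if "continuous_on {t1 - \<delta>..t2} f" "r \<in> ?J" "\<And>s. s \<in> {r - \<delta>..r} \<Longrightarrow> f s \<le> y" for f :: "real \<Rightarrow> real" and r y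
  proof -
    have "integral {r - \<delta>..r} f \<le> integral {r - \<delta>..r} (\<lambda>_. y)"
      by (rule integral_le[OF cont_on[OF that(1)] integrable_const_ivl that(3)]) (use that(2) in auto)
    then show ?thesis using \<delta>(1) by simp
  qed
  have nearE: "\<bar>E s - E r\<bar> \<le> \<epsilon>" if "r \<in> ?J" "s \<in> {r - \<delta>..r}" for r s
  proof -
    have "s \<in> {0..T}" "r \<in> {0..T}" "\<bar>s - r\<bar> < d3" using that t \<delta> by auto
    then show ?thesis using d3(2) by (simp add: less_imp_le)
  qed
  have e2: "\<delta> * (E t2 - \<epsilon>) \<le> integral {t2 - \<delta>..t2} E"
  proof (rule lower[OF Ec'])
    fix s assume "s \<in> {t2 - \<delta>..t2}"
    then show "E t2 - \<epsilon> \<le> E s" using nearE[of t2 s] t by auto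
  qed (use t in auto)
  have e1: "integral {t1 - \<delta>..t1} E \<le> \<delta> * (E t1 + \<epsilon>)"
  proof (rule upper[OF Ec'])
    fix s assume "s \<in> {t1 - \<delta>..t1}"
    then show "E s \<le> E t1 + \<epsilon>" using nearE[of t1 s] t by auto
  qed (use t in auto)
  have P2: "integral {t2 - \<delta>..t2} P \<le> \<delta> * \<epsilon>"
    by (rule upper[OF Pc']) (use t \<delta> Pb(2) in \<open>auto simp: a0_def\<close>)
  have P1: "\<delta> * 0 \<le> integral {t1 - \<delta>..t1} P"
    by (rule lower[OF Pc']) (use t \<delta> Pb(1) in \<open>auto simp: a0_def\<close>)
  have pJ\<epsilon>: "integral ?J p \<le> \<epsilon>"
  proof -
    have "integral ?J p \<le> integral {a0..t2} p"
      by (rule integral_subset_le[OF _ pJ p_on]) (use a0 t \<delta> p0 in \<open>auto simp: a0_def\<close>)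
    then show ?thesis using Pb(2)[of t2] t \<delta> by (simp add: P_def a0_def)
  qed
  have "3 * B * integral ?J (\<lambda>s. P s - P (s - \<delta>)) \<le> 3 * B * (\<delta> * \<epsilon>)"
    unfolding Pshift using P1 P2 B(2) by (intro mult_left_mono) auto
  moreover have "\<delta> * (3 * B * integral ?J p + (integral ?J R + \<epsilon> * (3 * B + m / cp + 1) * (t2 - t1)))
      \<le> \<delta> * (3 * B * \<epsilon> + (integral ?J R + \<epsilon> * (3 * B + m / cp + 1) * (t2 - t1)))"
    using pJ\<epsilon> B(2) \<delta>(1) by (intro mult_left_mono add_right_mono) auto
  ultimately have "\<delta> * (E t2 - \<epsilon>) - \<delta> * (E t1 + \<epsilon>)
      \<le> 3 * B * (\<delta> * \<epsilon>) + \<delta> * (3 * B * \<epsilon> + (integral ?J R + \<epsilon> * (3 * B + m / cp + 1) * (t2 - t1)))"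
    using main e1 e2 unfolding Eshift by linarith
  then have "\<delta> * (E t2 - E t1) \<le> \<delta> * (integral ?J R + \<epsilon> * (2 + 6 * B + (3 * B + m / cp + 1) * (t2 - t1)))"
    by (simp add: algebra_simps)
  then show ?thesis using \<delta>(1) unfolding E_def by (simp add: mult_le_cancel_left)
qed

lemma continuous_in_L2_iff: "continuous_in_L2 \<Omega> T u \<longleftrightarrow> L2_continuous (lebesgue_on \<Omega>) {0..<T} u"
  by (simp add: continuous_in_L2_def L2_continuous_def sq_L2_space L2_norm_def nrm_def)

lemma H10_H1: "w \<in> H10_space \<Omega> \<Longrightarrow> w \<in> H1_space \<Omega>"
  and H10_square_integrable: "w \<in> H10_space \<Omega> \<Longrightarrow> square_integrable (lebesgue_on \<Omega>) w"
  by (auto simp: H10_space_def H1_space_def sq_L2_space[symmetric])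

text \<open>
  The simple functions with values in \<open>H\<^sub>0\<^sup>1\<close> that approximate \<open>u\<close> yield simple functions that
  approximate its gradient, since gradients of differences are differences of gradients.
\<close>

lemma bochner_L2_grad:
  assumes \<Omega>: "open \<Omega>" "bounded \<Omega>" and u: "bochner_L2 (H10_space \<Omega>) (H1_norm \<Omega>) T u"
  shows "strongly_measurable (lebesgue_on \<Omega>) T (\<lambda>t. grad \<Omega> (u t))"
    and "integrable (lebesgue_on {0<..<T}) (\<lambda>t. (nrm (lebesgue_on \<Omega>) (grad \<Omega> (u t)))\<^sup>2)"
    and "AE t in lebesgue_on {0<..<T}. u t \<in> H10_space \<Omega>"
proof -
  let ?M = "lebesgue_on \<Omega>" and ?L = "lebesgue_on {0<..<T}"
  obtain s where s: "\<And>k. simple_function ?L (s k)" "\<And>k t. t \<in> {0<..<T} \<Longrightarrow> s k t \<in> H10_space \<Omega>"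
    "AE t in ?L. u t \<in> H10_space \<Omega> \<and> (\<lambda>k. H1_norm \<Omega> (\<lambda>x. s k t x - u t x)) \<longlonglongrightarrow> 0"
    and i: "integrable ?L (\<lambda>t. (H1_norm \<Omega> (u t))\<^sup>2)"
    using u unfolding bochner_L2_def by blast
  show H: "AE t in ?L. u t \<in> H10_space \<Omega>" using s(3) by (auto elim!: eventually_mono)
  show m: "strongly_measurable ?M T (\<lambda>t. grad \<Omega> (u t))"
    unfolding strongly_measurable_def
  proof (intro exI[of _ "\<lambda>k t. grad \<Omega> (s k t)"] conjI allI ballI)
    show "simple_function ?L (\<lambda>t. grad \<Omega> (s k t))" for k by (rule simple_function_compose1[OF s(1)])
    show "square_integrable ?M (grad \<Omega> (s k t))" if "t \<in> {0<..<T}" for k t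
      by (rule grad_square_integrable[OF H10_H1[OF s(2)[OF that]]])
    show "AE t in ?L. square_integrable ?M (grad \<Omega> (u t)) \<and>
        (\<lambda>k. nrm ?M (\<lambda>x. grad \<Omega> (s k t) x - grad \<Omega> (u t) x)) \<longlonglongrightarrow> 0"
      using s(3) AE_space
    proof eventually_elim
      case (elim t)
      then have ut: "u t \<in> H1_space \<Omega>" and t: "t \<in> {0<..<T}"
        and lim: "(\<lambda>k. H1_norm \<Omega> (\<lambda>x. s k t x - u t x)) \<longlonglongrightarrow> 0" using H10_H1 by auto
      have "(\<lambda>k. nrm ?M (\<lambda>x. grad \<Omega> (s k t) x - grad \<Omega> (u t) x)) \<longlonglongrightarrow> 0"
      proof (rule tendsto_sandwich[OF _ _ tendsto_const lim])
        show "\<forall>\<^sub>F k in sequentially. nrm ?M (\<lambda>x. grad \<Omega> (s k t) x - grad \<Omega> (u t) x)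
            \<le> H1_norm \<Omega> (\<lambda>x. s k t x - u t x)"
          by (intro always_eventually allI nrm_grad_diff_le_H1_norm \<Omega> H10_H1[OF s(2)[OF t]] ut)
      qed simp
      then show ?case using grad_square_integrable[OF ut] by simp
    qed
  qed
  show "integrable ?L (\<lambda>t. (nrm ?M (grad \<Omega> (u t)))\<^sup>2)"
  proof (rule Bochner_Integration.integrable_bound[OF i])
    show "(\<lambda>t. (nrm ?M (grad \<Omega> (u t)))\<^sup>2) \<in> borel_measurable ?L"
      using borel_measurable_nrm[OF m] by (rule borel_measurable_power)
    have "nrm ?M (grad \<Omega> w) \<le> H1_norm \<Omega> w" for w by (simp add: nrm_def H1_norm_def)
    then have "(nrm ?M (grad \<Omega> w))\<^sup>2 \<le> (H1_norm \<Omega> w)\<^sup>2" for w by (intro power_mono) auto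
    then show "AE t in ?L. norm ((nrm ?M (grad \<Omega> (u t)))\<^sup>2) \<le> norm ((H1_norm \<Omega> (u t))\<^sup>2)" by simp
  qed
qed

lemma integrable_mult_test_function:
  fixes k :: "real \<Rightarrow> real"
  assumes k: "integrable (lebesgue_on {0<..<T}) k" and \<psi>: "\<psi> \<in> test_functions {0<..<T}"
  shows "integrable (lebesgue_on {0<..<T}) (\<lambda>t. k t * \<psi> t)"
proof -
  let ?L = "lebesgue_on {0<..<T}"
  have c: "continuous_on UNIV \<psi>" using \<psi> by (simp add: test_functions_def smooth_fun_continuous)
  have m: "\<psi> \<in> borel_measurable ?L"
    by (rule continuous_imp_measurable_on_sets_lebesgue[OF continuous_on_subset[OF c]]) auto
  have "compact (\<psi> ` {0..T})" by (intro compact_continuous_image continuous_on_subset[OF c]) auto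
  then obtain B where B: "\<And>y. y \<in> \<psi> ` {0..T} \<Longrightarrow> norm y \<le> B"
    using compact_imp_bounded bounded_iff by metis
  show ?thesis
  proof (rule Bochner_Integration.integrable_bound[OF integrable_mult_right[OF integrable_norm[OF k], of B]])
    show "(\<lambda>t. k t * \<psi> t) \<in> borel_measurable ?L" using m k by (intro borel_measurable_times) auto
    show "AE t in ?L. norm (k t * \<psi> t) \<le> norm (B * norm (k t))"
    proof (rule AE_I2)
      fix t assume "t \<in> space ?L"
      then have "\<bar>\<psi> t\<bar> \<le> B" using B[of "\<psi> t"] by auto
      then have "\<bar>k t\<bar> * \<bar>\<psi> t\<bar> \<le> \<bar>k t\<bar> * \<bar>B\<bar>" by (intro mult_left_mono) auto
      then show "norm (k t * \<psi> t) \<le> norm (B * norm (k t))" by (simp add: abs_mult mult.commute)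
    qed
  qed
qed

text \<open>
  The energy inequality for a weak solution of \<open>u' - A(t) \<Delta>u = F\<close> with \<open>A \<ge> m\<close>, with the
  dissipation already estimated by the Poincare inequality. The nonlocal coefficient of the
  system enters only as a continuous function of time.
\<close>

lemma parabolic_energy_inequality:
  fixes \<Omega> :: "'a::euclidean_space set"
  assumes \<Omega>: "open \<Omega>" "bounded \<Omega>"
    and poin: "\<And>w. w \<in> H10_space \<Omega> \<Longrightarrow> (LINT x|lebesgue_on \<Omega>. \<bar>w x\<bar>\<^sup>2)
                     \<le> cp * (LINT x|lebesgue_on \<Omega>. (norm (grad \<Omega> w x))\<^sup>2)"
    and A: "continuous_on {0..T} A" "\<And>t. t \<in> {0..T} \<Longrightarrow> m \<le> A t" and m: "m \<ge> 0" "cp > 0"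
    and u: "L2_continuous (lebesgue_on \<Omega>) {0..T} u" "bochner_L2 (H10_space \<Omega>) (H1_norm \<Omega>) T u"
    and F: "L2_continuous (lebesgue_on \<Omega>) {0..T} F"
    and weak: "\<And>h \<psi>. h \<in> H10_space \<Omega> \<Longrightarrow> \<psi> \<in> test_functions {0<..<T} \<Longrightarrow>
       regular_distr_deriv T (\<lambda>t. L2_inner \<Omega> (u t) h) \<psi>
         + regular_distr T (\<lambda>t. A t * grad_inner \<Omega> (u t) h) \<psi>
       = regular_distr T (\<lambda>t. L2_inner \<Omega> (F t) h) \<psi>"
    and t: "0 < t1" "t1 \<le> t2" "t2 < T"
  shows "(nrm (lebesgue_on \<Omega>) (u t2))\<^sup>2 - (nrm (lebesgue_on \<Omega>) (u t1))\<^sup>2 \<le>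
    integral {t1..t2} (\<lambda>s. 2 * ip (lebesgue_on \<Omega>) (F s) (u s)
       - 2 * (m / cp) * (nrm (lebesgue_on \<Omega>) (u s))\<^sup>2)"
proof -
  let ?M = "lebesgue_on \<Omega>" and ?L = "lebesgue_on {0<..<T}"
  let ?G = "\<lambda>t. grad \<Omega> (u t)"
  note G = bochner_L2_grad[OF \<Omega> u(2)]
  have FTC: "ip ?M (u r2) h - ip ?M (u r1) h
      = integral {r1..r2} (\<lambda>\<tau>. ip ?M (F \<tau>) h - A \<tau> * ip ?M (?G \<tau>) (grad \<Omega> h))"
    if h: "h \<in> H10_space \<Omega>" and r: "0 < r1" "r1 \<le> r2" "r2 < T" for h r1 r2
  proof (rule weak_derivative_FTC[OF _ _ _ r])
    have hsq: "square_integrable ?M h" by (rule H10_square_integrable[OF h])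
    show "continuous_on {0..T} (\<lambda>t. ip ?M (u t) h)"
      by (rule L2_continuous_ip[OF u(1) L2_continuous_const[OF hsq]])
    have Fi: "integrable ?L (\<lambda>t. ip ?M (F t) h)"
      by (rule continuous_on_imp_integrable_lebesgue_on[OF L2_continuous_ip[OF F L2_continuous_const[OF hsq]]])
    have Gi: "integrable ?L (\<lambda>t. A t * ip ?M (?G t) (grad \<Omega> h))"
      by (rule integrable_coefficient_ip[OF A(1) G(1,2) grad_square_integrable[OF H10_H1[OF h]]])
    show "integrable ?L (\<lambda>t. ip ?M (F t) h - A t * ip ?M (?G t) (grad \<Omega> h))"
      using Fi Gi by (rule Bochner_Integration.integrable_diff)
    fix \<psi> assume \<psi>: "\<psi> \<in> test_functions {0<..<T}"
    have "- (LINT t|?L. ip ?M (u t) h * deriv \<psi> t) + (LINT t|?L. A t * ip ?M (?G t) (grad \<Omega> h) * \<psi> t)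
        = (LINT t|?L. ip ?M (F t) h * \<psi> t)"
      using weak[OF h \<psi>]
      by (simp add: regular_distr_deriv_def regular_distr_def L2_inner_ip grad_inner_def ip_def)
    then show "- (LINT t|?L. ip ?M (u t) h * deriv \<psi> t)
        = (LINT t|?L. (ip ?M (F t) h - A t * ip ?M (?G t) (grad \<Omega> h)) * \<psi> t)"
      using Bochner_Integration.integral_diff[OF integrable_mult_test_function[OF Fi \<psi>]
          integrable_mult_test_function[OF Gi \<psi>]]
      by (simp add: left_diff_distrib)
  qed
  have P: "AE t in ?L. (nrm ?M (u t))\<^sup>2 \<le> cp * (nrm ?M (?G t))\<^sup>2"
    using G(3)
  proof eventually_elim
    case (elim t)
    then show ?case using poin[OF elim] by (simp add: nrm_def)
  qed
  have E: "AE s in ?L. \<forall>r1 r2. 0 < r1 \<and> r1 \<le> r2 \<and> r2 < T \<longrightarrow> ip ?M (u r2) (u s) - ip ?M (u r1) (u s)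
         = integral {r1..r2} (\<lambda>\<tau>. ip ?M (F \<tau>) (u s) - A \<tau> * ip ?M (?G \<tau>) (?G s))"
    using G(3) by eventually_elim (auto intro!: FTC)
  have "compact (A ` {0..T})" by (rule compact_continuous_image[OF A(1)]) simp
  then obtain B0 where B0: "\<And>y. y \<in> A ` {0..T} \<Longrightarrow> norm y \<le> B0"
    using compact_imp_bounded bounded_iff by metis
  define B where "B = max B0 0"
  have B: "A t \<le> B" if "t \<in> {0..T}" for t using B0[of "A t"] that unfolding B_def by fastforce
  have B0: "B \<ge> 0" by (simp add: B_def)
  define K where "K = 2 + 6 * B + (3 * B + m / cp + 1) * (t2 - t1)"
  have K: "K > 0" using B0 m t unfolding K_def by (intro add_pos_nonneg mult_nonneg_nonneg) auto
  let ?R = "integral {t1..t2} (\<lambda>s. 2 * ip ?M (F s) (u s) - 2 * (m / cp) * (nrm ?M (u s))\<^sup>2)"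
  show ?thesis
  proof (rule field_le_epsilon)
    fix e :: real assume e: "e > 0"
    have "(nrm ?M (u t2))\<^sup>2 - (nrm ?M (u t1))\<^sup>2 \<le> ?R + e / K * K"
      unfolding K_def
      by (rule energy_inequality_eps[OF u(1) F A m B B0 G(1,2) P E t])
        (use e K in \<open>simp_all add: K_def\<close>)
    then show "(nrm ?M (u t2))\<^sup>2 - (nrm ?M (u t1))\<^sup>2 \<le> ?R + e" using K by simp
  qed
qed

section \<open>Exponential decay\<close>

text \<open>
  \<open>Y\<close> satisfies \<open>Y' \<le> - c Y\<close> only in integrated form. The quantity
  \<open>J r = \<integral>\<^bsub>r\<^esub>\<^bsup>t\<^esup> Y + Y t / c\<close> is differentiable, and the hypothesis says \<open>c * J \<le> Y = - J'\<close>; hence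
  \<open>J r * exp (c * r)\<close> decreases. Since the hypothesis concerns positive times, time zero is
  reached by continuity.
\<close>

lemma integral_Gronwall:
  fixes Y :: "real \<Rightarrow> real"
  assumes Y: "continuous_on {0..T} Y" and c: "c > 0"
    and le: "\<And>t1 t2. 0 < t1 \<Longrightarrow> t1 \<le> t2 \<Longrightarrow> t2 < T \<Longrightarrow> Y t2 + c * integral {t1..t2} Y \<le> Y t1"
    and t: "0 \<le> t" "t < T"
  shows "Y t \<le> Y 0 * exp (- c * t)"
proof (cases "t = 0")
  case False
  with t have t0: "0 < t" by simp
  have Yt: "continuous_on {0..t} Y" by (rule continuous_on_subset[OF Y]) (use t in auto)
  have step: "Y t * exp (c * t) \<le> Y s * exp (c * s)" if s: "0 < s" "s \<le> t" for s
  proof -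
    define J where "J r = integral {0..t} Y - integral {0..r} Y + Y t / c" for r
    have on: "Y integrable_on {0..t}" by (rule integrable_continuous_real[OF Yt])
    have Jeq: "J r = integral {r..t} Y + Y t / c" if "r \<in> {0..t}" for r
      using Henstock_Kurzweil_Integration.integral_combine[of 0 r t Y] on that by (simp add: J_def)
    have Jc: "continuous_on {s..t} (\<lambda>r. J r * exp (c * r))"
      unfolding J_def
      by (intro continuous_intros continuous_on_subset[OF indefinite_integral_continuous_1[OF on]]) (use s in auto)
    have "J t * exp (c * t) \<le> J s * exp (c * s)"
    proof (rule DERIV_nonpos_imp_decreasing_open[OF s(2) _ Jc])
      fix r assume r: "s < r" "r < t"
      have "((\<lambda>r. integral {0..r} Y) has_real_derivative Y r) (at r within {0..t})"
        by (rule integral_has_real_derivative[OF Yt]) (use r s in auto)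
      then have "((\<lambda>r. integral {0..r} Y) has_real_derivative Y r) (at r)"
        using at_within_Icc_at[of 0 r t] r s by simp
      then have "(J has_real_derivative - Y r) (at r)"
        unfolding J_def[abs_def] by (auto intro!: derivative_eq_intros)
      then have "((\<lambda>r. J r * exp (c * r)) has_real_derivative - Y r * exp (c * r) + (exp (c * r) * c) * J r) (at r)"
        by (rule DERIV_mult) (auto intro!: derivative_eq_intros)
      moreover have "- Y r * exp (c * r) + (exp (c * r) * c) * J r \<le> 0"
      proof -
        have "Y t + c * integral {r..t} Y \<le> Y r" using r s t by (intro le) auto
        then have "c * J r \<le> Y r" using Jeq[of r] r s c by (simp add: distrib_left)
        then have "exp (c * r) * (c * J r) \<le> exp (c * r) * Y r" by (intro mult_left_mono) auto
        then show ?thesis by (simp add: algebra_simps)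
      qed
      ultimately show "\<exists>y. ((\<lambda>r. J r * exp (c * r)) has_real_derivative y) (at r) \<and> y \<le> 0" by blast
    qed
    moreover have "J t = Y t / c" by (simp add: J_def)
    moreover have "c * J s \<le> Y s"
      using le[of s t] Jeq[of s] s t c by (simp add: distrib_left)
    then have "J s * exp (c * s) \<le> Y s / c * exp (c * s)"
      using c by (intro mult_right_mono) (auto simp: field_simps)
    ultimately have "Y t / c * exp (c * t) \<le> Y s / c * exp (c * s)" by simp
    then show ?thesis using c by (simp add: field_simps)
  qed
  have "continuous_on {0..t} (\<lambda>s. Y s * exp (c * s))" by (intro continuous_intros Yt)
  then have "((\<lambda>s. Y s * exp (c * s)) \<longlongrightarrow> Y 0 * exp (c * 0)) (at 0 within {0..t})"
    using t0 unfolding continuous_on_def by (metis atLeastAtMost_iff less_imp_le order_refl)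
  then have "((\<lambda>s. Y s * exp (c * s)) \<longlongrightarrow> Y 0) (at_right 0)"
    using t0 by (simp add: at_within_Icc_at_right)
  then have "Y t * exp (c * t) \<le> Y 0"
  proof (rule tendsto_lowerbound)
    show "\<forall>\<^sub>F s in at_right 0. Y t * exp (c * t) \<le> Y s * exp (c * s)"
      using eventually_at_right_less[of 0] eventually_at_right_real[OF t0]
      by eventually_elim (auto intro: step)
  qed simp
  then show ?thesis by (simp add: exp_minus field_simps)
qed simp

lemma square_integrable_Lipschitz:
  fixes \<phi> :: "real \<Rightarrow> real"
  assumes \<phi>: "\<And>s t. \<bar>\<phi> s - \<phi> t\<bar> \<le> K * \<bar>s - t\<bar>" and zero: "\<phi> 0 = 0"
    and w: "square_integrable M w"
  shows "square_integrable M (\<lambda>x. \<phi> (w x))"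
proof -
  have "K-lipschitz_on UNIV \<phi>"
    using \<phi> \<phi>[of 1 0] by (intro lipschitz_onI) (auto simp: dist_real_def)
  then have "continuous_on UNIV \<phi>" by (rule lipschitz_on_continuous_on)
  then have m: "(\<lambda>x. \<phi> (w x)) \<in> borel_measurable M"
    using w measurable_compose[of w M borel, OF _ borel_measurable_continuous_onI]
    by (simp add: square_integrable_def)
  have "integrable M (\<lambda>x. K\<^sup>2 * (norm (w x))\<^sup>2)" using w by (simp add: square_integrable_def)
  then have "integrable M (\<lambda>x. (norm (\<phi> (w x)))\<^sup>2)"
  proof (rule Bochner_Integration.integrable_bound)
    show "AE x in M. norm ((norm (\<phi> (w x)))\<^sup>2) \<le> norm (K\<^sup>2 * (norm (w x))\<^sup>2)"
    proof (rule AE_I2)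
      fix x
      have "\<bar>\<phi> (w x)\<bar>\<^sup>2 \<le> (K * \<bar>w x\<bar>)\<^sup>2" using \<phi>[of "w x" 0] zero by (intro power_mono) auto
      then show "norm ((norm (\<phi> (w x)))\<^sup>2) \<le> norm (K\<^sup>2 * (norm (w x))\<^sup>2)"
        by (simp add: power_mult_distrib)
    qed
  qed (use m in auto)
  then show ?thesis using m by (simp add: square_integrable_def)
qed

lemma nrm_Lipschitz:
  fixes \<phi> :: "real \<Rightarrow> real"
  assumes \<phi>: "\<And>s t. \<bar>\<phi> s - \<phi> t\<bar> \<le> K * \<bar>s - t\<bar>" and zero: "\<phi> 0 = 0"
    and w: "square_integrable M w" "square_integrable M z"
  shows "nrm M (\<lambda>x. \<phi> (w x) - \<phi> (z x)) \<le> K * nrm M (\<lambda>x. w x - z x)"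
proof (rule power2_le_imp_le)
  have K: "K \<ge> 0" using \<phi>[of 1 0] by simp
  then show "0 \<le> K * nrm M (\<lambda>x. w x - z x)" by simp
  have sq: "square_integrable M (\<lambda>x. \<phi> (w x) - \<phi> (z x))" "square_integrable M (\<lambda>x. w x - z x)"
    using w by (auto intro!: square_integrable_diff square_integrable_Lipschitz[OF \<phi> zero])
  have "(LINT x|M. (norm (\<phi> (w x) - \<phi> (z x)))\<^sup>2) \<le> (LINT x|M. K\<^sup>2 * (norm (w x - z x))\<^sup>2)"
  proof (rule integral_mono)
    fix x
    have "\<bar>\<phi> (w x) - \<phi> (z x)\<bar>\<^sup>2 \<le> (K * \<bar>w x - z x\<bar>)\<^sup>2" using \<phi> by (intro power_mono) auto
    then show "(norm (\<phi> (w x) - \<phi> (z x)))\<^sup>2 \<le> K\<^sup>2 * (norm (w x - z x))\<^sup>2"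
      by (simp add: power_mult_distrib)
  qed (use sq in \<open>auto simp: square_integrable_def\<close>)
  then show "(nrm M (\<lambda>x. \<phi> (w x) - \<phi> (z x)))\<^sup>2 \<le> (K * nrm M (\<lambda>x. w x - z x))\<^sup>2"
    by (simp add: nrm_def power_mult_distrib)
qed

lemma L2_continuous_Lipschitz:
  fixes \<phi> :: "real \<Rightarrow> real"
  assumes \<phi>: "\<And>s t. \<bar>\<phi> s - \<phi> t\<bar> \<le> K * \<bar>s - t\<bar>" and zero: "\<phi> 0 = 0"
    and w: "L2_continuous M S w"
  shows "L2_continuous M S (\<lambda>t x. \<phi> (w t x))"
  unfolding L2_continuous_def
proof (intro conjI ballI)
  have sq: "square_integrable M (w t)" if "t \<in> S" for t using w that by (simp add: L2_continuous_def)
  then show "square_integrable M (\<lambda>x. \<phi> (w t x))" if "t \<in> S" for t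
    using that by (intro square_integrable_Lipschitz[OF \<phi> zero])
  fix t assume t: "t \<in> S"
  have "((\<lambda>s. nrm M (\<lambda>x. w s x - w t x)) \<longlongrightarrow> 0) (at t within S)"
    using w t by (simp add: L2_continuous_def)
  then have lim: "((\<lambda>s. K * nrm M (\<lambda>x. w s x - w t x)) \<longlongrightarrow> 0) (at t within S)"
    by (rule tendsto_mult_right_zero)
  show "((\<lambda>s. nrm M (\<lambda>x. \<phi> (w s x) - \<phi> (w t x))) \<longlongrightarrow> 0) (at t within S)"
  proof (rule tendsto_sandwich[OF _ _ tendsto_const lim])
    show "\<forall>\<^sub>F s in at t within S. nrm M (\<lambda>x. \<phi> (w s x) - \<phi> (w t x)) \<le> K * nrm M (\<lambda>x. w s x - w t x)"
    proof -
      have "\<forall>\<^sub>F s in at t within S. s \<in> S" by (simp add: eventually_at_filter)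
      then show ?thesis by eventually_elim (rule nrm_Lipschitz[OF \<phi> zero sq sq[OF t]])
    qed
  qed simp
qed

text \<open>
  Makes the nonlocal coefficient \<open>a (l (u t))\<close> a continuous function of time.
\<close>

lemma L2_continuous_linear_form:
  assumes l: "continuous_linear_form_L2 \<Omega> l" and u: "L2_continuous (lebesgue_on \<Omega>) S u"
  shows "continuous_on S (\<lambda>t. l (u t))"
  unfolding continuous_on_def
proof (intro ballI tendstoI)
  fix t e assume t: "t \<in> S" and e: "(e::real) > 0"
  have sq: "u s \<in> L2_space \<Omega>" if "s \<in> S" for s using u that by (simp add: L2_continuous_def sq_L2_space)
  obtain d where d: "d > 0" "\<And>z. z \<in> L2_space \<Omega> \<Longrightarrow> L2_norm \<Omega> (\<lambda>x. z x - u t x) < d \<Longrightarrow> \<bar>l z - l (u t)\<bar> < e"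
    using l sq[OF t] e unfolding continuous_linear_form_L2_def by blast
  have "((\<lambda>s. nrm (lebesgue_on \<Omega>) (\<lambda>x. u s x - u t x)) \<longlongrightarrow> 0) (at t within S)"
    using u t by (simp add: L2_continuous_def)
  from order_tendstoD(2)[OF this d(1)]
  have "\<forall>\<^sub>F s in at t within S. nrm (lebesgue_on \<Omega>) (\<lambda>x. u s x - u t x) < d" .
  moreover have "\<forall>\<^sub>F s in at t within S. s \<in> S" by (simp add: eventually_at_filter)
  ultimately show "\<forall>\<^sub>F s in at t within S. dist (l (u s)) (l (u t)) < e"
  proof eventually_elim
    case (elim s)
    then show ?case using d(2)[OF sq[OF elim(2)]] by (simp add: L2_norm_def nrm_def dist_real_def)
  qed
qed

text \<open>
  The reaction terms of the two equations are opposite, so together they pair with \<open>u - v\<close>.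
\<close>

lemma ip_Lipschitz_difference_bound:
  fixes \<phi> :: "real \<Rightarrow> real"
  assumes \<phi>: "\<And>s t. \<bar>\<phi> s - \<phi> t\<bar> \<le> K * \<bar>s - t\<bar>" and zero: "\<phi> 0 = 0"
    and u: "square_integrable M u" and v: "square_integrable M v"
  shows "ip M (\<lambda>x. \<phi> (u x - v x)) u + ip M (\<lambda>x. - \<phi> (u x - v x)) v
    \<le> 2 * K * ((nrm M u)\<^sup>2 + (nrm M v)\<^sup>2)"
proof -
  let ?w = "\<lambda>x. u x - v x"
  have K: "K \<ge> 0" using \<phi>[of 1 0] by simp
  have w: "square_integrable M ?w" using u v by (rule square_integrable_diff)
  have \<phi>w: "square_integrable M (\<lambda>x. \<phi> (?w x))" by (rule square_integrable_Lipschitz[OF \<phi> zero w])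
  have "ip M (\<lambda>x. - \<phi> (?w x)) v = - ip M (\<lambda>x. \<phi> (?w x)) v" by (simp add: ip_def)
  then have "ip M (\<lambda>x. \<phi> (?w x)) u + ip M (\<lambda>x. - \<phi> (?w x)) v = ip M (\<lambda>x. \<phi> (?w x)) ?w"
    using ip_diff_right[OF u v \<phi>w] by simp
  also have "\<dots> \<le> nrm M (\<lambda>x. \<phi> (?w x)) * nrm M ?w"
    using ip_Cauchy_Schwarz[OF \<phi>w w] by linarith
  also have "\<dots> \<le> (K * nrm M ?w) * nrm M ?w"
    using nrm_Lipschitz[OF \<phi> zero w square_integrable_zero] zero by (intro mult_right_mono) auto
  also have "\<dots> = K * (nrm M ?w)\<^sup>2" by (simp add: power2_eq_square)
  also have "\<dots> \<le> K * (2 * ((nrm M u)\<^sup>2 + (nrm M v)\<^sup>2))"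
  proof (rule mult_left_mono[OF _ K])
    have "nrm M ?w \<le> nrm M u + nrm M v"
      using nrm_triangle_diff[OF u square_integrable_zero v] by (simp add: nrm_def)
    then have "(nrm M ?w)\<^sup>2 \<le> (nrm M u + nrm M v)\<^sup>2" by (intro power_mono) auto
    also have "\<dots> \<le> 2 * ((nrm M u)\<^sup>2 + (nrm M v)\<^sup>2)"
      using sum_squares_bound[of "nrm M u" "nrm M v"] by (simp add: power2_sum)
    finally show "(nrm M ?w)\<^sup>2 \<le> 2 * ((nrm M u)\<^sup>2 + (nrm M v)\<^sup>2)" .
  qed
  finally show ?thesis by (simp add: algebra_simps)
qed

lemma energy_nrm:
  assumes "square_integrable (lebesgue_on \<Omega>) (u t)" "square_integrable (lebesgue_on \<Omega>) (v t)"
  shows "energy \<Omega> u v t = ((nrm (lebesgue_on \<Omega>) (u t))\<^sup>2 + (nrm (lebesgue_on \<Omega>) (v t))\<^sup>2) / 2"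
  using assms by (simp add: energy_def nrm_def square_integrable_def)

(* The hypothesis f 0 = 0 is not written in the source but is used there through
   |f s| <= M1 * |s|; without it the claim is false (for zero initial data it would
   force u = v = 0, which solves the system only if f 0 = 0). *)

theorem theorem1p3:
  fixes \<Omega> :: "(real ^ 'n) set"
    and \<alpha> M1 M2 m cp :: real
    and f a :: "real \<Rightarrow> real"
    and l :: "(real ^ 'n \<Rightarrow> real) \<Rightarrow> real"
    and u0 v0 :: "real ^ 'n \<Rightarrow> real"
    and u v :: "real \<Rightarrow> real ^ 'n \<Rightarrow> real"
  assumes domain: "bounded_C2_domain \<Omega>"
    and alpha: "\<alpha> > 0"
    and M1: "M1 > 0"
    and f_Lipschitz: "\<forall>s t. \<bar>f s - f t\<bar> \<le> M1 * \<bar>s - t\<bar>"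
    and f_zero: "f 0 = 0"
    and M2: "M2 > 0"
    and a_Lipschitz: "\<forall>s t. \<bar>a s - a t\<bar> \<le> M2 * \<bar>s - t\<bar>"
    and m: "m > 0"
    and a_lower: "\<forall>\<xi>. a \<xi> \<ge> m"
    and l: "continuous_linear_form_L2 \<Omega> l"
    and cp: "cp > 0"
    and Poincare: "\<forall>w\<in>H10_space \<Omega>. (LINT x|lebesgue_on \<Omega>. \<bar>w x\<bar>\<^sup>2)
                     \<le> cp * (LINT x|lebesgue_on \<Omega>. (norm (grad \<Omega> w x))\<^sup>2)"
    and u0: "u0 \<in> L2_space \<Omega>"
    and v0: "v0 \<in> L2_space \<Omega>"
    and solution: "weak_solution \<Omega> \<alpha> f a l u0 v0 u v"
    and smallness: "m > 2 * cp * (M1 + \<alpha>)" "2 * cp * (M1 + \<alpha>) > 0"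
  shows "\<exists>C>0. \<exists>\<eta>>0. \<forall>t\<ge>0. energy \<Omega> u v t \<le> C * energy \<Omega> u v 0 * exp (- \<eta> * t)"
proof -
  let ?M = "lebesgue_on \<Omega>"
  have \<Omega>: "open \<Omega>" "bounded \<Omega>" using domain by (auto simp: bounded_C2_domain_def)
  define K where "K = M1 + \<alpha>"
  define \<phi> where "\<phi> s = \<alpha> * s - f s" for s
  have \<phi>: "\<bar>\<phi> s - \<phi> t\<bar> \<le> K * \<bar>s - t\<bar>" for s t
  proof -
    have "\<bar>\<phi> s - \<phi> t\<bar> = \<bar>\<alpha> * (s - t) - (f s - f t)\<bar>" by (simp add: \<phi>_def algebra_simps)
    also have "\<dots> \<le> \<bar>\<alpha> * (s - t)\<bar> + \<bar>f s - f t\<bar>" by (rule abs_triangle_ineq4)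
    also have "\<dots> \<le> \<alpha> * \<bar>s - t\<bar> + M1 * \<bar>s - t\<bar>"
      using alpha f_Lipschitz by (intro add_mono) (auto simp: abs_mult)
    finally show ?thesis by (simp add: K_def algebra_simps)
  qed
  have \<phi>0: "\<phi> 0 = 0" by (simp add: \<phi>_def f_zero)
  define \<eta> where "\<eta> = 2 * (m / cp) - 4 * K"
  have \<eta>: "\<eta> > 0" using smallness(1) cp by (simp add: \<eta>_def K_def field_simps)
  have "L2_continuous ?M {0..<T} u" "L2_continuous ?M {0..<T} v" if "T > 0" for T
    using solution that unfolding weak_solution_def continuous_in_L2_iff by blast+
  then have uc: "L2_continuous ?M {0..T} u" and vc: "L2_continuous ?M {0..T} v" if "T > 0" for T
    using that by (auto intro!: L2_continuous_subset[of ?M "{0..<T+1}" _ "{0..T}"])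
  have ac: "continuous_on UNIV a"
  proof -
    have "M2-lipschitz_on UNIV a" using a_Lipschitz M2 by (intro lipschitz_onI) (auto simp: dist_real_def)
    then show ?thesis by (rule lipschitz_on_continuous_on)
  qed
  define Y where "Y t = (nrm ?M (u t))\<^sup>2 + (nrm ?M (v t))\<^sup>2" for t
  have decay: "Y t2 + \<eta> * integral {t1..t2} Y \<le> Y t1" if t: "0 < t1" "t1 \<le> t2" "t2 < T" for t1 t2 T
  proof -
    have T: "T > 0" using t by simp
    note uT = uc[OF T] and vT = vc[OF T]
    have sq: "square_integrable ?M (u s)" "square_integrable ?M (v s)" if "s \<in> {0..T}" for s
      using uT vT that by (auto simp: L2_continuous_def)
    let ?w = "\<lambda>t x. u t x - v t x"
    let ?Fu = "\<lambda>t x. \<phi> (?w t x)" and ?Fv = "\<lambda>t x. - \<phi> (?w t x)"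
    have w: "L2_continuous ?M {0..T} ?w"
      using L2_continuous_add[OF uT L2_continuous_Lipschitz[where \<phi>=uminus and K=1, OF _ _ vT]] by simp
    have Fu: "L2_continuous ?M {0..T} ?Fu" by (rule L2_continuous_Lipschitz[OF \<phi> \<phi>0 w])
    have \<phi>': "\<bar>- \<phi> s - - \<phi> t\<bar> \<le> K * \<bar>s - t\<bar>" for s t using \<phi>[of s t] by simp
    have Fv: "L2_continuous ?M {0..T} ?Fv"
      by (rule L2_continuous_Lipschitz[where \<phi>="\<lambda>s. - \<phi> s", OF \<phi>' _ w]) (simp add: \<phi>0)
    have reaction: "- (LINT x|?M. f (?w t x) * h x) + (LINT x|?M. \<alpha> * ?w t x * h x) = L2_inner \<Omega> (?Fu t) h"
        "(LINT x|?M. f (?w t x) * h x) - (LINT x|?M. \<alpha> * ?w t x * h x) = L2_inner \<Omega> (?Fv t) h"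
      if h: "h \<in> H10_space \<Omega>" and t: "t \<in> {0<..<T}" for h t
    proof -
      have wt: "square_integrable ?M (?w t)" using w t by (simp add: L2_continuous_def)
      have "integrable ?M (\<lambda>x. f (?w t x) * h x)"
        using ip_integrable[OF square_integrable_Lipschitz[OF f_Lipschitz[rule_format] f_zero wt] H10_square_integrable[OF h]]
        by simp
      moreover have "integrable ?M (\<lambda>x. \<alpha> * ?w t x * h x)"
        using ip_integrable[OF square_integrable_scaleR[OF wt, of \<alpha>] H10_square_integrable[OF h]] by simp
      ultimately show "- (LINT x|?M. f (?w t x) * h x) + (LINT x|?M. \<alpha> * ?w t x * h x) = L2_inner \<Omega> (?Fu t) h"
        "(LINT x|?M. f (?w t x) * h x) - (LINT x|?M. \<alpha> * ?w t x * h x) = L2_inner \<Omega> (?Fv t) h"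
        by (simp_all add: L2_inner_def \<phi>_def left_diff_distrib Bochner_Integration.integral_diff
            flip: Bochner_Integration.integral_minus)
    qed
    have distr_cong: "regular_distr T g \<psi> = regular_distr T g' \<psi>" if "\<And>t. t \<in> {0<..<T} \<Longrightarrow> g t = g' t" for g g' \<psi>
      unfolding regular_distr_def by (rule Bochner_Integration.integral_cong) (use that in auto)
    have sol: "bochner_L2 (H10_space \<Omega>) (H1_norm \<Omega>) T u" "bochner_L2 (H10_space \<Omega>) (H1_norm \<Omega>) T v"
      and equ: "\<And>h \<psi>. h \<in> H10_space \<Omega> \<Longrightarrow> \<psi> \<in> test_functions {0<..<T} \<Longrightarrow>
           regular_distr_deriv T (\<lambda>t. L2_inner \<Omega> (u t) h) \<psi>
             + regular_distr T (\<lambda>t. a (l (u t)) * grad_inner \<Omega> (u t) h) \<psi>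
           = regular_distr T (\<lambda>t. - (LINT x|?M. f (?w t x) * h x) + (LINT x|?M. \<alpha> * ?w t x * h x)) \<psi>"
      and eqv: "\<And>h \<psi>. h \<in> H10_space \<Omega> \<Longrightarrow> \<psi> \<in> test_functions {0<..<T} \<Longrightarrow>
           regular_distr_deriv T (\<lambda>t. L2_inner \<Omega> (v t) h) \<psi>
             + regular_distr T (\<lambda>t. a (l (v t)) * grad_inner \<Omega> (v t) h) \<psi>
           = regular_distr T (\<lambda>t. (LINT x|?M. f (?w t x) * h x) - (LINT x|?M. \<alpha> * ?w t x * h x)) \<psi>"
      using solution T unfolding weak_solution_def by blast+
    have Pc: "(LINT x|?M. \<bar>w x\<bar>\<^sup>2) \<le> cp * (LINT x|?M. (norm (grad \<Omega> w x))\<^sup>2)" if "w \<in> H10_space \<Omega>" for w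
      using Poincare that by blast
    have Ac: "continuous_on {0..T} (\<lambda>t. a (l (z t)))" if "L2_continuous ?M {0..T} z" for z
      by (rule continuous_on_compose2[OF ac L2_continuous_linear_form[OF l that]]) simp
    have Eu: "(nrm ?M (u t2))\<^sup>2 - (nrm ?M (u t1))\<^sup>2 \<le>
        integral {t1..t2} (\<lambda>s. 2 * ip ?M (?Fu s) (u s) - 2 * (m / cp) * (nrm ?M (u s))\<^sup>2)"
    proof (rule parabolic_energy_inequality[OF \<Omega> Pc Ac[OF uT] _ _ cp uT sol(1) Fu _ t])
      fix h \<psi> assume h: "h \<in> H10_space \<Omega>" "\<psi> \<in> test_functions {0<..<T}"
      show "regular_distr_deriv T (\<lambda>t. L2_inner \<Omega> (u t) h) \<psi>
             + regular_distr T (\<lambda>t. a (l (u t)) * grad_inner \<Omega> (u t) h) \<psi>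
           = regular_distr T (\<lambda>t. L2_inner \<Omega> (?Fu t) h) \<psi>"
        unfolding equ[OF h] by (rule distr_cong) (rule reaction(1)[OF h(1)])
    qed (use a_lower m in auto)
    have Ev: "(nrm ?M (v t2))\<^sup>2 - (nrm ?M (v t1))\<^sup>2 \<le>
        integral {t1..t2} (\<lambda>s. 2 * ip ?M (?Fv s) (v s) - 2 * (m / cp) * (nrm ?M (v s))\<^sup>2)"
    proof (rule parabolic_energy_inequality[OF \<Omega> Pc Ac[OF vT] _ _ cp vT sol(2) Fv _ t])
      fix h \<psi> assume h: "h \<in> H10_space \<Omega>" "\<psi> \<in> test_functions {0<..<T}"
      show "regular_distr_deriv T (\<lambda>t. L2_inner \<Omega> (v t) h) \<psi>
             + regular_distr T (\<lambda>t. a (l (v t)) * grad_inner \<Omega> (v t) h) \<psi>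
           = regular_distr T (\<lambda>t. L2_inner \<Omega> (?Fv t) h) \<psi>"
        unfolding eqv[OF h] by (rule distr_cong) (rule reaction(2)[OF h(1)])
    qed (use a_lower m in auto)
    let ?J = "{t1..t2}"
    have on: "g integrable_on ?J" if "continuous_on {0..T} g" for g :: "real \<Rightarrow> real"
      by (rule integrable_continuous_real[OF continuous_on_subset[OF that]]) (use t in auto)
    have Ru: "(\<lambda>s. 2 * ip ?M (?Fu s) (u s) - 2 * (m / cp) * (nrm ?M (u s))\<^sup>2) integrable_on ?J"
      by (intro on continuous_on_diff continuous_on_mult continuous_on_const L2_continuous_ip[OF Fu uT]
          L2_continuous_norm_square[OF uT])
    have Rv: "(\<lambda>s. 2 * ip ?M (?Fv s) (v s) - 2 * (m / cp) * (nrm ?M (v s))\<^sup>2) integrable_on ?J"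
      by (intro on continuous_on_diff continuous_on_mult continuous_on_const L2_continuous_ip[OF Fv vT]
          L2_continuous_norm_square[OF vT])
    have Yi: "Y integrable_on ?J" unfolding Y_def
      by (intro on continuous_on_add L2_continuous_norm_square uT vT)
    have "Y t2 - Y t1 \<le> integral ?J (\<lambda>s. (2 * ip ?M (?Fu s) (u s) - 2 * (m / cp) * (nrm ?M (u s))\<^sup>2)
        + (2 * ip ?M (?Fv s) (v s) - 2 * (m / cp) * (nrm ?M (v s))\<^sup>2))"
      using Eu Ev Henstock_Kurzweil_Integration.integral_add[OF Ru Rv] by (simp add: Y_def)
    also have "\<dots> \<le> integral ?J (\<lambda>s. - \<eta> * Y s)"
    proof (rule integral_le[OF integrable_add[OF Ru Rv] integrable_on_mult_right[OF Yi]])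
      fix s assume "s \<in> ?J"
      then have s: "s \<in> {0..T}" using t by auto
      have "ip ?M (?Fu s) (u s) + ip ?M (?Fv s) (v s) \<le> 2 * K * Y s"
        unfolding Y_def by (rule ip_Lipschitz_difference_bound[OF \<phi> \<phi>0 sq[OF s]])
      then show "(2 * ip ?M (?Fu s) (u s) - 2 * (m / cp) * (nrm ?M (u s))\<^sup>2)
        + (2 * ip ?M (?Fv s) (v s) - 2 * (m / cp) * (nrm ?M (v s))\<^sup>2) \<le> - \<eta> * Y s"
        unfolding \<eta>_def Y_def by (simp add: algebra_simps)
    qed
    also have "\<dots> = - \<eta> * integral ?J Y" by (rule Henstock_Kurzweil_Integration.integral_mult_right)
    finally show ?thesis by simp
  qed
  have "energy \<Omega> u v t \<le> 1 * energy \<Omega> u v 0 * exp (- \<eta> * t)" if t: "t \<ge> 0" for t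
  proof -
    have T: "t + 1 > 0" using t by simp
    have e: "energy \<Omega> u v s = Y s / 2" if "s \<in> {0..t+1}" for s
      unfolding Y_def by (rule energy_nrm) (use uc[OF T] vc[OF T] that in \<open>auto simp: L2_continuous_def\<close>)
    have Yc: "continuous_on {0..t+1} Y" unfolding Y_def
      by (intro continuous_on_add L2_continuous_norm_square uc[OF T] vc[OF T])
    have "Y t \<le> Y 0 * exp (- \<eta> * t)"
      by (rule integral_Gronwall[OF Yc \<eta> decay t]) auto
    moreover have "energy \<Omega> u v t = Y t / 2" "energy \<Omega> u v 0 = Y 0 / 2"
      using t by (intro e; simp)+
    ultimately show ?thesis by (simp only:)
  qed
  then show ?thesis using \<eta> zero_less_one by blast
qed

end
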